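(* (i) No infinite internal set is of standard size. (ii) Every $\Delta^{\rm ss}_2$ set that is not of standard size contains an infinite internal subset; equivalently, $\mathrm{spn}(X)\supsetneq\mathbb N$ for every $\Delta^{\rm ss}_2$ set $X$ not of standard size. (iii) If $X\subseteq\mathbb I$ is a set of standard size and $Y$ is a $\Delta^{\rm ss}_2$ set that is not of standard size, then $\mathrm{card}^{\rm eff}X<\mathrm{card}^{\rm eff}Y$.
   Context: Work in Hrbacek set theory HST, in the language with $\in$ and a standardness predicate $\mathrm{st}$; its universe contains the standard sets $\mathbb S$, the internal sets $\mathbb I=\{y:\exists^{\mathrm{st}}x\,(y\in x)\}$ (transitive, satisfying ZFC, an elementary extension of $\mathbb S$) and the well-founded sets $\mathbb V$, isomorphic to $\mathbb S$ via $x\mapsto{}^*x$; the universe is the von Neumann superstructure over $\mathbb I$. $\mathbb N\subseteq{}^*\mathbb N$ are the natural and internal natural numbers; $\#x$ is the internal cardinality of an internal $x$. A set is of standard size if it is in bijection with a set in $\mathbb V$. $\Delta^{\rm ss}_2$ sets are the sets representable both as $\bigcup_{a\in A}\bigcap_{b\in B}X_{ab}$ and as $\bigcap_{a\in A}\bigcup_{b\in B}X_{ab}$ with $A,B\in\mathbb V$ and $X_{ab}$ internal. For $X,Y\subseteq\mathbb I$ in $\Delta^{\rm ss}_2$, $\mathrm{card}^{\rm eff}X\le\mathrm{card}^{\rm eff}Y$ means there is a $\Delta^{\rm ss}_2$ injection $X\to Y$ (equivalently an injection in the class $\mathbf L[\mathbb I]$ of sets constructible over $\mathbb I$), and $\mathrm{card}^{\rm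 eff}X<\mathrm{card}^{\rm eff}Y$ means $\mathrm{card}^{\rm eff}X\le\mathrm{card}^{\rm eff}Y$ but not $\mathrm{card}^{\rm eff}Y\le\mathrm{card}^{\rm eff}X$. $\mathrm{spn}(X)=\{\#y:y\in\mathbb I,\ y\subseteq X\}$. *)

theory Defs
  imports Main
begin

text \<open>
  Hrbacek set theory HST is treated through its models: a model is a type \<open>'u\<close> with a binary
  relation (membership) and a unary predicate (standardness) satisfying the axioms of HST.
  The axiom schemata range over genuine first-order formulas with parameters, for which the
  syntax and the satisfaction relation are set up first.
\<close>

datatype fm =
    Mem nat nat
  | Eq nat nat
  | St nat
  | Neg fm
  | And fm fm
  | Ex nat fm

primrec st_free :: "fm \<Rightarrow> bool" where
  "st_free (Mem i j) \<longleftrightarrow> True"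
| "st_free (Eq i j) \<longleftrightarrow> True"
| "st_free (St i) \<longleftrightarrow> False"
| "st_free (Neg p) \<longleftrightarrow> st_free p"
| "st_free (And p q) \<longleftrightarrow> st_free p \<and> st_free q"
| "st_free (Ex i p) \<longleftrightarrow> st_free p"

locale st_structure =
  fixes mem :: "'u \<Rightarrow> 'u \<Rightarrow> bool"  (infix "\<^bold>\<in>" 50)
    and st :: "'u \<Rightarrow> bool"
begin

text \<open>Satisfaction of a formula relativized to the class \<open>D\<close>; free variables are read
  off the assignment \<open>e\<close>, so that an assignment also supplies the parameters.\<close>

primrec sat :: "'u set \<Rightarrow> fm \<Rightarrow> (nat \<Rightarrow> 'u) \<Rightarrow> bool" where
  "sat D (Mem i j) e \<longleftrightarrow> e i \<^bold>\<in> e j"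
| "sat D (Eq i j) e \<longleftrightarrow> e i = e j"
| "sat D (St i) e \<longleftrightarrow> st (e i)"
| "sat D (Neg p) e \<longleftrightarrow> \<not> sat D p e"
| "sat D (And p q) e \<longleftrightarrow> sat D p e \<and> sat D q e"
| "sat D (Ex i p) e \<longleftrightarrow> (\<exists>x\<in>D. sat D p (e(i := x)))"


subsection \<open>Classes and elementary set-theoretic notions\<close>

definition elts :: "'u \<Rightarrow> 'u set" where
  "elts x = {y. y \<^bold>\<in> x}"

definition SS :: "'u set" where
  "SS = {x. st x}"

definition II :: "'u set" where
  "II = {y. \<exists>x. st x \<and> y \<^bold>\<in> x}"

definition VV :: "'u set" where
  "VV = {x. \<exists>T. x \<^bold>\<in> T \<and> (\<forall>y\<in>elts T. elts y \<subseteq> elts T) \<and>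
           (\<forall>s. elts s \<subseteq> elts T \<and> elts s \<noteq> {} \<longrightarrow> (\<exists>m\<in>elts s. elts m \<inter> elts s = {}))}"

text \<open>Kuratowski pairs. The unordered pair exists and is unique in every model of HST.
  A pair of internal sets, formed in the universe, is the pair formed in \<open>II\<close>.\<close>

definition upair :: "'u \<Rightarrow> 'u \<Rightarrow> 'u" where
  "upair a b = (THE z. elts z = {a, b})"

definition pair :: "'u \<Rightarrow> 'u \<Rightarrow> 'u" where
  "pair a b = upair (upair a a) (upair a b)"

definition func :: "'u \<Rightarrow> 'u \<Rightarrow> 'u \<Rightarrow> bool" where
  "func f X Y \<longleftrightarrow>
     (\<forall>p\<in>elts f. \<exists>x\<in>elts X. \<exists>y\<in>elts Y. p = pair x y) \<and>
     (\<forall>x\<in>elts X. \<exists>!y. pair x y \<^bold>\<in> f)"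

definition app :: "'u \<Rightarrow> 'u \<Rightarrow> 'u" where
  "app f x = (THE y. pair x y \<^bold>\<in> f)"

definition injection :: "'u \<Rightarrow> 'u \<Rightarrow> 'u \<Rightarrow> bool" where
  "injection f X Y \<longleftrightarrow> func f X Y \<and> inj_on (app f) (elts X)"

definition bijection :: "'u \<Rightarrow> 'u \<Rightarrow> 'u \<Rightarrow> bool" where
  "bijection f X Y \<longleftrightarrow> func f X Y \<and> bij_betw (app f) (elts X) (elts Y)"

definition standard_size :: "'u \<Rightarrow> bool" where
  "standard_size X \<longleftrightarrow> (\<exists>v\<in>VV. \<exists>f. bijection f X v)"


subsection \<open>Natural numbers and finiteness\<close>

definition closed_under_Suc :: "'u \<Rightarrow> bool" where
  "closed_under_Suc W \<longleftrightarrow>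
     (\<forall>z. elts z = {} \<longrightarrow> z \<^bold>\<in> W) \<and>
     (\<forall>n\<in>elts W. \<forall>m. elts m = insert n (elts n) \<longrightarrow> m \<^bold>\<in> W)"

definition NN :: "'u set" where
  "NN = {n. \<forall>W. closed_under_Suc W \<longrightarrow> n \<^bold>\<in> W}"

text \<open>Finiteness is external: a hyperfinite internal set whose number of elements is a
  nonstandard element of the internal natural numbers is infinite.\<close>

definition finite_set :: "'u \<Rightarrow> bool" where
  "finite_set x \<longleftrightarrow> (\<exists>n\<in>NN. \<exists>f. bijection f x n)"


subsection \<open>Internal cardinality\<close>

text \<open>The following relativize the usual definitions to \<open>II\<close>. Quantifiers over elements
  of internal sets need no relativization, since \<open>II\<close> is transitive in HST.\<close>

definition int_ordinal :: "'u \<Rightarrow> bool" where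
  "int_ordinal k \<longleftrightarrow> k \<in> II \<and>
     (\<forall>x\<in>elts k. elts x \<subseteq> elts k) \<and>
     (\<forall>x\<in>elts k. \<forall>y\<in>elts k. x \<^bold>\<in> y \<or> x = y \<or> y \<^bold>\<in> x) \<and>
     (\<forall>s\<in>II. elts s \<subseteq> elts k \<and> elts s \<noteq> {} \<longrightarrow> (\<exists>m\<in>elts s. elts m \<inter> elts s = {}))"

definition int_equinumerous :: "'u \<Rightarrow> 'u \<Rightarrow> bool" where
  "int_equinumerous x y \<longleftrightarrow> (\<exists>f\<in>II. bijection f x y)"

definition int_card :: "'u \<Rightarrow> 'u" where
  "int_card x = (THE k. int_ordinal k \<and> int_equinumerous x k \<and>
                        (\<forall>j\<in>elts k. \<not> int_equinumerous x j))"

definition spn :: "'u \<Rightarrow> 'u set" where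
  "spn X = {int_card y | y. y \<in> II \<and> elts y \<subseteq> elts X}"


subsection \<open>\<open>\<Delta>\<^sup>s\<^sup>s\<^sub>2\<close> sets and effective cardinals\<close>

definition internal_family :: "'u \<Rightarrow> 'u \<Rightarrow> 'u \<Rightarrow> bool" where
  "internal_family F A B \<longleftrightarrow>
     (\<exists>P Z. elts P = {pair a b | a b. a \<in> elts A \<and> b \<in> elts B} \<and>
            elts Z \<subseteq> II \<and> func F P Z)"

text \<open>If the index set of an intersection is empty, the intersection is the whole universe.
  This adds no sets to the classes below, because in HST the universe is not a set.\<close>

definition Sigma_ss2 :: "'u \<Rightarrow> bool" where
  "Sigma_ss2 X \<longleftrightarrow> (\<exists>A\<in>VV. \<exists>B\<in>VV. \<exists>F. internal_family F A B \<and>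
     elts X = (\<Union>a\<in>elts A. \<Inter>b\<in>elts B. elts (app F (pair a b))))"

definition Pi_ss2 :: "'u \<Rightarrow> bool" where
  "Pi_ss2 X \<longleftrightarrow> (\<exists>A\<in>VV. \<exists>B\<in>VV. \<exists>F. internal_family F A B \<and>
     elts X = (\<Inter>a\<in>elts A. \<Union>b\<in>elts B. elts (app F (pair a b))))"

definition Delta_ss2 :: "'u \<Rightarrow> bool" where
  "Delta_ss2 X \<longleftrightarrow> Sigma_ss2 X \<and> Pi_ss2 X"

definition card_eff_le :: "'u \<Rightarrow> 'u \<Rightarrow> bool" where
  "card_eff_le X Y \<longleftrightarrow> (\<exists>f. Delta_ss2 f \<and> injection f X Y)"

definition card_eff_less :: "'u \<Rightarrow> 'u \<Rightarrow> bool" where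
  "card_eff_less X Y \<longleftrightarrow> card_eff_le X Y \<and> \<not> card_eff_le Y X"


subsection \<open>Axioms relativized to a class\<close>

definition ax_extensionality :: "'u set \<Rightarrow> bool" where
  "ax_extensionality D \<longleftrightarrow>
     (\<forall>x\<in>D. \<forall>y\<in>D. (\<forall>z\<in>D. z \<^bold>\<in> x \<longleftrightarrow> z \<^bold>\<in> y) \<longrightarrow> x = y)"

definition ax_pairing :: "'u set \<Rightarrow> bool" where
  "ax_pairing D \<longleftrightarrow> (\<forall>x\<in>D. \<forall>y\<in>D. \<exists>z\<in>D. \<forall>w\<in>D. w \<^bold>\<in> z \<longleftrightarrow> w = x \<or> w = y)"

definition ax_union :: "'u set \<Rightarrow> bool" where
  "ax_union D \<longleftrightarrow> (\<forall>x\<in>D. \<exists>u\<in>D. \<forall>z\<in>D. z \<^bold>\<in> u \<longleftrightarrow> (\<exists>y\<in>D. y \<^bold>\<in> x \<and> z \<^bold>\<in> y))"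

definition ax_power :: "'u set \<Rightarrow> bool" where
  "ax_power D \<longleftrightarrow> (\<forall>x\<in>D. \<exists>p\<in>D. \<forall>y\<in>D. y \<^bold>\<in> p \<longleftrightarrow> (\<forall>z\<in>D. z \<^bold>\<in> y \<longrightarrow> z \<^bold>\<in> x))"

definition ax_infinity :: "'u set \<Rightarrow> bool" where
  "ax_infinity D \<longleftrightarrow>
     (\<exists>w\<in>D. (\<exists>z\<in>D. z \<^bold>\<in> w \<and> (\<forall>y\<in>D. \<not> y \<^bold>\<in> z)) \<and>
            (\<forall>n\<in>D. n \<^bold>\<in> w \<longrightarrow> (\<exists>m\<in>D. m \<^bold>\<in> w \<and> (\<forall>y\<in>D. y \<^bold>\<in> m \<longleftrightarrow> y \<^bold>\<in> n \<or> y = n))))"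

definition ax_regularity :: "'u set \<Rightarrow> bool" where
  "ax_regularity D \<longleftrightarrow>
     (\<forall>x\<in>D. (\<exists>y\<in>D. y \<^bold>\<in> x) \<longrightarrow> (\<exists>y\<in>D. y \<^bold>\<in> x \<and> \<not> (\<exists>z\<in>D. z \<^bold>\<in> y \<and> z \<^bold>\<in> x)))"

definition ax_choice :: "'u set \<Rightarrow> bool" where
  "ax_choice D \<longleftrightarrow>
     (\<forall>X\<in>D. (\<forall>x\<in>D. x \<^bold>\<in> X \<longrightarrow> (\<exists>z\<in>D. z \<^bold>\<in> x)) \<and>
            (\<forall>x\<in>D. \<forall>y\<in>D. x \<^bold>\<in> X \<and> y \<^bold>\<in> X \<and> x \<noteq> y \<longrightarrow> \<not> (\<exists>z\<in>D. z \<^bold>\<in> x \<and> z \<^bold>\<in> y)) \<longrightarrow>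
            (\<exists>C\<in>D. \<forall>x\<in>D. x \<^bold>\<in> X \<longrightarrow> (\<exists>!z. z \<in> D \<and> z \<^bold>\<in> x \<and> z \<^bold>\<in> C)))"

text \<open>In the schemata, \<open>L\<close> is the set of formulas admitted; variable 0 (and 1) is the
  distinguished one, all others are parameters from \<open>D\<close>.\<close>

definition ax_separation :: "fm set \<Rightarrow> 'u set \<Rightarrow> bool" where
  "ax_separation L D \<longleftrightarrow>
     (\<forall>p\<in>L. \<forall>e. range e \<subseteq> D \<longrightarrow>
        (\<forall>X\<in>D. \<exists>Y\<in>D. \<forall>x\<in>D. x \<^bold>\<in> Y \<longleftrightarrow> x \<^bold>\<in> X \<and> sat D p (e(0 := x))))"

definition ax_replacement :: "fm set \<Rightarrow> 'u set \<Rightarrow> bool" where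
  "ax_replacement L D \<longleftrightarrow>
     (\<forall>p\<in>L. \<forall>e. range e \<subseteq> D \<longrightarrow>
        (\<forall>X\<in>D. (\<forall>x\<in>D. x \<^bold>\<in> X \<longrightarrow> (\<exists>!y. y \<in> D \<and> sat D p (e(0 := x, 1 := y)))) \<longrightarrow>
           (\<exists>Y\<in>D. \<forall>y\<in>D. y \<^bold>\<in> Y \<longleftrightarrow> (\<exists>x\<in>D. x \<^bold>\<in> X \<and> sat D p (e(0 := x, 1 := y))))))"

definition ax_collection :: "fm set \<Rightarrow> 'u set \<Rightarrow> bool" where
  "ax_collection L D \<longleftrightarrow>
     (\<forall>p\<in>L. \<forall>e. range e \<subseteq> D \<longrightarrow>
        (\<forall>X\<in>D. \<exists>Y\<in>D. \<forall>x\<in>D. x \<^bold>\<in> X \<longrightarrow> (\<exists>y\<in>D. sat D p (e(0 := x, 1 := y))) \<longrightarrow>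
           (\<exists>y\<in>D. y \<^bold>\<in> Y \<and> sat D p (e(0 := x, 1 := y)))))"

definition ZFC_on :: "'u set \<Rightarrow> bool" where
  "ZFC_on D \<longleftrightarrow>
     ax_extensionality D \<and> ax_pairing D \<and> ax_union D \<and> ax_power D \<and> ax_infinity D \<and>
     ax_separation {p. st_free p} D \<and> ax_replacement {p. st_free p} D \<and>
     ax_regularity D \<and> ax_choice D"

end


section \<open>Models of HST\<close>

locale HST = st_structure mem st
  for mem :: "'u \<Rightarrow> 'u \<Rightarrow> bool"  (infix "\<^bold>\<in>" 50)
    and st :: "'u \<Rightarrow> bool" +
  \<comment> \<open>Power Set, Choice and Regularity are not assumed for the whole universe.\<close>
  assumes extensionality: "ax_extensionality UNIV"
    and pairing: "ax_pairing UNIV"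
    and union: "ax_union UNIV"
    and infinity: "ax_infinity UNIV"
    and separation: "ax_separation UNIV UNIV"
    and collection: "ax_collection UNIV UNIV"
    and ZFC_st: "ZFC_on SS"
    and transfer: "\<And>p e. st_free p \<Longrightarrow> range e \<subseteq> SS \<Longrightarrow> sat II p e \<longleftrightarrow> sat SS p e"
    and transitivity_of_II: "\<And>x y. x \<in> II \<Longrightarrow> y \<^bold>\<in> x \<Longrightarrow> y \<in> II"
    and regularity_over_II: "\<And>X. elts X \<noteq> {} \<Longrightarrow> \<exists>x\<in>elts X. elts x \<inter> elts X \<subseteq> II"
    and standardization: "\<And>X. \<exists>Y. st Y \<and> elts Y \<inter> SS = elts X \<inter> SS"
    and saturation:
      "\<And>X. \<lbrakk>elts X \<subseteq> II; standard_size X; elts X \<noteq> {}; \<forall>x\<in>elts X. elts x \<noteq> {};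
             \<forall>x\<in>elts X. \<forall>y\<in>elts X. \<exists>z\<in>elts X. elts z = elts x \<inter> elts y\<rbrakk>
            \<Longrightarrow> (\<Inter>x\<in>elts X. elts x) \<noteq> {}"
    and standard_size_choice:
      "\<And>X F Y. \<lbrakk>standard_size X; func F X Y; \<forall>x\<in>elts X. elts (app F x) \<noteq> {}\<rbrakk>
            \<Longrightarrow> \<exists>f Z. func f X Z \<and> (\<forall>x\<in>elts X. app f x \<^bold>\<in> app F x)"
    and dependent_choice:
      "\<And>X R. \<lbrakk>elts X \<noteq> {}; \<forall>x\<in>elts X. \<exists>y\<in>elts X. pair x y \<^bold>\<in> R\<rbrakk>
            \<Longrightarrow> \<exists>W f. elts W = NN \<and> func f W X \<and>
                  (\<forall>n\<in>NN. \<forall>m. elts m = insert n (elts n) \<longrightarrow> pair (app f n) (app f m) \<^bold>\<in> R)"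

end

(* Everything rests on one saturation argument. A set Y = (UN a. INT b. X a b) that is not of
   standard size has an infinite piece K = (INT b. X a b): a union of standard size many finite
   sets is of standard size. If D is a set of internal sets of standard size, the internal
   partial injections whose domain contains a given d in D and whose range lies in a given X a b
   have the finite intersection property because K is infinite, so there is one internal
   injection g into K that is defined on all of D. With D the natural numbers, g is defined on
   some nonstandard internal ordinal, whose image is an infinite internal subset of Y; with D = X,
   the restriction of g to X is a graph of standard size, and such sets are both Sigma and Pi. *)

theory Submission
  imports Defs
begin

section \<open>Definable predicates and terms\<close>

text \<open>The obstacle is syntactic: Separation, Collection and transfer speak of formulas, while
  the argument runs on Isabelle predicates. Hence the calculus of definable predicates
  \<open>dfn\<close> and terms \<open>dtm\<close>, in two copies: all formulas over the universe,
  and st-free formulas over the internal sets, where separation yields internal sets. Partial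
  operations such as \<open>app\<close> are replaced by total definable ones. Neither power sets nor
  full choice are available in the universe, so the set of finite subsets is built by induction on
  their size, and enumerations of standard size many finite sets come from the special choice axiom.
  Finiteness refers to the external \<open>NN\<close>; the finite intersection property is proved by
  induction on finite families, with a partial injection whose range stays inside K and inside some
  finite set. A nonstandard ordinal exists because \<open>NN\<close> is not internal. This follows
  from the first assertion, which is saturation applied to the sets obtained from an infinite
  internal set by deleting one point.\<close>

primrec ren :: "(nat \<Rightarrow> nat) \<Rightarrow> fm \<Rightarrow> fm" where
  "ren f (Mem i j) = Mem (f i) (f j)"
| "ren f (Eq i j) = Eq (f i) (f j)"
| "ren f (St i) = St (f i)"
| "ren f (Neg p) = Neg (ren f p)"
| "ren f (And p q) = And (ren f p) (ren f q)"
| "ren f (Ex i p) = Ex (f i) (ren f p)"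

lemma st_free_ren [simp]: "st_free (ren f p) = st_free p"
  by (induction p) auto

text \<open>Bound variables are renamed along with the free ones. Injectivity of \<open>f\<close>
  prevents capture: updating at \<open>f i\<close> affects exactly the variable \<open>i\<close> of
  the composed assignment.\<close>

lemma (in st_structure) sat_ren:
  assumes "inj f"
  shows "sat D (ren f p) e = sat D p (e \<circ> f)"
proof (induction p arbitrary: e)
  case (Ex i p)
  have "(e(f i := x)) \<circ> f = (e \<circ> f)(i := x)" for x
    using assms by (auto simp: fun_eq_iff dest: injD)
  then show ?case by (simp only: ren.simps sat.simps Ex.IH)
qed auto

text \<open>Bound variables are counted too: a finite set outside of which assignments do not matter
  and fresh variables can be found is all that is wanted.\<close>

primrec fm_vars :: "fm \<Rightarrow> nat set" where
  "fm_vars (Mem i j) = {i, j}"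
| "fm_vars (Eq i j) = {i, j}"
| "fm_vars (St i) = {i}"
| "fm_vars (Neg p) = fm_vars p"
| "fm_vars (And p q) = fm_vars p \<union> fm_vars q"
| "fm_vars (Ex i p) = insert i (fm_vars p)"

lemma finite_fm_vars: "finite (fm_vars p)"
  by (induction p) auto

lemma (in st_structure) sat_cong:
  "(\<And>i. i \<in> fm_vars p \<Longrightarrow> e i = e' i) \<Longrightarrow> sat D p e = sat D p e'"
proof (induction p arbitrary: e e')
  case (Neg p)
  have "sat D p e = sat D p e'" by (rule Neg.IH) (simp add: Neg.prems)
  then show ?case by simp
next
  case (And p q)
  have "sat D p e = sat D p e'" by (rule And.IH) (simp add: And.prems)
  moreover have "sat D q e = sat D q e'" by (rule And.IH) (simp add: And.prems)
  ultimately show ?case by simp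
next
  case (Ex i p)
  have "sat D p (e(i := x)) = sat D p (e'(i := x))" for x
    using Ex.prems by (intro Ex.IH) auto
  then show ?case by simp
qed simp_all

definition mix :: "(nat \<Rightarrow> 'a) \<Rightarrow> (nat \<Rightarrow> 'a) \<Rightarrow> nat \<Rightarrow> 'a" where
  "mix e d k = (if even k then e (k div 2) else d (k div 2))"

lemma range_mix: "range e \<subseteq> D \<Longrightarrow> range d \<subseteq> D \<Longrightarrow> range (mix e d) \<subseteq> D"
  by (auto simp: mix_def)

text \<open>Predicates and terms are functions of an environment, read with de Bruijn indices:
  under a quantifier the new variable is \<open>e 0\<close> and the old ones are shifted by \<open>Suc\<close>. In the
  defining formula the even variables carry the environment and the odd ones the parameters.\<close>

locale deflang = st_structure mem st
  for mem :: "'u \<Rightarrow> 'u \<Rightarrow> bool"  (infix "\<^bold>\<in>" 50) and st :: "'u \<Rightarrow> bool" +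
  fixes D :: "'u set" and L :: "fm set"
  assumes D_nonempty: "D \<noteq> {}"
    and L_Mem: "\<And>i j. Mem i j \<in> L"
    and L_Eq: "\<And>i j. Eq i j \<in> L"
    and L_Neg: "\<And>p. p \<in> L \<Longrightarrow> Neg p \<in> L"
    and L_And: "\<And>p q. p \<in> L \<Longrightarrow> q \<in> L \<Longrightarrow> And p q \<in> L"
    and L_Ex: "\<And>i p. p \<in> L \<Longrightarrow> Ex i p \<in> L"
    and L_ren: "\<And>f p. p \<in> L \<Longrightarrow> ren f p \<in> L"
    and D_trans: "\<And>x y. x \<in> D \<Longrightarrow> y \<^bold>\<in> x \<Longrightarrow> y \<in> D"
    and elts_eqD: "\<And>x y. elts x = elts y \<Longrightarrow> x = y"
    and elts_upair0: "\<And>a b. elts (upair a b) = {a, b}"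
    and D_upair: "\<And>a b. a \<in> D \<Longrightarrow> b \<in> D \<Longrightarrow> upair a b \<in> D"
begin

definition dfn :: "((nat \<Rightarrow> 'u) \<Rightarrow> bool) \<Rightarrow> bool" where
  "dfn \<Phi> \<longleftrightarrow> (\<exists>p\<in>L. \<exists>d. range d \<subseteq> D \<and> (\<forall>e. range e \<subseteq> D \<longrightarrow> \<Phi> e = sat D p (mix e d)))"

text \<open>A term is given by its graph, with the value as variable 0. Closure of \<open>D\<close>
  is part of the notion because a term is substituted through a witness quantified over
  \<open>D\<close>.\<close>

definition dtm :: "((nat \<Rightarrow> 'u) \<Rightarrow> 'u) \<Rightarrow> bool" where
  "dtm t \<longleftrightarrow> dfn (\<lambda>e. e 0 = t (\<lambda>i. e (Suc i))) \<and> (\<forall>e. range e \<subseteq> D \<longrightarrow> t e \<in> D)"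

lemma dfn_cong: "dfn \<Phi> \<Longrightarrow> (\<And>e. range e \<subseteq> D \<Longrightarrow> \<Phi> e = \<Psi> e) \<Longrightarrow> dfn \<Psi>"
  unfolding dfn_def by metis

lemma dfn_ren:
  assumes "dfn \<Phi>" "inj g"
  shows "dfn (\<lambda>e. \<Phi> (\<lambda>i. e (g i)))"
proof -
  obtain p d where p: "p \<in> L" "range d \<subseteq> D" "\<And>e. range e \<subseteq> D \<Longrightarrow> \<Phi> e = sat D p (mix e d)"
    using assms(1) unfolding dfn_def by blast
  \<comment> \<open>Acts as \<open>g\<close> on the even variables, which hold the environment, and
    fixes the parameters.\<close>
  define f where "f k = (if even k then 2 * g (k div 2) else k)" for k
  have f: "inj f"
    using assms(2) by (auto intro!: injI simp: f_def inj_eq split: if_splits elim!: evenE)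
  have "mix e d \<circ> f = mix (\<lambda>i. e (g i)) d" for e
    by (auto simp: fun_eq_iff mix_def f_def)
  then have "\<Phi> (\<lambda>i. e (g i)) = sat D (ren f p) (mix e d)" if "range e \<subseteq> D" for e
    using that p(3)[of "\<lambda>i. e (g i)"] by (auto simp: sat_ren[OF f])
  then show ?thesis
    unfolding dfn_def using L_ren[OF p(1)] p(2) by blast
qed

lemma dfn_mem_var: "dfn (\<lambda>e. e i \<^bold>\<in> e j)"
  and dfn_eq_var: "dfn (\<lambda>e. e i = e j)"
proof -
  obtain c where c: "c \<in> D" using D_nonempty by blast
  show "dfn (\<lambda>e. e i \<^bold>\<in> e j)" unfolding dfn_def
    by (rule bexI[OF _ L_Mem[of "2 * i" "2 * j"]], rule exI[of _ "\<lambda>_. c"]) (use c in \<open>auto simp: mix_def\<close>)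
  show "dfn (\<lambda>e. e i = e j)" unfolding dfn_def
    by (rule bexI[OF _ L_Eq[of "2 * i" "2 * j"]], rule exI[of _ "\<lambda>_. c"]) (use c in \<open>auto simp: mix_def\<close>)
qed

lemma dfn_not: assumes "dfn \<Phi>" shows "dfn (\<lambda>e. \<not> \<Phi> e)"
proof -
  obtain p d where p: "p \<in> L" "range d \<subseteq> D" "\<And>e. range e \<subseteq> D \<Longrightarrow> \<Phi> e = sat D p (mix e d)"
    using assms unfolding dfn_def by blast
  then show ?thesis unfolding dfn_def
    by (intro bexI[OF _ L_Neg[OF p(1)]] exI[of _ d]) auto
qed

lemma dfn_conj: assumes "dfn \<Phi>" "dfn \<Psi>" shows "dfn (\<lambda>e. \<Phi> e \<and> \<Psi> e)"
proof -
  obtain p d where p: "p \<in> L" "range d \<subseteq> D" "\<And>e. range e \<subseteq> D \<Longrightarrow> \<Phi> e = sat D p (mix e d)"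
    using assms(1) unfolding dfn_def by blast
  obtain q d' where q: "q \<in> L" "range d' \<subseteq> D" "\<And>e. range e \<subseteq> D \<Longrightarrow> \<Psi> e = sat D q (mix e d')"
    using assms(2) unfolding dfn_def by blast
  \<comment> \<open>The two parameter lists are interleaved into \<open>mix d d'\<close>. Entry j of
    \<open>d\<close> moves from variable 2j+1 to 2(2j)+1 = 4j+1, and entry j of \<open>d'\<close>
    moves to 2(2j+1)+1 = 4j+3.\<close>
  define f where "f k = (if even k then k else 4 * (k div 2) + 1)" for k :: nat
  define f' where "f' k = (if even k then k else 4 * (k div 2) + 3)" for k :: nat
  have f: "inj f" by (rule injI) (auto simp: f_def split: if_splits elim!: evenE oddE; presburger)
  have f': "inj f'" by (rule injI) (auto simp: f'_def split: if_splits elim!: evenE oddE; presburger)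
 have  half: "(4 * b + 3) div 2 = Suc (2 * b)" for b :: nat by presburger
  have "mix e (mix d d') \<circ> f = mix e d" "mix e (mix d d') \<circ> f' = mix e d'" for e
    by (auto simp: fun_eq_iff mix_def f_def f'_def half elim!: oddE)
  then have "(\<Phi> e \<and> \<Psi> e) = sat D (And (ren f p) (ren f' q)) (mix e (mix d d'))"
    if "range e \<subseteq> D" for e
    using that p(3) q(3) by (auto simp: sat_ren[OF f] sat_ren[OF f'])
  then show ?thesis
    unfolding dfn_def using L_And[OF L_ren[OF p(1)] L_ren[OF q(1)]] range_mix[OF p(2) q(2)] by blast
qed

lemma dfn_bex_dom: assumes "dfn (\<lambda>e. \<Phi> (\<lambda>i. e (Suc i)) (e 0))" shows "dfn (\<lambda>e. \<exists>x\<in>D. \<Phi> e x)"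
proof -
  obtain p d where p: "p \<in> L" "range d \<subseteq> D"
    "\<And>e. range e \<subseteq> D \<Longrightarrow> \<Phi> (\<lambda>i. e (Suc i)) (e 0) = sat D p (mix e d)"
    using assms unfolding dfn_def by blast
  \<comment> \<open>Variable 0, which is to be bound, moves to 1; the other environment variables
    drop by 2 and the parameters rise by 2. Position 1 is vacated by prepending a dummy parameter
    \<open>c\<close>.\<close>
  define f where "f k = (if k = 0 then 1 else if even k then k - 2 else k + 2)" for k :: nat
  have f: "inj f" by (rule injI) (auto simp: f_def split: if_splits elim!: evenE oddE; presburger)
  have eq: "(mix e (case_nat c d))(1 := x) \<circ> f = mix (case_nat x e) d" for e c x
    by (rule ext) (auto simp: mix_def f_def elim!: evenE oddE split: nat.splits)
  obtain c where c: "c \<in> D" using D_nonempty by blast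
  have "(\<exists>x\<in>D. \<Phi> e x) = sat D (Ex 1 (ren f p)) (mix e (case_nat c d))"
    if "range e \<subseteq> D" for e
  proof -
    have "\<Phi> e x = sat D p (mix (case_nat x e) d)" if "x \<in> D" for x
      using p(3)[of "case_nat x e"] \<open>range e \<subseteq> D\<close> that by (force split: nat.splits)
    then show ?thesis by (simp only: sat.simps sat_ren[OF f] eq) blast
  qed
  moreover have "range (case_nat c d) \<subseteq> D" using c p(2) by (force split: nat.splits)
  ultimately show ?thesis
    unfolding dfn_def using L_Ex[OF L_ren[OF p(1)]] by blast
qed

lemma dfn_disj: "dfn \<Phi> \<Longrightarrow> dfn \<Psi> \<Longrightarrow> dfn (\<lambda>e. \<Phi> e \<or> \<Psi> e)"
  by (rule dfn_cong[OF dfn_not[OF dfn_conj[OF dfn_not dfn_not]]]) auto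

lemma dfn_imp: "dfn \<Phi> \<Longrightarrow> dfn \<Psi> \<Longrightarrow> dfn (\<lambda>e. \<Phi> e \<longrightarrow> \<Psi> e)"
  by (rule dfn_cong[OF dfn_disj[OF dfn_not]]) auto

lemma dfn_iff: "dfn \<Phi> \<Longrightarrow> dfn \<Psi> \<Longrightarrow> dfn (\<lambda>e. \<Phi> e \<longleftrightarrow> \<Psi> e)"
  by (subst iff_conv_conj_imp) (intro dfn_conj dfn_imp)

lemma dfn_ball_dom: "dfn (\<lambda>e. \<Phi> (\<lambda>i. e (Suc i)) (e 0)) \<Longrightarrow> dfn (\<lambda>e. \<forall>x\<in>D. \<Phi> e x)"
  by (rule dfn_cong[OF dfn_not[OF dfn_bex_dom[OF dfn_not]]]) auto

lemma dfn_const: "dfn (\<lambda>e. b)"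
proof -
  have "dfn (\<lambda>e. e 0 = e 0)" "dfn (\<lambda>e. e 0 \<noteq> e 0)"
    by (intro dfn_not dfn_eq_var)+
  then show ?thesis by (cases b) auto
qed

lemma dtm_in: "dtm t \<Longrightarrow> range e \<subseteq> D \<Longrightarrow> t e \<in> D"
  unfolding dtm_def by blast

lemma dtm_var: "dtm (\<lambda>e. e i)"
  unfolding dtm_def by (auto intro: dfn_eq_var)

lemma dtm_const: "c \<in> D \<Longrightarrow> dtm (\<lambda>e. c)"
  unfolding dtm_def dfn_def
  by (intro conjI bexI[OF _ L_Eq[of 0 1]] exI[of _ "\<lambda>_. c"]) (auto simp: mix_def)

text \<open>Formulas have no function symbols, so a term enters through the equivalent predicate
  that some x in \<open>D\<close> equals it and satisfies the rest.\<close>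

lemma dfn_subst:
  assumes "dtm t" "dfn (\<lambda>e. \<Phi> (\<lambda>i. e (Suc i)) (e 0))"
  shows "dfn (\<lambda>e. \<Phi> e (t e))"
proof -
  have "dfn (\<lambda>e. \<exists>x\<in>D. x = t e \<and> \<Phi> e x)"
    using assms unfolding dtm_def by (intro dfn_bex_dom dfn_conj) auto
  then show ?thesis by (rule dfn_cong) (use dtm_in[OF assms(1)] in auto)
qed

lemma dfn_shift: "dfn \<Phi> \<Longrightarrow> dfn (\<lambda>e. \<Phi> (\<lambda>i. e (Suc i)))"
  by (rule dfn_ren) auto

lemma inj_shift_under: "inj (case_nat 0 (\<lambda>i. Suc (Suc i)))"
  by (auto intro!: injI split: nat.splits)

lemma dfn_shift_under:
  "dfn (\<lambda>e. \<Phi> (\<lambda>i. e (Suc i)) (e 0)) \<Longrightarrow> dfn (\<lambda>e. \<Phi> (\<lambda>i. e (Suc (Suc i))) (e 0))"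
  using dfn_ren[OF _ inj_shift_under] by fastforce

lemma dtm_shift: assumes "dtm t" shows "dtm (\<lambda>e. t (\<lambda>i. e (Suc i)))"
  unfolding dtm_def
proof (intro conjI allI impI)
  show "dfn (\<lambda>e. e 0 = t (\<lambda>i. e (Suc (Suc i))))"
    using assms unfolding dtm_def by (intro dfn_shift_under[of "\<lambda>e x. x = t e"]) (rule conjunct1)
  show "t (\<lambda>i. e (Suc i)) \<in> D" if "range e \<subseteq> D" for e
    using that by (intro dtm_in[OF assms]) auto
qed

lemma dfn1I: "dfn (\<lambda>e. R (e 0)) \<Longrightarrow> dtm t \<Longrightarrow> dfn (\<lambda>e. R (t e))"
  by (rule dfn_subst[where \<Phi> = "\<lambda>e x. R x"])

text \<open>Substitution acts on variable 0 only, so the arguments are permuted into that place one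
  at a time, the last argument first.\<close>

lemma dfn2I:
  assumes "dfn (\<lambda>e. R (e 0) (e 1))" "dtm t" "dtm s"
  shows "dfn (\<lambda>e. R (t e) (s e))"
proof -
  have "inj (\<lambda>i::nat. if i = 0 then 1 else if i = 1 then 0 else i)" by (auto intro!: injI split: if_splits)
  from dfn_ren[OF assms(1) this] have "dfn (\<lambda>e. R (e (Suc 0)) (e 0))" by simp
  then have "dfn (\<lambda>e. R (e 0) (s (\<lambda>i. e (Suc i))))"
    by (rule dfn_subst[OF dtm_shift[OF assms(3)]])
  then show ?thesis by (rule dfn_subst[OF assms(2), where \<Phi> = "\<lambda>e x. R x (s e)"])
qed

lemma dfn3I:
  assumes "dfn (\<lambda>e. R (e 0) (e 1) (e 2))" "dtm t" "dtm s" "dtm r"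
  shows "dfn (\<lambda>e. R (t e) (s e) (r e))"
proof -
  have "inj (\<lambda>i::nat. if i = 0 then 1 else if i = 1 then 2 else if i = 2 then 0 else i)"
    by (auto intro!: injI split: if_splits)
  from dfn_ren[OF assms(1) this] have "dfn (\<lambda>e. R (e (Suc 0)) (e (Suc (Suc 0))) (e 0))"
    by (simp add: numeral_2_eq_2)
  then have "dfn (\<lambda>e. R (e 0) (e (Suc 0)) (r (\<lambda>i. e (Suc (Suc i)))))"
    by (rule dfn_subst[OF dtm_shift[OF dtm_shift[OF assms(4)]]])
  from dfn_ren[OF this, of "\<lambda>i. if i = 0 then 1 else if i = 1 then 0 else i"]
  have "dfn (\<lambda>e. R (e (Suc 0)) (e 0) (r (\<lambda>i. e (Suc (Suc i)))))"
    by (simp add: inj_def)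
  then have "dfn (\<lambda>e. R (e 0) (s (\<lambda>i. e (Suc i))) (r (\<lambda>i. e (Suc i))))"
    by (rule dfn_subst[OF dtm_shift[OF assms(3)],
          where \<Phi> = "\<lambda>e x. R (e 0) x (r (\<lambda>i. e (Suc i)))"])
  then show ?thesis by (rule dfn_subst[OF assms(2), where \<Phi> = "\<lambda>e x. R x (s e) (r e)"])
qed

lemma dfn_mem: "dtm t \<Longrightarrow> dtm s \<Longrightarrow> dfn (\<lambda>e. t e \<^bold>\<in> s e)"
  by (rule dfn2I[where R = mem, OF dfn_mem_var])

lemma dfn_eq: "dtm t \<Longrightarrow> dtm s \<Longrightarrow> dfn (\<lambda>e. t e = s e)"
  by (rule dfn2I[where R = "(=)", OF dfn_eq_var])

lemma dfn_elts: "dtm t \<Longrightarrow> dtm s \<Longrightarrow> dfn (\<lambda>e. t e \<in> elts (s e))"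
  unfolding elts_def mem_Collect_eq by (rule dfn_mem)

lemma dfn_bex:
  assumes "dtm t" "dfn (\<lambda>e. \<Phi> (\<lambda>i. e (Suc i)) (e 0))"
  shows "dfn (\<lambda>e. \<exists>x\<in>elts (t e). \<Phi> e x)"
proof -
  have "dfn (\<lambda>e. \<exists>x\<in>D. x \<^bold>\<in> t e \<and> \<Phi> e x)"
    by (intro dfn_bex_dom dfn_conj dfn_mem dtm_var dtm_shift assms)
  then show ?thesis
    by (rule dfn_cong) (use D_trans[OF dtm_in[OF assms(1)]] in \<open>auto simp: elts_def\<close>)
qed

lemma dfn_ball:
  assumes "dtm t" "dfn (\<lambda>e. \<Phi> (\<lambda>i. e (Suc i)) (e 0))"
  shows "dfn (\<lambda>e. \<forall>x\<in>elts (t e). \<Phi> e x)"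
  by (rule dfn_cong[OF dfn_not[OF dfn_bex[OF assms(1) dfn_not[OF assms(2)]]]]) auto

lemma dfn_subset: "dtm t \<Longrightarrow> dtm s \<Longrightarrow> dfn (\<lambda>e. elts (t e) \<subseteq> elts (s e))"
  unfolding subset_eq by (intro dfn_ball dfn_elts dtm_var dtm_shift)

lemma dfn_bex1_dom:
  assumes "dfn (\<lambda>e. \<Phi> (\<lambda>i. e (Suc i)) (e 0))"
  shows "dfn (\<lambda>e. \<exists>!x. x \<in> D \<and> \<Phi> e x)"
proof -
  have "dfn (\<lambda>e. \<exists>x\<in>D. \<Phi> e x \<and> (\<forall>z\<in>D. \<Phi> e z \<longrightarrow> z = x))"
    by (intro dfn_bex_dom dfn_conj dfn_ball_dom dfn_imp assms dfn_eq dtm_var dfn_shift_under)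
  then show ?thesis by (rule dfn_cong) metis
qed

lemma dtmI:
  assumes "dfn (\<lambda>e. \<Phi> (\<lambda>i. e (Suc i)) (e 0))"
    and "\<And>e. range e \<subseteq> D \<Longrightarrow> t e \<in> D"
    and "\<And>e y. range e \<subseteq> D \<Longrightarrow> y \<in> D \<Longrightarrow> y = t e \<longleftrightarrow> \<Phi> e y"
  shows "dtm t"
  unfolding dtm_def
proof (intro conjI allI impI)
  show "dfn (\<lambda>e. e 0 = t (\<lambda>i. e (Suc i)))"
    by (rule dfn_cong[OF assms(1)], subst assms(3)) auto
qed (use assms(2) in auto)

lemma dtm1I:
  assumes "dtm (\<lambda>e. h (e 0))" "dtm t"
  shows "dtm (\<lambda>e. h (t e))"
proof (rule dtmI[where \<Phi> = "\<lambda>e y. y = h (t e)"])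
  show "dfn (\<lambda>e. e 0 = h (t (\<lambda>i. e (Suc i))))"
  proof (rule dfn2I[where R = "\<lambda>x y. x = h y"])
    show "dfn (\<lambda>e. e 0 = h (e 1))" using assms(1) unfolding dtm_def by simp
  qed (auto intro: dtm_var dtm_shift assms)
  show "h (t e) \<in> D" if "range e \<subseteq> D" for e
    using dtm_in[OF assms(1), of "\<lambda>_. t e"] dtm_in[OF assms(2) that] by auto
qed auto

lemma dtm2I:
  assumes "dtm (\<lambda>e. h (e 0) (e 1))" "dtm t" "dtm s"
  shows "dtm (\<lambda>e. h (t e) (s e))"
proof (rule dtmI[where \<Phi> = "\<lambda>e y. y = h (t e) (s e)"])
  show "dfn (\<lambda>e. e 0 = h (t (\<lambda>i. e (Suc i))) (s (\<lambda>i. e (Suc i))))"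
  proof (rule dfn3I[where R = "\<lambda>x y z. x = h y z"])
    show "dfn (\<lambda>e. e 0 = h (e 1) (e 2))" using assms(1) unfolding dtm_def
      by (simp add: numeral_2_eq_2)
  qed (auto intro: dtm_var dtm_shift assms)
  show "h (t e) (s e) \<in> D" if "range e \<subseteq> D" for e
    using dtm_in[OF assms(1), of "\<lambda>i. if i = 0 then t e else s e"] dtm_in[OF assms(2) that]
      dtm_in[OF assms(3) that] by auto
qed auto

lemma dtm_if:
  assumes "dfn \<Phi>" "dtm t" "dtm s"
  shows "dtm (\<lambda>e. if \<Phi> e then t e else s e)"
proof (rule dtmI[where \<Phi> = "\<lambda>e y. (\<Phi> e \<longrightarrow> y = t e) \<and> (\<not> \<Phi> e \<longrightarrow> y = s e)"])
  show "dfn (\<lambda>e. (\<Phi> (\<lambda>i. e (Suc i)) \<longrightarrow> e 0 = t (\<lambda>i. e (Suc i))) \<and>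
      (\<not> \<Phi> (\<lambda>i. e (Suc i)) \<longrightarrow> e 0 = s (\<lambda>i. e (Suc i))))"
    by (intro dfn_conj dfn_imp dfn_not dfn_shift dfn_eq dtm_shift dtm_var assms)
qed (use assms in \<open>auto dest: dtm_in\<close>)

lemma dtm_upair: assumes "dtm t" "dtm s" shows "dtm (\<lambda>e. upair (t e) (s e))"
proof (rule dtm2I[OF _ assms])
  show "dtm (\<lambda>e. upair (e 0) (e 1))"
  proof (rule dtmI[where \<Phi> = "\<lambda>(e :: nat \<Rightarrow> 'u) y. \<forall>w\<in>D. w \<^bold>\<in> y \<longleftrightarrow> w = e 0 \<or> w = e 1"])
    show "dfn (\<lambda>e. \<forall>w\<in>D. w \<^bold>\<in> e 0 \<longleftrightarrow> w = e (Suc 0) \<or> w = e (Suc 1))"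
      by (intro dfn_ball_dom dfn_iff dfn_disj dfn_mem dfn_eq dtm_var)
    fix e :: "nat \<Rightarrow> 'u" and y assume e: "range e \<subseteq> D" and y: "y \<in> D"
    show "y = upair (e 0) (e 1) \<longleftrightarrow> (\<forall>w\<in>D. w \<^bold>\<in> y \<longleftrightarrow> w = e 0 \<or> w = e 1)"
    proof
      assume "y = upair (e 0) (e 1)"
      then show "\<forall>w\<in>D. w \<^bold>\<in> y \<longleftrightarrow> w = e 0 \<or> w = e 1"
        using elts_upair0[of "e 0" "e 1"] by (auto simp: elts_def)
    next
      assume "\<forall>w\<in>D. w \<^bold>\<in> y \<longleftrightarrow> w = e 0 \<or> w = e 1"
      then have "elts y = {e 0, e 1}" using e D_trans[OF y] unfolding elts_def by blast
      then show "y = upair (e 0) (e 1)" by (intro elts_eqD) (simp add: elts_upair0)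
    qed
  qed (auto intro!: D_upair)
qed

lemma dtm_pair: "dtm t \<Longrightarrow> dtm s \<Longrightarrow> dtm (\<lambda>e. pair (t e) (s e))"
  unfolding pair_def by (intro dtm_upair)

text \<open>Turns the environment from position \<open>n\<close> on into parameters. This is how a
  set former with a varying environment is reduced, for each fixed environment, to a predicate of
  its own variable.\<close>

lemma dfn_fix:
  assumes "dfn \<Phi>" "range c \<subseteq> D"
  shows "dfn (\<lambda>e. \<Phi> (\<lambda>i. if i < n then e i else c i))"
proof -
  obtain p d where p: "p \<in> L" "range d \<subseteq> D" "\<And>e. range e \<subseteq> D \<Longrightarrow> \<Phi> e = sat D p (mix e d)"
    using assms(1) unfolding dfn_def by blast
  define f where "f k = (if even k \<and> k div 2 < n then k else if even k then 4 * (k div 2) + 1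
      else 4 * (k div 2) + 3)" for k :: nat
  have f: "inj f" by (rule injI) (auto simp: f_def split: if_splits elim!: evenE oddE; presburger)
  have half: "(4 * b + 3) div 2 = Suc (2 * b)" for b :: nat
    by presburger+
  have "mix e (mix c d) \<circ> f = mix (\<lambda>i. if i < n then e i else c i) d" for e
    by (auto simp: fun_eq_iff mix_def f_def half elim!: evenE oddE)
  then have "\<Phi> (\<lambda>i. if i < n then e i else c i) = sat D (ren f p) (mix e (mix c d))"
    if "range e \<subseteq> D" for e
    using p(3)[of "\<lambda>i. if i < n then e i else c i"] that assms(2)
    by (auto simp: sat_ren[OF f] image_subset_iff)
  then show ?thesis
    unfolding dfn_def using L_ren[OF p(1)] range_mix[OF assms(2) p(2)] by blast
qed

lemma dfn_fix1:
  assumes "dfn (\<lambda>e. \<Phi> (\<lambda>i. e (Suc i)) (e 0))" "range c \<subseteq> D"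
  shows "dfn (\<lambda>e. \<Phi> c (e 0))"
proof -
  have "range (case_nat (c 0) c) \<subseteq> D" using assms(2) by (auto simp: image_subset_iff split: nat.splits)
  from dfn_fix[OF assms(1) this, of 1] show ?thesis by simp
qed

lemma dtm_fix1:
  assumes "dtm (\<lambda>e. t (\<lambda>i. e (Suc i)) (e 0))" "range c \<subseteq> D"
  shows "dtm (\<lambda>e. t c (e 0))"
  unfolding dtm_def
proof (intro conjI allI impI)
  have *: "dfn (\<lambda>e. e 0 = t (\<lambda>i. e (Suc (Suc i))) (e 1))"
    using assms(1) unfolding dtm_def by simp
  have "range (case_nat (c 0) (case_nat (c 0) c)) \<subseteq> D"
    using assms(2) by (auto simp: image_subset_iff split: nat.splits)
  from dfn_fix[OF * this, of 2] show "dfn (\<lambda>e. e 0 = t c (e (Suc 0)))" by simp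
  show "t c (e 0) \<in> D" if "range e \<subseteq> D" for e
    using dtm_in[OF assms(1), of "case_nat (e 0) c"] assms(2) that
    by (auto simp: image_subset_iff split: nat.splits)
qed

lemmas dfn_intros = dfn_const dfn_mem dfn_eq dfn_elts dfn_subset dfn_not dfn_conj dfn_disj dfn_imp
  dfn_iff dfn_bex dfn_ball dfn_bex_dom dfn_ball_dom dfn_bex1_dom dtm_var dtm_if dtm_pair dtm_upair

end

section \<open>Internal sets\<close>

definition fAll :: "nat \<Rightarrow> fm \<Rightarrow> fm" where "fAll i p = Neg (Ex i (Neg p))"
definition fIff :: "fm \<Rightarrow> fm \<Rightarrow> fm" where "fIff p q = And (Neg (And p (Neg q))) (Neg (And q (Neg p)))"
definition fImp :: "fm \<Rightarrow> fm \<Rightarrow> fm" where "fImp p q = Neg (And p (Neg q))"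

text \<open>Closing off the parameters turns an instance of a schema into one sentence, which can
  then be transferred.\<close>

primrec fAlls :: "nat \<Rightarrow> fm \<Rightarrow> fm" where
  "fAlls 0 p = p"
| "fAlls (Suc n) p = fAll n (fAlls n p)"

lemma st_free_fm [simp]: "st_free (fAll i p) = st_free p" "st_free (fIff p q) \<longleftrightarrow> st_free p \<and> st_free q"
  "st_free (fImp p q) \<longleftrightarrow> st_free p \<and> st_free q" "st_free (fAlls n p) = st_free p"
proof -
  show "st_free (fAlls n p) = st_free p"
    by (induction n) (auto simp: fAll_def)
qed (auto simp: fAll_def fIff_def fImp_def)

context st_structure
begin

lemma sat_fm [simp]: "sat D (fAll i p) e \<longleftrightarrow> (\<forall>x\<in>D. sat D p (e(i := x)))"
  "sat D (fIff p q) e \<longleftrightarrow> (sat D p e \<longleftrightarrow> sat D q e)"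
  "sat D (fImp p q) e \<longleftrightarrow> (sat D p e \<longrightarrow> sat D q e)"
  by (auto simp: fAll_def fIff_def fImp_def)

lemma sat_fAlls:
  "sat D (fAlls n p) e \<longleftrightarrow> (\<forall>c. (\<forall>i<n. c i \<in> D) \<longrightarrow> sat D p (\<lambda>i. if i < n then c i else e i))"
proof (induction n arbitrary: e)
  case (Suc n)
  have "sat D (fAlls (Suc n) p) e \<longleftrightarrow>
    (\<forall>x\<in>D. \<forall>c. (\<forall>i<n. c i \<in> D) \<longrightarrow> sat D p (\<lambda>i. if i < n then c i else (e(n := x)) i))"
    using Suc by simp
  also have "\<dots> \<longleftrightarrow> (\<forall>c. (\<forall>i<Suc n. c i \<in> D) \<longrightarrow> sat D p (\<lambda>i. if i < Suc n then c i else e i))"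
  proof (intro iffI allI impI ballI)
    fix c assume *: "\<forall>x\<in>D. \<forall>c. (\<forall>i<n. c i \<in> D) \<longrightarrow> sat D p (\<lambda>i. if i < n then c i else (e(n := x)) i)"
      "\<forall>i<Suc n. c i \<in> D"
    have eq: "(\<lambda>i. if i < n then c i else (e(n := c n)) i) = (\<lambda>i. if i < Suc n then c i else e i)"
      by (auto simp: fun_eq_iff less_Suc_eq)
    show "sat D p (\<lambda>i. if i < Suc n then c i else e i)"
      using *(1)[rule_format, of "c n" c] *(2) unfolding eq by simp
  next
    fix x c assume *: "\<forall>c. (\<forall>i<Suc n. c i \<in> D) \<longrightarrow> sat D p (\<lambda>i. if i < Suc n then c i else e i)"
      "x \<in> D" "\<forall>i<n. c i \<in> D"
    have "(\<lambda>i. if i < Suc n then (c(n := x)) i else e i) = (\<lambda>i. if i < n then c i else (e(n := x)) i)"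
      by (auto simp: fun_eq_iff less_Suc_eq)
    moreover have "\<forall>i<Suc n. (c(n := x)) i \<in> D" using *(2,3) by (auto simp: less_Suc_eq)
    ultimately show "sat D p (\<lambda>i. if i < n then c i else (e(n := x)) i)"
      using *(1) by metis
  qed
  finally show ?case .
qed simp

lemma ax_separationD:
  assumes "ax_separation L D" "p \<in> L" "range e \<subseteq> D" "X \<in> D"
  shows "\<exists>Y\<in>D. \<forall>x\<in>D. x \<^bold>\<in> Y \<longleftrightarrow> x \<^bold>\<in> X \<and> sat D p (e(0 := x))"
  using assms(1)[unfolded ax_separation_def, rule_format, OF assms(2-4)] .

lemma ax_collectionD:
  assumes "ax_collection L D" "p \<in> L" "range e \<subseteq> D" "X \<in> D"
  shows "\<exists>Y\<in>D. \<forall>x\<in>D. x \<^bold>\<in> X \<longrightarrow> (\<exists>y\<in>D. sat D p (e(0 := x, 1 := y))) \<longrightarrow>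
    (\<exists>y\<in>D. y \<^bold>\<in> Y \<and> sat D p (e(0 := x, 1 := y)))"
  using assms(1)[unfolded ax_collection_def, rule_format, OF assms(2-4)] .

end

lemma bij_betw_iff_ex1:
  assumes "f ` A \<subseteq> B"
  shows "bij_betw f A B \<longleftrightarrow> (\<forall>y\<in>B. \<exists>!x. x \<in> A \<and> y = f x)"
proof
  assume R: "\<forall>y\<in>B. \<exists>!x. x \<in> A \<and> y = f x"
  have "inj_on f A"
  proof (rule inj_onI)
    fix x x' assume x: "x \<in> A" "x' \<in> A" "f x = f x'"
    then have "\<exists>!z. z \<in> A \<and> f x = f z" using R assms by blast
    then show "x = x'" using x by (auto elim: ex1E)
  qed
  moreover have "f ` A = B" using R assms by (auto simp: image_iff)
  ultimately show "bij_betw f A B" by (simp add: bij_betw_def)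
qed (auto simp: bij_betw_def inj_on_def)

context HST
begin

lemma elts_eqI:
  assumes "elts x = elts y"
  shows "x = y"
proof -
  have "z \<^bold>\<in> x \<longleftrightarrow> z \<^bold>\<in> y" for z using assms by (auto simp: elts_def)
  then show ?thesis using extensionality unfolding ax_extensionality_def by blast
qed

lemma mem_elts: "x \<in> elts y \<longleftrightarrow> x \<^bold>\<in> y"
  by (simp add: elts_def)

lemma elts_upair: "elts (upair a b) = {a, b}"
proof -
  obtain z where "\<forall>w. w \<^bold>\<in> z \<longleftrightarrow> w = a \<or> w = b"
    using pairing unfolding ax_pairing_def by (meson UNIV_I)
  then have "elts z = {a, b}" by (auto simp: elts_def)
  then show ?thesis
    unfolding upair_def by (metis (mono_tags, lifting) elts_eqI theI)
qed

lemma upair_eq_iff: "upair a b = upair c d \<longleftrightarrow> {a, b} = {c, d}"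
proof
  assume "upair a b = upair c d"
  then have "elts (upair a b) = elts (upair c d)" by (rule arg_cong)
  then show "{a, b} = {c, d}" by (simp only: elts_upair)
next
  assume "{a, b} = {c, d}"
  then show "upair a b = upair c d" by (intro elts_eqI) (simp only: elts_upair)
qed

lemma pair_eq_iff [simp]: "pair a b = pair c d \<longleftrightarrow> a = c \<and> b = d"
  unfolding pair_def upair_eq_iff doubleton_eq_iff by auto

lemma SS_subset_II: "SS \<subseteq> II"
proof
  fix x assume x: "x \<in> SS"
  then obtain z where "z \<in> SS" "\<forall>w\<in>SS. w \<^bold>\<in> z \<longleftrightarrow> w = x \<or> w = x"
    using ZFC_st unfolding ZFC_on_def ax_pairing_def by blast
  with x show "x \<in> II" unfolding II_def SS_def by blast
qed

lemma SS_nonempty: "SS \<noteq> {}"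
  using ZFC_st unfolding ZFC_on_def ax_infinity_def by blast

text \<open>A single axiom is expressed by a formula whose truth does not depend on the assignment,
  so any constant standard assignment can be transferred.\<close>

lemma transfer_axiom:
  assumes "st_free p" "Ax SS" "\<And>D e. sat D p e \<longleftrightarrow> Ax D"
  shows "Ax II"
proof -
  obtain c where "c \<in> SS" using SS_nonempty by blast
  then have "sat II p (\<lambda>_. c) \<longleftrightarrow> sat SS p (\<lambda>_. c)" by (intro transfer assms) auto
  then show ?thesis using assms by simp
qed

section \<open>Axioms of set theory for the internal sets, by transfer\<close>

lemma pairing_II: "ax_pairing II"
  by (rule transfer_axiom[of "fAll 0 (fAll 1 (Ex 2 (fAll 3 (fIff (Mem 3 2)
        (Neg (And (Neg (Eq 3 0)) (Neg (Eq 3 1)))))))) "])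
    (insert ZFC_st, simp_all add: ZFC_on_def, simp_all add: ax_pairing_def)

lemma union_II: "ax_union II"
  by (rule transfer_axiom[of "fAll 0 (Ex 1 (fAll 2 (fIff (Mem 2 1)
        (Ex 3 (And (Mem 3 0) (Mem 2 3))))))"])
    (insert ZFC_st, simp_all add: ZFC_on_def, simp_all add: ax_union_def)

lemma power_II: "ax_power II"
  by (rule transfer_axiom[of "fAll 0 (Ex 1 (fAll 2 (fIff (Mem 2 1)
        (fAll 3 (fImp (Mem 3 2) (Mem 3 0))))))"])
    (insert ZFC_st, simp_all add: ZFC_on_def, simp_all add: ax_power_def)

lemma infinity_II: "ax_infinity II"
  by (rule transfer_axiom[of "Ex 0 (And (Ex 1 (And (Mem 1 0) (fAll 2 (Neg (Mem 2 1)))))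
        (fAll 1 (fImp (Mem 1 0) (Ex 2 (And (Mem 2 0)
          (fAll 3 (fIff (Mem 3 2) (Neg (And (Neg (Mem 3 1)) (Neg (Eq 3 1)))))))))))"])
    (insert ZFC_st, simp_all add: ZFC_on_def, simp_all add: ax_infinity_def)

text \<open>Transfer allows standard parameters only, while internal ones are wanted here. For a
  fixed formula the instance of Separation is therefore quantified over all its parameters, and this
  one st-free sentence is transferred.\<close>

lemma separation_II: "ax_separation {p. st_free p} II"
  unfolding ax_separation_def
proof (intro ballI allI impI)
  fix p and e :: "nat \<Rightarrow> 'u" and X assume p: "p \<in> {p. st_free p}" and e: "range e \<subseteq> II" and X: "X \<in> II"
  have "finite (insert 0 (fm_vars p))" by (simp add: finite_fm_vars)
  then obtain N where N0: "\<forall>i\<in>insert 0 (fm_vars p). i < N"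
    using finite_nat_set_iff_bounded by blast
  then have N: "\<forall>i\<in>fm_vars p. i < N" "N > 0" by auto
  \<comment> \<open>Variable \<open>N\<close> is the given set and \<open>Suc N\<close> the subset
    to be found; \<open>p\<close> mentions neither, since all its variables lie below
    \<open>N\<close>.\<close>
  define q where "q = fAlls N (fAll N (Ex (Suc N) (fAll 0 (fIff (Mem 0 (Suc N)) (And (Mem 0 N) p)))))"
  have sat_q: "sat D q e \<longleftrightarrow> (\<forall>c. range c \<subseteq> D \<longrightarrow> (\<forall>X\<in>D. \<exists>Y\<in>D. \<forall>x\<in>D. x \<^bold>\<in> Y \<longleftrightarrow> x \<^bold>\<in> X \<and> sat D p (c(0 := x))))"
    (is "_ \<longleftrightarrow> ?R") if D: "D \<noteq> {}" for D e
  proof -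
    have eq: "sat D p ((\<lambda>i. if i < N then c i else e i)(N := X, Suc N := Y, 0 := x)) = sat D p (c(0 := x))" for c X Y x
      using N by (intro sat_cong) auto
    have "sat D q e \<longleftrightarrow> (\<forall>c. (\<forall>i<N. c i \<in> D) \<longrightarrow>
        (\<forall>X\<in>D. \<exists>Y\<in>D. \<forall>x\<in>D. x \<^bold>\<in> Y \<longleftrightarrow> x \<^bold>\<in> X \<and> sat D p (c(0 := x))))"
      by (simp only: q_def sat_fAlls sat_fm sat.simps eq) (use N(2) in simp)
    also have "\<dots> \<longleftrightarrow> ?R"
    proof (intro iffI allI impI)
      fix c :: "nat \<Rightarrow> 'u" assume R: ?R and c: "\<forall>i<N. c i \<in> D"
      \<comment> \<open>The closure controls only the values below \<open>N\<close>, whereas the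
        schema wants an assignment entirely in \<open>D\<close>; the remaining values are filled
        with \<open>b\<close>.\<close>
      obtain b where b: "b \<in> D" using D by blast
      have eq': "sat D p ((\<lambda>i. if i < N then c i else b)(0 := x)) = sat D p (c(0 := x))" for x
        using N by (intro sat_cong) auto
      have "range (\<lambda>i. if i < N then c i else b) \<subseteq> D" using b c by auto
      from R[rule_format, OF this] show "\<forall>X\<in>D. \<exists>Y\<in>D. \<forall>x\<in>D. x \<^bold>\<in> Y \<longleftrightarrow> x \<^bold>\<in> X \<and> sat D p (c(0 := x))"
        unfolding eq' by blast
    qed (simp add: image_subset_iff)
    finally show ?thesis .
  qed
  show "\<exists>Y\<in>II. \<forall>x\<in>II. x \<^bold>\<in> Y \<longleftrightarrow> x \<^bold>\<in> X \<and> sat II p (e(0 := x))"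
  proof -
    obtain c where c: "c \<in> SS" using SS_nonempty by blast
    have "ax_separation {p. st_free p} SS" using ZFC_st by (simp only: ZFC_on_def)
    then have "sat SS q (\<lambda>_. c)"
      unfolding sat_q[OF SS_nonempty] ax_separation_def using p by (rule bspec)
    moreover have "st_free q" using p by (simp add: q_def)
    ultimately have "sat II q (\<lambda>_. c)" using c by (subst transfer) auto
    moreover have "II \<noteq> {}" using X by blast
    ultimately show ?thesis
      using e X sat_q[THEN iffD1, of II "\<lambda>_. c", THEN spec, of e] by blast
  qed
qed

lemma elts_of_II: "x \<in> II \<Longrightarrow> elts x \<subseteq> II"
  using transitivity_of_II by (auto simp: elts_def)

lemma upair_II: assumes "a \<in> II" "b \<in> II" shows "upair a b \<in> II"
proof -
  obtain z where z: "z \<in> II" "\<forall>w\<in>II. w \<^bold>\<in> z \<longleftrightarrow> w = a \<or> w = b"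
    using pairing_II assms unfolding ax_pairing_def by blast
  then have "elts z = {a, b}" using assms elts_of_II[of z] unfolding elts_def by blast
  then have "z = upair a b" by (intro elts_eqI) (simp add: elts_upair)
  then show ?thesis using z by simp
qed

sublocale univ: deflang mem st UNIV UNIV
  by unfold_locales (auto simp: elts_upair intro: elts_eqI)

sublocale intl: deflang mem st II "{p. st_free p}"
proof unfold_locales
  show "II \<noteq> {}" using SS_nonempty SS_subset_II by blast
  show "\<And>x y. x \<in> II \<Longrightarrow> y \<^bold>\<in> x \<Longrightarrow> y \<in> II" by (rule transitivity_of_II)
qed (auto simp: elts_upair upair_II intro: elts_eqI)

lemma dtm_const: "univ.dtm (\<lambda>e. c)"
  by (rule univ.dtm_const) simp

lemma dfn_st: "univ.dtm t \<Longrightarrow> univ.dfn (\<lambda>e. st (t e))"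
proof (rule univ.dfn1I)
  show "univ.dfn (\<lambda>e. st (e 0))" unfolding univ.dfn_def
    by (rule bexI[of _ "St 0"], rule exI[of _ undefined]) (auto simp: mix_def)
qed

lemma dfn_ex: "univ.dfn (\<lambda>e. \<Phi> (\<lambda>i. e (Suc i)) (e 0)) \<Longrightarrow> univ.dfn (\<lambda>e. \<exists>x. \<Phi> e x)"
  using univ.dfn_bex_dom[of \<Phi>] by simp

lemma dfn_all: "univ.dfn (\<lambda>e. \<Phi> (\<lambda>i. e (Suc i)) (e 0)) \<Longrightarrow> univ.dfn (\<lambda>e. \<forall>x. \<Phi> e x)"
  using univ.dfn_ball_dom[of \<Phi>] by simp

lemma dfn_ex1: "univ.dfn (\<lambda>e. \<Phi> (\<lambda>i. e (Suc i)) (e 0)) \<Longrightarrow> univ.dfn (\<lambda>e. \<exists>!x. \<Phi> e x)"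
  using univ.dfn_bex1_dom[of \<Phi>] by simp

lemma dfn_II: "univ.dtm t \<Longrightarrow> univ.dfn (\<lambda>e. t e \<in> II)"
  unfolding II_def mem_Collect_eq
  by (intro dfn_ex univ.dfn_conj dfn_st univ.dfn_mem univ.dtm_shift univ.dtm_var)

lemmas dfn_rules = dtm_const univ.dfn_const univ.dfn_mem univ.dfn_eq univ.dfn_elts univ.dfn_subset
  univ.dfn_not univ.dfn_conj univ.dfn_disj univ.dfn_imp univ.dfn_iff univ.dfn_bex univ.dfn_ball
  dfn_ex dfn_all dfn_ex1 univ.dtm_var univ.dtm_if univ.dtm_pair univ.dtm_upair dfn_st dfn_II

subsection \<open>Comprehension, unions and images\<close>

lemma univ_dfnD: "univ.dfn \<Phi> \<Longrightarrow> \<exists>p d. \<forall>e. \<Phi> e = sat UNIV p (mix e d)"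
  unfolding univ.dfn_def by auto

lemma separation_set:
  assumes "univ.dfn (\<lambda>e. P (e 0))"
  shows "\<exists>Y. elts Y = {x \<in> elts X. P x}"
proof -
  obtain p d where p: "\<forall>e. P (e 0) = sat UNIV p (mix e d)"
    using univ_dfnD[OF assms] by (elim exE)
  have "(mix (\<lambda>_. X) d)(0 := x) = mix ((\<lambda>_. X)(0 := x)) d" for x
    by (auto simp: mix_def fun_eq_iff)
  then have "P x = sat UNIV p ((mix (\<lambda>_. X) d)(0 := x))" for x
    using p[rule_format, of "(\<lambda>_. X)(0 := x)"] by simp
  moreover obtain Y where "\<forall>x. x \<^bold>\<in> Y \<longleftrightarrow> x \<^bold>\<in> X \<and> sat UNIV p ((mix (\<lambda>_. X) d)(0 := x))"
    using ax_separationD[OF separation UNIV_I subset_UNIV UNIV_I, of X p "mix (\<lambda>_. X) d"] by (simp only: ball_UNIV bex_UNIV) blast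
  ultimately show ?thesis by (auto simp: elts_def)
qed

lemma separation_internal:
  assumes "X \<in> II" "intl.dfn (\<lambda>e. P (e 0))"
  shows "\<exists>Y\<in>II. elts Y = {x \<in> elts X. P x}"
proof -
  obtain p d where p: "st_free p" "range d \<subseteq> II" "\<And>e. range e \<subseteq> II \<Longrightarrow> P (e 0) = sat II p (mix e d)"
    using assms(2) unfolding intl.dfn_def by auto
  have "(mix (\<lambda>_. X) d)(0 := x) = mix ((\<lambda>_. X)(0 := x)) d" for x
    by (auto simp: mix_def fun_eq_iff)
  then have P: "P x = sat II p ((mix (\<lambda>_. X) d)(0 := x))" if "x \<in> II" for x
    using p(3)[of "(\<lambda>_. X)(0 := x)"] that assms(1) by auto
  have "range (mix (\<lambda>_. X) d) \<subseteq> II" using p(2) assms(1) by (intro range_mix) auto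
  then obtain Y where Y: "Y \<in> II" "\<forall>x\<in>II. x \<^bold>\<in> Y \<longleftrightarrow> x \<^bold>\<in> X \<and> sat II p ((mix (\<lambda>_. X) d)(0 := x))"
    using ax_separationD[OF separation_II _ _ assms(1), of p] p(1) by blast
  have "x \<in> elts Y \<longleftrightarrow> x \<in> elts X \<and> P x" for x
    using Y P elts_of_II[OF Y(1)] elts_of_II[OF assms(1)] unfolding elts_def by blast
  then show ?thesis using Y(1) by blast
qed

lemma collection_set:
  assumes "univ.dfn (\<lambda>e. R (e 0) (e 1))"
  shows "\<exists>Y. \<forall>x\<in>elts X. (\<exists>y. R x y) \<longrightarrow> (\<exists>y\<in>elts Y. R x y)"
proof -
  obtain p d where p: "\<forall>e. R (e 0) (e 1) = sat UNIV p (mix e d)"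
    using univ_dfnD[OF assms] by (elim exE)
  \<comment> \<open>In \<open>p\<close> the two distinguished arguments are variables 0 and 2, and
    the parameter \<open>d 0\<close> is variable 1; the schema wants the arguments at 0 and
    1.\<close>
  define f :: "nat \<Rightarrow> nat" where "f k = (if k = 1 then 2 else if k = 2 then 1 else k)" for k
  have f: "inj f" by (rule inj_on_inverseI[of _ f]) (simp add: f_def)
  define a where "a = (mix (\<lambda>_. X) d)(2 := d 0)"
  have eq: "a(0 := x, 1 := y) \<circ> f = mix ((\<lambda>_. X)(0 := x, 1 := y)) d" for x y
  proof
    fix k :: nat
    consider "k = 0" | "k = 1" | "k = 2" | "k > 2" by linarith
    then show "(a(0 := x, 1 := y) \<circ> f) k = mix ((\<lambda>_. X)(0 := x, 1 := y)) d k"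
    proof cases
      assume k: "k > 2"
      then show ?thesis
        by (cases "even k") (auto simp: a_def f_def mix_def elim!: evenE oddE)
    qed (simp_all add: a_def f_def mix_def)
  qed
  have R: "R x y = sat UNIV (ren f p) (a(0 := x, 1 := y))" for x y
    using p[rule_format, of "(\<lambda>_. X)(0 := x, 1 := y)"] unfolding sat_ren[OF f] eq by simp
  show ?thesis
    using ax_collectionD[OF collection UNIV_I subset_UNIV UNIV_I, of X "ren f p" a]
    unfolding R elts_def by simp
qed

definition sepset :: "'u \<Rightarrow> ('u \<Rightarrow> bool) \<Rightarrow> 'u" where
  "sepset X P = (THE Y. elts Y = {x \<in> elts X. P x})"

lemma the_elts: assumes "\<exists>Y. elts Y = A" shows "elts (THE Y. elts Y = A) = A"
proof -
  obtain Y where Y: "elts Y = A" using assms by blast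
  then have "(THE Y. elts Y = A) = Y" by (intro the_equality elts_eqI) auto
  then show ?thesis using Y by simp
qed

lemma elts_sepset: "univ.dfn (\<lambda>e. P (e 0)) \<Longrightarrow> elts (sepset X P) = {x \<in> elts X. P x}"
  unfolding sepset_def by (rule the_elts[OF separation_set])

text \<open>By extensionality a set is pinned down by its elements, so a set-valued term is
  definable as soon as membership in it is.\<close>

lemma dtm_by_elts:
  assumes "univ.dfn (\<lambda>e. \<Phi> (\<lambda>i. e (Suc i)) (e 0))" "\<And>e. elts (t e) = {x. \<Phi> e x}"
  shows "univ.dtm t"
proof (rule univ.dtmI[where \<Phi> = "\<lambda>e y. \<forall>x. x \<^bold>\<in> y \<longleftrightarrow> \<Phi> e x"])
  have *: "univ.dfn (\<lambda>e. \<Phi> (\<lambda>i. e (Suc (Suc i))) (e 0))"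
    by (rule univ.dfn_shift_under[OF assms(1)])
  show "univ.dfn (\<lambda>e. \<forall>x. x \<^bold>\<in> e 0 \<longleftrightarrow> \<Phi> (\<lambda>i. e (Suc i)) x)"
    by (intro dfn_rules *)
  show "y = t e \<longleftrightarrow> (\<forall>x. x \<^bold>\<in> y \<longleftrightarrow> \<Phi> e x)" for e y
    using assms(2)[of e] elts_eqI[of y "t e"] by (auto simp: elts_def)
qed simp

lemma dtm_sepset:
  assumes "univ.dtm t" "univ.dfn (\<lambda>e. \<Phi> (\<lambda>i. e (Suc i)) (e 0))"
  shows "univ.dtm (\<lambda>e. sepset (t e) (\<Phi> e))"
proof (rule dtm_by_elts[where \<Phi> = "\<lambda>e x. x \<^bold>\<in> t e \<and> \<Phi> e x"])
  show "univ.dfn (\<lambda>e. e 0 \<^bold>\<in> t (\<lambda>i. e (Suc i)) \<and> \<Phi> (\<lambda>i. e (Suc i)) (e 0))"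
    by (intro dfn_rules univ.dtm_shift assms)
  show "elts (sepset (t e) (\<Phi> e)) = {x. x \<^bold>\<in> t e \<and> \<Phi> e x}" for e
    by (subst elts_sepset) (auto simp: elts_def intro!: univ.dfn_fix1 assms(2))
qed

definition unionset :: "'u \<Rightarrow> 'u" where "unionset X = (THE Y. elts Y = (\<Union>x\<in>elts X. elts x))"

lemma elts_unionset: "elts (unionset X) = (\<Union>x\<in>elts X. elts x)"
  unfolding unionset_def
proof (rule the_elts)
  obtain u where "\<forall>z. z \<^bold>\<in> u \<longleftrightarrow> (\<exists>y. y \<^bold>\<in> X \<and> z \<^bold>\<in> y)"
    using union unfolding ax_union_def ball_UNIV bex_UNIV by meson
  then have "elts u = (\<Union>x\<in>elts X. elts x)" by (auto simp: elts_def)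
  then show "\<exists>Y. elts Y = (\<Union>x\<in>elts X. elts x)" ..
qed

lemma dtm_unionset: assumes "univ.dtm t" shows "univ.dtm (\<lambda>e. unionset (t e))"
proof (rule dtm_by_elts[where \<Phi> = "\<lambda>e x. \<exists>y\<in>elts (t e). x \<^bold>\<in> y"])
  show "univ.dfn (\<lambda>e. \<exists>y\<in>elts (t (\<lambda>i. e (Suc i))). e 0 \<^bold>\<in> y)"
    by (intro dfn_rules univ.dtm_shift assms)
qed (auto simp: elts_unionset mem_elts)

lemma unionset_II: assumes "x \<in> II" shows "unionset x \<in> II"
proof -
  obtain u where u: "u \<in> II" "\<forall>z\<in>II. z \<^bold>\<in> u \<longleftrightarrow> (\<exists>y\<in>II. y \<^bold>\<in> x \<and> z \<^bold>\<in> y)"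
    using union_II assms unfolding ax_union_def by blast
  have "z \<in> elts u \<longleftrightarrow> z \<in> elts (unionset x)" for z
  proof
    assume "z \<in> elts u"
    then show "z \<in> elts (unionset x)"
      using u(2) elts_of_II[OF u(1)] by (auto simp: elts_unionset mem_elts[symmetric])
  next
    assume "z \<in> elts (unionset x)"
    then obtain y where y: "y \<^bold>\<in> x" "z \<^bold>\<in> y"
      by (auto simp: elts_unionset mem_elts[symmetric])
    then have "y \<in> II" using transitivity_of_II[OF assms] by simp
    with y show "z \<in> elts u" using u(2) transitivity_of_II[of y z] by (auto simp: elts_def)
  qed
  then have "u = unionset x" by (intro elts_eqI) auto
  then show ?thesis using u by simp
qed

definition vun :: "'u \<Rightarrow> 'u \<Rightarrow> 'u" where "vun a b = unionset (upair a b)"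
definition ins :: "'u \<Rightarrow> 'u \<Rightarrow> 'u" where "ins x a = vun a (upair x x)"
definition zero :: 'u where "zero = sepset undefined (\<lambda>_. False)"

lemma elts_vun [simp]: "elts (vun a b) = elts a \<union> elts b"
  by (simp add: vun_def elts_unionset elts_upair)

lemma elts_ins [simp]: "elts (ins x a) = insert x (elts a)"
  by (auto simp: ins_def elts_upair)

lemma elts_zero [simp]: "elts zero = {}"
  unfolding zero_def by (subst elts_sepset) (auto intro: univ.dfn_const)

lemma elts_empty_iff [simp]: "elts x = {} \<longleftrightarrow> x = zero"
proof
  assume "elts x = {}"
  then have "elts x = elts zero" by simp
  then show "x = zero" by (rule elts_eqI)
qed simp

lemma vun_II: "a \<in> II \<Longrightarrow> b \<in> II \<Longrightarrow> vun a b \<in> II"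
  unfolding vun_def by (intro unionset_II upair_II)

lemma ins_II: "x \<in> II \<Longrightarrow> a \<in> II \<Longrightarrow> ins x a \<in> II"
  unfolding ins_def by (intro vun_II upair_II)

lemma dtm_vun: "univ.dtm t \<Longrightarrow> univ.dtm s \<Longrightarrow> univ.dtm (\<lambda>e. vun (t e) (s e))"
  unfolding vun_def by (intro dtm_unionset univ.dtm_upair)

lemma dtm_ins: "univ.dtm t \<Longrightarrow> univ.dtm s \<Longrightarrow> univ.dtm (\<lambda>e. ins (t e) (s e))"
  unfolding ins_def by (intro dtm_vun univ.dtm_upair)

definition replset :: "'u \<Rightarrow> ('u \<Rightarrow> 'u) \<Rightarrow> 'u" where
  "replset X h = (THE Y. elts Y = h ` elts X)"

lemma dtm_graph: "univ.dtm (\<lambda>e. h (e 0)) \<Longrightarrow> univ.dfn (\<lambda>e. e 1 = h (e 0))"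
  using univ.dtm1I[of h "\<lambda>e. e 0"] by (intro univ.dfn_eq univ.dtm_var)

text \<open>Replacement is derived from Collection: a collected set contains all the values, and
  Separation removes everything else.\<close>

lemma elts_replset: assumes "univ.dtm (\<lambda>e. h (e 0))" shows "elts (replset X h) = h ` elts X"
  unfolding replset_def
proof (rule the_elts)
  obtain W where W: "\<forall>x\<in>elts X. (\<exists>y. y = h x) \<longrightarrow> (\<exists>y\<in>elts W. y = h x)"
    using collection_set[OF dtm_graph[OF assms]] by blast
  have "univ.dfn (\<lambda>e. \<exists>x\<in>elts X. e 0 = h x)"
    by (intro dfn_rules univ.dtm1I[OF assms])
  from separation_set[OF this] show "\<exists>Y. elts Y = h ` elts X"
    using W by fastforce
qed

lemma dtm_replset:
  assumes "univ.dtm t" "univ.dtm (\<lambda>e. h (\<lambda>i. e (Suc i)) (e 0))"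
  shows "univ.dtm (\<lambda>e. replset (t e) (h e))"
proof (rule dtm_by_elts[where \<Phi> = "\<lambda>e y. \<exists>x\<in>elts (t e). y = h e x"])
  have "univ.dfn (\<lambda>e. e 0 = h (\<lambda>i. e (Suc (Suc i))) (e (Suc 0)))"
    using assms(2) unfolding univ.dtm_def by simp
  from univ.dfn_ren[OF this, of "\<lambda>i. if i = 0 then 1 else if i = 1 then 0 else i"]
  have *: "univ.dfn (\<lambda>e. e (Suc 0) = h (\<lambda>i. e (Suc (Suc i))) (e 0))" by (simp add: inj_def)
  show "univ.dfn (\<lambda>e. \<exists>x\<in>elts (t (\<lambda>i. e (Suc i))). e 0 = h (\<lambda>i. e (Suc i)) x)"
    by (intro univ.dfn_bex univ.dtm_shift assms(1) *)
  show "elts (replset (t e) (h e)) = {y. \<exists>x\<in>elts (t e). y = h e x}" for e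
    by (subst elts_replset) (auto intro!: univ.dtm_fix1 assms(2))
qed

lemmas dtm_rules = dtm_sepset dtm_unionset dtm_vun dtm_ins dtm_replset dtm_const

subsection \<open>Functions as sets\<close>

text \<open>The description operator in \<open>app\<close> is not definable outside the domain of a function,
  whereas the following variant is a definable term everywhere.\<close>

definition appx :: "'u \<Rightarrow> 'u \<Rightarrow> 'u" where
  "appx f x = (if \<exists>!y. pair x y \<^bold>\<in> f then app f x else f)"

lemma dtm_appx:
  assumes "univ.dtm t" "univ.dtm s"
  shows "univ.dtm (\<lambda>e. appx (t e) (s e))"
proof (rule univ.dtm2I[OF _ assms])
  show "univ.dtm (\<lambda>e. appx (e 0) (e 1))"
  proof (rule univ.dtmI[where \<Phi> = "\<lambda>(e :: nat \<Rightarrow> 'u) y. ((\<exists>!z. pair (e 1) z \<^bold>\<in> e 0) \<and> pair (e 1) y \<^bold>\<in> e 0) \<or>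
      (\<not> (\<exists>!z. pair (e 1) z \<^bold>\<in> e 0) \<and> y = e 0)"])
    show "univ.dfn (\<lambda>e. ((\<exists>!z. pair (e (Suc 1)) z \<^bold>\<in> e (Suc 0)) \<and> pair (e (Suc 1)) (e 0) \<^bold>\<in> e (Suc 0)) \<or>
      (\<not> (\<exists>!z. pair (e (Suc 1)) z \<^bold>\<in> e (Suc 0)) \<and> e 0 = e (Suc 0)))"
      by (intro dfn_rules)
    show "y = appx (e 0) (e 1) \<longleftrightarrow> ((\<exists>!z. pair (e 1) z \<^bold>\<in> e 0) \<and> pair (e 1) y \<^bold>\<in> e 0) \<or>
      (\<not> (\<exists>!z. pair (e 1) z \<^bold>\<in> e 0) \<and> y = e 0)" for e :: "nat \<Rightarrow> 'u" and y
    proof (cases "\<exists>!z. pair (e 1) z \<^bold>\<in> e 0")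
      case True
      then have "pair (e 1) (app (e 0) (e 1)) \<^bold>\<in> e 0" unfolding app_def by (rule theI')
      then have "pair (e 1) y \<^bold>\<in> e 0 \<longleftrightarrow> y = app (e 0) (e 1)"
        using True by (auto elim: ex1E)
      with True show ?thesis by (simp add: appx_def)
    qed (simp add: appx_def)
  qed simp
qed

lemma func_app:
  assumes "func f X Y" "x \<in> elts X"
  shows "app f x \<in> elts Y" "pair x y \<^bold>\<in> f \<longleftrightarrow> y = app f x" "appx f x = app f x"
proof -
  have ex1: "\<exists>!y. pair x y \<^bold>\<in> f" using assms unfolding func_def by blast
  then have "pair x (app f x) \<^bold>\<in> f" unfolding app_def by (rule theI')
  with ex1 show "pair x y \<^bold>\<in> f \<longleftrightarrow> y = app f x" by (auto elim: ex1E)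
  have "pair x (app f x) \<in> elts f" using \<open>pair x (app f x) \<^bold>\<in> f\<close> by (simp add: elts_def)
  then have "\<exists>x'\<in>elts X. \<exists>y\<in>elts Y. pair x (app f x) = pair x' y"
    using assms(1) unfolding func_def by blast
  then show "app f x \<in> elts Y" by auto
  show "appx f x = app f x" using ex1 by (simp add: appx_def)
qed

definition lam :: "'u \<Rightarrow> ('u \<Rightarrow> 'u) \<Rightarrow> 'u" where "lam X h = replset X (\<lambda>x. pair x (h x))"

lemma mem_lam:
  assumes "univ.dtm (\<lambda>e. h (e 0))"
  shows "p \<^bold>\<in> lam X h \<longleftrightarrow> (\<exists>x\<in>elts X. p = pair x (h x))"
proof -
  have "elts (lam X h) = (\<lambda>x. pair x (h x)) ` elts X"
    unfolding lam_def by (intro elts_replset univ.dtm_pair assms univ.dtm_var)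
  then have "p \<in> elts (lam X h) \<longleftrightarrow> (\<exists>x\<in>elts X. p = pair x (h x))" by (simp add: image_iff)
  then show ?thesis by (simp add: mem_elts)
qed

lemma func_lam:
  assumes "univ.dtm (\<lambda>e. h (e 0))" "h ` elts X \<subseteq> elts Y"
  shows "func (lam X h) X Y"
  unfolding func_def
proof (intro conjI ballI)
  fix p assume "p \<in> elts (lam X h)"
  then show "\<exists>x\<in>elts X. \<exists>y\<in>elts Y. p = pair x y"
    unfolding mem_elts mem_lam[OF assms(1)] using assms(2) by blast
next
  fix x assume "x \<in> elts X"
  then show "\<exists>!y. pair x y \<^bold>\<in> lam X h" unfolding mem_lam[OF assms(1)] by simp
qed

lemma app_lam:
  assumes "univ.dtm (\<lambda>e. h (e 0))" "x \<in> elts X"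
  shows "app (lam X h) x = h x"
  unfolding app_def mem_lam[OF assms(1)] using assms(2) by (intro the_equality) simp_all

lemma bijection_lam:
  assumes "univ.dtm (\<lambda>e. h (e 0))" "bij_betw h (elts X) (elts Y)"
  shows "bijection (lam X h) X Y"
  unfolding bijection_def
proof
  show "func (lam X h) X Y" using assms by (intro func_lam) (auto simp: bij_betw_def)
  show "bij_betw (app (lam X h)) (elts X) (elts Y)"
    using assms(2) app_lam[OF assms(1)] by (subst bij_betw_cong[where g = h])
qed

text \<open>Mentions only membership of pairs and no \<open>app\<close>, hence makes bijectivity
  expressible by a formula.\<close>

lemma bijection_iff:
  "bijection f X Y \<longleftrightarrow> func f X Y \<and> (\<forall>y\<in>elts Y. \<exists>!x. x \<in> elts X \<and> pair x y \<^bold>\<in> f)"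
proof (cases "func f X Y")
  case True
  have "app f ` elts X \<subseteq> elts Y" using func_app(1)[OF True] by auto
  then show ?thesis
    using True func_app(2)[OF True] by (simp add: bijection_def bij_betw_iff_ex1 cong: conj_cong)
qed (simp add: bijection_def)

lemma dfn_func:
  assumes "univ.dtm t" "univ.dtm s" "univ.dtm r"
  shows "univ.dfn (\<lambda>e. func (t e) (s e) (r e))"
  by (rule univ.dfn3I[OF _ assms]) (unfold func_def, intro dfn_rules)

lemma dfn_bijection:
  assumes "univ.dtm t" "univ.dtm s" "univ.dtm r"
  shows "univ.dfn (\<lambda>e. bijection (t e) (s e) (r e))"
  by (rule univ.dfn3I[OF _ assms]) (unfold bijection_iff func_def, intro dfn_rules)

text \<open>A uniquely determined element is the union of the set of all such elements.\<close>

definition inv_app :: "'u \<Rightarrow> 'u \<Rightarrow> 'u \<Rightarrow> 'u" where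
  "inv_app X f y = unionset (sepset X (\<lambda>x. pair x y \<^bold>\<in> f))"

lemma dtm_inv_app:
  assumes "univ.dtm t"
  shows "univ.dtm (\<lambda>e. inv_app X f (t e))"
  by (rule univ.dtm1I[OF _ assms]) (unfold inv_app_def, intro dtm_rules dfn_rules)

lemma inv_app:
  assumes "func f X Y" "inj_on (app f) (elts X)" "x \<in> elts X"
  shows "inv_app X f (app f x) = x"
proof (rule elts_eqI)
  have "elts (sepset X (\<lambda>z. pair z (app f x) \<^bold>\<in> f)) = {z \<in> elts X. pair z (app f x) \<^bold>\<in> f}"
    by (rule elts_sepset) (intro dfn_rules)
  also have "\<dots> = {x}" using assms func_app(2)[OF assms(1)] by (auto dest: inj_onD)
  finally show "elts (inv_app X f (app f x)) = elts x" by (simp add: inv_app_def elts_unionset)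
qed

lemma bijection_inverse:
  assumes "bijection f X Y"
  shows "bijection (lam Y (inv_app X f)) Y X"
proof (rule bijection_lam)
  show "univ.dtm (\<lambda>e. inv_app X f (e 0))" by (intro dtm_inv_app univ.dtm_var)
  have f: "func f X Y" "inj_on (app f) (elts X)" "app f ` elts X = elts Y"
    using assms by (auto simp: bijection_def bij_betw_def)
  show "bij_betw (inv_app X f) (elts Y) (elts X)"
    by (rule bij_betw_byWitness[where f' = "app f"]) (auto simp: inv_app[OF f(1,2)] f(3)[symmetric])
qed

subsection \<open>Natural numbers\<close>

definition suc :: "'u \<Rightarrow> 'u" where "suc n = ins n n"

lemma elts_suc [simp]: "elts (suc n) = insert n (elts n)"
  by (simp add: suc_def)

lemma dtm_suc: "univ.dtm t \<Longrightarrow> univ.dtm (\<lambda>e. suc (t e))"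
  unfolding suc_def by (intro dtm_ins)

lemma closed_under_Suc_iff:
  "closed_under_Suc W \<longleftrightarrow> zero \<^bold>\<in> W \<and> (\<forall>n\<in>elts W. suc n \<^bold>\<in> W)"
proof -
  have "elts m = insert n (elts n) \<longleftrightarrow> m = suc n" for m n
    using elts_eqI[of m "suc n"] by auto
  then show ?thesis by (simp add: closed_under_Suc_def)
qed

text \<open>Belonging to every inductive set is a definable condition, and it is separated from the
  inductive set that the axiom of infinity provides.\<close>

lemma ex_omega: "\<exists>w. elts w = NN"
proof -
  obtain w z where w: "z \<^bold>\<in> w" "\<forall>y. \<not> y \<^bold>\<in> z"
    "\<forall>n. n \<^bold>\<in> w \<longrightarrow> (\<exists>m. m \<^bold>\<in> w \<and> (\<forall>y. y \<^bold>\<in> m \<longleftrightarrow> y \<^bold>\<in> n \<or> y = n))"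
    using infinity unfolding ax_infinity_def ball_UNIV bex_UNIV by (elim exE conjE)
  have "elts z = {}" using w(2) by (auto simp: elts_def)
  moreover have "suc n \<^bold>\<in> w" if n: "n \<^bold>\<in> w" for n
  proof -
    obtain m where m: "m \<^bold>\<in> w" "\<forall>y. y \<^bold>\<in> m \<longleftrightarrow> y \<^bold>\<in> n \<or> y = n" using w(3)[rule_format, OF n] by (elim exE conjE)
    then have "elts m = elts (suc n)" by (auto simp: mem_elts)
    then have "m = suc n" by (rule elts_eqI)
    then show ?thesis using m(1) by simp
  qed
  ultimately have cl: "closed_under_Suc w" using w(1) by (simp add: closed_under_Suc_iff mem_elts)
  have "univ.dfn (\<lambda>e. \<forall>W. closed_under_Suc W \<longrightarrow> e 0 \<^bold>\<in> W)"
    unfolding closed_under_Suc_iff by (intro dfn_rules dtm_suc dtm_const)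
  from separation_set[OF this, of w] obtain y where
    "elts y = {x \<in> elts w. \<forall>W. closed_under_Suc W \<longrightarrow> x \<^bold>\<in> W}" by (elim exE)
  then have "elts y = NN" using cl unfolding NN_def by (auto simp: mem_elts)
  then show ?thesis ..
qed

definition omega :: 'u where "omega = (THE w. elts w = NN)"

lemma elts_omega: "elts omega = NN"
  unfolding omega_def by (rule the_elts[OF ex_omega])

lemma zero_NN: "zero \<in> NN" and suc_NN: "n \<in> NN \<Longrightarrow> suc n \<in> NN"
  unfolding NN_def by (auto simp: closed_under_Suc_iff mem_elts)

lemma NN_subset: "closed_under_Suc W \<Longrightarrow> NN \<subseteq> elts W"
  unfolding NN_def by (auto simp: mem_elts)

text \<open>Minimality of \<open>NN\<close> is applied to the set of numbers satisfying
  \<open>P\<close>. That this is a set requires \<open>P\<close> to be definable, hence the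
  additional premise.\<close>

lemma NN_induct [consumes 1, case_names definable zero suc]:
  assumes "n \<in> NN" "univ.dfn (\<lambda>e. P (e 0))" "P zero" "\<And>n. n \<in> NN \<Longrightarrow> P n \<Longrightarrow> P (suc n)"
  shows "P n"
proof -
  have W: "elts (sepset omega P) = {n \<in> NN. P n}"
    using elts_sepset[OF assms(2)] by (simp add: elts_omega)
  then have "closed_under_Suc (sepset omega P)"
    using assms(3,4) zero_NN suc_NN by (auto simp: closed_under_Suc_iff mem_elts[symmetric])
  then show ?thesis using NN_subset W assms(1) by blast
qed

lemma elts_NN: assumes "n \<in> NN" shows "elts n \<subseteq> NN"
proof -
  have "elts n \<subseteq> elts omega"
    using assms
  proof (induction rule: NN_induct)
    case definable
    show ?case by (intro univ.dfn_subset dtm_const univ.dtm_var)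
  qed (auto simp: elts_omega)
  then show ?thesis by (simp add: elts_omega)
qed

subsection \<open>Internal ordinals\<close>

lemma int_ordinalD:
  assumes "int_ordinal k"
  shows "k \<in> II" "x \<in> elts k \<Longrightarrow> elts x \<subseteq> elts k"
    "x \<in> elts k \<Longrightarrow> y \<in> elts k \<Longrightarrow> x \<in> elts y \<or> x = y \<or> y \<in> elts x"
    "s \<in> II \<Longrightarrow> elts s \<subseteq> elts k \<Longrightarrow> elts s \<noteq> {} \<Longrightarrow> \<exists>m\<in>elts s. elts m \<inter> elts s = {}"
proof -
  note k = assms[unfolded int_ordinal_def]
  show "k \<in> II" using k by (rule conjunct1)
  show "x \<in> elts k \<Longrightarrow> elts x \<subseteq> elts k"
    using k[THEN conjunct2, THEN conjunct1] by (rule bspec)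
  show "x \<in> elts y \<or> x = y \<or> y \<in> elts x" if "x \<in> elts k" "y \<in> elts k"
    using k[THEN conjunct2, THEN conjunct2, THEN conjunct1, THEN bspec, OF that(1), THEN bspec, OF that(2)]
    unfolding mem_elts .
  show "\<exists>m\<in>elts s. elts m \<inter> elts s = {}" if "s \<in> II" "elts s \<subseteq> elts k" "elts s \<noteq> {}"
    using k[THEN conjunct2, THEN conjunct2, THEN conjunct2, THEN bspec, OF that(1), THEN mp, OF conjI, OF that(2,3)] .
qed

text \<open>Otherwise the singleton of \<open>k\<close> would be a nonempty internal subset of
  \<open>k\<close> without a minimal element.\<close>

lemma int_ordinal_irrefl:
  assumes "int_ordinal k"
  shows "k \<notin> elts k"
proof
  assume k: "k \<in> elts k"
  have "elts (upair k k) \<subseteq> elts k" "elts (upair k k) \<noteq> {}"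
    using k by (simp_all add: elts_upair del: elts_empty_iff)
  from int_ordinalD(4)[OF assms _ this] have "\<exists>m\<in>elts (upair k k). elts m \<inter> elts (upair k k) = {}"
    using int_ordinalD(1)[OF assms] by (simp add: upair_II)
  then show False using k by (simp add: elts_upair)
qed

lemma int_ordinal_suc:
  assumes k: "int_ordinal k"
  shows "int_ordinal (suc k)"
  unfolding int_ordinal_def elts_suc
proof (intro conjI ballI impI)
  show "suc k \<in> II" unfolding suc_def using int_ordinalD(1)[OF k] by (intro ins_II)
  show "elts x \<subseteq> insert k (elts k)" if "x \<in> insert k (elts k)" for x
    using that int_ordinalD(2)[OF k, of x] by auto
  show "x \<^bold>\<in> y \<or> x = y \<or> y \<^bold>\<in> x" if "x \<in> insert k (elts k)" "y \<in> insert k (elts k)" for x y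
    using that int_ordinalD(3)[OF k, of x y] by (auto simp: mem_elts[symmetric])
  fix s assume s: "s \<in> II" "elts s \<subseteq> insert k (elts k) \<and> elts s \<noteq> {}"
  have irr: "k \<notin> elts k" by (rule int_ordinal_irrefl[OF k])
  show "\<exists>m\<in>elts s. elts m \<inter> elts s = {}"
  proof (cases "elts s \<inter> elts k = {}")
    case True
    then have "k \<in> elts s" "elts k \<inter> elts s = {}" using s(2) by blast+
    then show ?thesis by blast
  next
    case False
    \<comment> \<open>Minimal elements are available only for internal subsets of \<open>k\<close>,
      so the part of \<open>s\<close> below \<open>k\<close> is formed by internal
      separation.\<close>
    have "intl.dfn (\<lambda>e. e 0 \<in> elts k)"
      using int_ordinalD(1)[OF k] by (intro intl.dfn_elts intl.dtm_const intl.dtm_var)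
    from separation_internal[OF s(1) this] obtain t where
      t: "t \<in> II" "elts t = {x \<in> elts s. x \<in> elts k}" by (elim bexE)
    then have "elts t \<subseteq> elts k" "elts t \<noteq> {}" using False by auto
    from int_ordinalD(4)[OF k t(1) this] obtain m where m: "m \<in> elts t" "elts m \<inter> elts t = {}"
      by (elim bexE)
    then have mk: "m \<in> elts s" "m \<in> elts k" using t(2) by auto
    have "elts m \<inter> elts s = {}"
      using m(2) int_ordinalD(2)[OF k mk(2)] t(2) by auto
    then show ?thesis using mk(1) by blast
  qed
qed

text \<open>The point is transitivity of \<open>x\<close>. If z in y in x, and z is not in
  \<open>x\<close>, linearity in \<open>k\<close> produces a membership cycle of length two or
  three; its members form an internal subset of \<open>k\<close> without a minimal element.\<close>

lemma int_ordinal_elt: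
  assumes k: "int_ordinal k" and x: "x \<in> elts k"
  shows "int_ordinal x"
  unfolding int_ordinal_def
proof (intro conjI ballI impI)
  have sub: "elts x \<subseteq> elts k" by (rule int_ordinalD(2)[OF k x])
  show "x \<in> II" using elts_of_II[OF int_ordinalD(1)[OF k]] x by (rule subsetD)
  show "y \<^bold>\<in> z \<or> y = z \<or> z \<^bold>\<in> y" if "y \<in> elts x" "z \<in> elts x" for y z
    using int_ordinalD(3)[OF k, of y z] that sub by (auto simp: mem_elts[symmetric])
  show "\<exists>m\<in>elts s. elts m \<inter> elts s = {}" if "s \<in> II" "elts s \<subseteq> elts x \<and> elts s \<noteq> {}" for s
    using that sub by (intro int_ordinalD(4)[OF k that(1)]) auto
  show "elts y \<subseteq> elts x" if y: "y \<in> elts x" for y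
  proof
    fix z assume z: "z \<in> elts y"
    have yk: "y \<in> elts k" using sub y by (rule subsetD)
    have zk: "z \<in> elts k" using int_ordinalD(2)[OF k yk] z by (rule subsetD)
    have kI: "elts k \<subseteq> II" by (rule elts_of_II[OF int_ordinalD(1)[OF k]])
    have xI: "x \<in> II" "y \<in> II" "z \<in> II"
      using kI x yk zk by auto
    consider "z \<in> elts x" | "z = x" | "x \<in> elts z" using int_ordinalD(3)[OF k zk x] by auto
    then show "z \<in> elts x"
    proof cases
      case 2
      have "elts (upair x y) \<subseteq> elts k" "elts (upair x y) \<noteq> {}"
        using x yk by (simp_all add: elts_upair del: elts_empty_iff)
      from int_ordinalD(4)[OF k upair_II[OF xI(1,2)] this] show ?thesis
        using y z 2 by (auto simp: elts_upair)
    next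
      case 3
      have "elts (ins z (upair x y)) \<subseteq> elts k" "elts (ins z (upair x y)) \<noteq> {}"
        using x yk zk by (simp_all add: elts_upair del: elts_empty_iff)
      from int_ordinalD(4)[OF k ins_II[OF xI(3) upair_II[OF xI(1,2)]] this] show ?thesis
        using y z 3 by (auto simp: elts_upair)
    qed
  qed
qed

text \<open>The witness is the least element of the internal set of elements of \<open>j\<close>
  outside \<open>k\<close>.\<close>

lemma int_ordinal_inter:
  assumes j: "int_ordinal j" and k: "int_ordinal k" and "\<not> elts j \<subseteq> elts k"
  shows "\<exists>m\<in>elts j. elts m = elts j \<inter> elts k"
proof -
  have "intl.dfn (\<lambda>e. e 0 \<notin> elts k)"
    using int_ordinalD(1)[OF k] by (intro intl.dfn_not intl.dfn_elts intl.dtm_const intl.dtm_var)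
  from separation_internal[OF int_ordinalD(1)[OF j] this] obtain t where
    t: "t \<in> II" "elts t = {x \<in> elts j. x \<notin> elts k}" by (elim bexE)
  then have "elts t \<subseteq> elts j" "elts t \<noteq> {}" using assms(3) by auto
  from int_ordinalD(4)[OF j t(1) this] obtain m where m: "m \<in> elts t" "elts m \<inter> elts t = {}"
    by (elim bexE)
  have mj: "m \<in> elts j" "m \<notin> elts k" using m(1) t(2) by auto
  have "elts m \<subseteq> elts j \<inter> elts k" using m(2) t(2) int_ordinalD(2)[OF j mj(1)] by auto
  moreover have "x \<in> elts m" if x: "x \<in> elts j" "x \<in> elts k" for x
    using int_ordinalD(3)[OF j x(1) mj(1)] mj(2) x(2) int_ordinalD(2)[OF k x(2)] by auto
  ultimately have "elts m = elts j \<inter> elts k" by auto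
  then show ?thesis using mj(1) by blast
qed

text \<open>If neither ordinal included the other, their intersection would be an element of both,
  hence of itself.\<close>

lemma int_ordinal_linear:
  assumes j: "int_ordinal j" and k: "int_ordinal k"
  shows "j \<in> elts k \<or> j = k \<or> k \<in> elts j"
proof (cases "elts j \<subseteq> elts k")
  case jk: True
  show ?thesis
  proof (cases "elts k \<subseteq> elts j")
    case True
    then have "elts j = elts k" using jk by auto
    then show ?thesis using elts_eqI by auto
  next
    case False
    obtain m where m: "m \<in> elts k" "elts m = elts k \<inter> elts j"
      using int_ordinal_inter[OF k j False] by (elim bexE)
    then have "elts m = elts j" using jk by auto
    then have "m = j" by (rule elts_eqI)
    then show ?thesis using m(1) by simp
  qed
next
  case False
  obtain m where m: "m \<in> elts j" "elts m = elts j \<inter> elts k"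
    using int_ordinal_inter[OF j k False] by (elim bexE)
  show ?thesis
  proof (cases "elts k \<subseteq> elts j")
    case True
    then have "elts m = elts k" using m by auto
    then have "m = k" by (rule elts_eqI)
    then show ?thesis using m(1) by simp
  next
    case False
    obtain m' where m': "m' \<in> elts k" "elts m' = elts k \<inter> elts j"
      using int_ordinal_inter[OF k j False] by (elim bexE)
    then have "elts m = elts m'" using m by auto
    then have "m = m'" by (rule elts_eqI)
    then have "m \<in> elts m" using m m'(1) by simp
    then show ?thesis using int_ordinal_irrefl[OF int_ordinal_elt[OF j m(1)]] by simp
  qed
qed

text \<open>An internal inductive set is cut down to its internal ordinals by internal separation.
  The result is still closed under successors, so it includes the external \<open>NN\<close>; it is
  the ambient set for overspill.\<close>

lemma ex_internal_ordinals: "\<exists>W\<in>II. NN \<subseteq> elts W \<and> (\<forall>k\<in>elts W. int_ordinal k)"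
proof -
  obtain w where w1: "w \<in> II" "(\<exists>z\<in>II. z \<^bold>\<in> w \<and> (\<forall>y\<in>II. \<not> y \<^bold>\<in> z)) \<and>
    (\<forall>n\<in>II. n \<^bold>\<in> w \<longrightarrow> (\<exists>m\<in>II. m \<^bold>\<in> w \<and> (\<forall>y\<in>II. y \<^bold>\<in> m \<longleftrightarrow> y \<^bold>\<in> n \<or> y = n)))"
    using infinity_II unfolding ax_infinity_def by (elim bexE)
  note w = w1(1) conjunct1[OF w1(2)] conjunct2[OF w1(2)]
  obtain z where z: "z \<in> II" "z \<^bold>\<in> w" "\<forall>y\<in>II. \<not> y \<^bold>\<in> z" using w(2) by (elim bexE conjE)
  have "elts z = {}" using z(3) elts_of_II[OF z(1)] by (auto simp: elts_def)
  then have z': "zero \<^bold>\<in> w" "zero \<in> II" using z by simp_all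
  have suc_w: "suc n \<^bold>\<in> w" if n: "n \<^bold>\<in> w" for n
  proof -
    have nI: "n \<in> II" using transitivity_of_II[OF w(1) n] .
    obtain m where m: "m \<in> II" "m \<^bold>\<in> w" "\<forall>y\<in>II. y \<^bold>\<in> m \<longleftrightarrow> y \<^bold>\<in> n \<or> y = n"
      using w(3)[rule_format, OF nI n] by (elim bexE conjE)
    have "y \<in> elts m \<longleftrightarrow> y \<in> elts (suc n)" for y
      using m(3) elts_of_II[OF m(1)] elts_of_II[OF nI] nI unfolding elts_suc by (auto simp: elts_def)
    then have "elts m = elts (suc n)" by (rule set_eqI)
    then have "m = suc n" by (rule elts_eqI)
    then show ?thesis using m(2) by simp
  qed
  \<comment> \<open>The conditions on an internal ordinal, with nonemptiness and disjointness
    spelled out by quantifiers to fit the rules of the calculus.\<close>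
  have "intl.dfn (\<lambda>e. (\<forall>x\<in>elts (e 0). elts x \<subseteq> elts (e 0)) \<and>
     (\<forall>x\<in>elts (e 0). \<forall>y\<in>elts (e 0). x \<^bold>\<in> y \<or> x = y \<or> y \<^bold>\<in> x) \<and>
     (\<forall>s\<in>II. elts s \<subseteq> elts (e 0) \<and> (\<exists>x\<in>elts s. True) \<longrightarrow> (\<exists>m\<in>elts s. \<forall>z\<in>elts m. z \<notin> elts s)))"
    by (intro intl.dfn_intros)
  from separation_internal[OF w(1) this] obtain W where W: "W \<in> II"
    "elts W = {k \<in> elts w. (\<forall>x\<in>elts k. elts x \<subseteq> elts k) \<and>
     (\<forall>x\<in>elts k. \<forall>y\<in>elts k. x \<^bold>\<in> y \<or> x = y \<or> y \<^bold>\<in> x) \<and>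
     (\<forall>s\<in>II. elts s \<subseteq> elts k \<and> (\<exists>x\<in>elts s. True) \<longrightarrow> (\<exists>m\<in>elts s. \<forall>z\<in>elts m. z \<notin> elts s))}"
    by (elim bexE)
  have *: "(\<exists>x\<in>A. True) \<longleftrightarrow> A \<noteq> {}" "(\<forall>z\<in>A. z \<notin> B) \<longleftrightarrow> A \<inter> B = {}" for A B :: "'u set" by auto
  have "int_ordinal k" if "k \<in> elts w" "(\<forall>x\<in>elts k. elts x \<subseteq> elts k) \<and>
     (\<forall>x\<in>elts k. \<forall>y\<in>elts k. x \<^bold>\<in> y \<or> x = y \<or> y \<^bold>\<in> x) \<and>
     (\<forall>s\<in>II. elts s \<subseteq> elts k \<and> elts s \<noteq> {} \<longrightarrow> (\<exists>m\<in>elts s. elts m \<inter> elts s = {}))" for k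
    unfolding int_ordinal_def using that elts_of_II[OF w(1)] by (intro conjI) (auto simp del: elts_empty_iff)
  then have W': "elts W = {k \<in> elts w. int_ordinal k}"
    unfolding W(2) * by (intro Collect_cong conj_cong refl) (auto simp: int_ordinal_def simp del: elts_empty_iff)
  have "int_ordinal zero" using z'(2) by (simp add: int_ordinal_def)
  moreover have "k \<in> elts W \<longleftrightarrow> k \<in> elts w \<and> int_ordinal k" for k unfolding W' by simp
  ultimately have "closed_under_Suc W"
    using z'(1) suc_w int_ordinal_suc by (simp add: closed_under_Suc_iff mem_elts)
  then have "NN \<subseteq> elts W" by (rule NN_subset)
  then show ?thesis using W(1) W' by (intro bexI[of _ W]) simp_all
qed

lemma int_ordinal_NN: assumes "n \<in> NN" shows "int_ordinal n"
proof -
  obtain W where "NN \<subseteq> elts W \<and> (\<forall>k\<in>elts W. int_ordinal k)"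
    using ex_internal_ordinals by (elim bexE)
  then show ?thesis using assms by auto
qed

lemma NN_subset_II: "NN \<subseteq> II"
  by (intro subsetI int_ordinalD(1) int_ordinal_NN)

lemma NN_irrefl: "n \<in> NN \<Longrightarrow> n \<notin> elts n"
  by (intro int_ordinal_irrefl int_ordinal_NN)

subsection \<open>Finite sets\<close>

lemma pigeonhole_NN:
  assumes "n \<in> NN"
  shows "\<forall>f. func f n n \<longrightarrow> (\<forall>x\<in>elts n. \<forall>y\<in>elts n. appx f x = appx f y \<longrightarrow> x = y) \<longrightarrow>
    (\<forall>y\<in>elts n. \<exists>x\<in>elts n. appx f x = y)"
  using assms
proof (induction rule: NN_induct)
  case definable
  show ?case by (intro dfn_rules dfn_func dtm_appx)
next
  case (suc n)
  show ?case
  proof (intro allI impI ballI)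
    fix f y assume f: "func f (suc n) (suc n)"
      and inj: "\<forall>x\<in>elts (suc n). \<forall>y\<in>elts (suc n). appx f x = appx f y \<longrightarrow> x = y"
      and y: "y \<in> elts (suc n)"
    have n: "n \<notin> elts n" by (rule NN_irrefl[OF suc.hyps])
    have inj': "x = x'" if "x = n \<or> x \<in> elts n" "x' = n \<or> x' \<in> elts n" "appx f x = appx f x'" for x x'
      using inj[THEN bspec, THEN bspec, of x x'] that by simp
    have rng: "appx f x = n \<or> appx f x \<in> elts n" if "x = n \<or> x \<in> elts n" for x
      using func_app(1,3)[OF f, of x] that by auto
    \<comment> \<open>The point sent to \<open>n\<close>, if there is one below \<open>n\<close>, is
      rerouted to the value of \<open>f\<close> at \<open>n\<close>; this gives an injection of
      \<open>n\<close> into itself, to which the induction hypothesis applies.\<close>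
    define h where "h x = (if appx f x = n then appx f n else appx f x)" for x
    have h: "univ.dtm (\<lambda>e. h (e 0))"
      unfolding h_def by (intro dfn_rules dtm_appx)
    have h_in: "h x \<in> elts n" if "x \<in> elts n" for x
      using that rng[of x] rng[of n] inj'[of x n] n unfolding h_def by auto
    then have g: "func (lam n h) n n" by (intro func_lam[OF h]) auto
    have app_g: "appx (lam n h) x = h x" if "x \<in> elts n" for x
      using func_app(3)[OF g that] app_lam[OF h that] by simp
    have "x = x'" if x: "x \<in> elts n" "x' \<in> elts n" "h x = h x'" for x x'
    proof -
      have "x \<noteq> n" "x' \<noteq> n" using n x(1,2) by auto
      then have "appx f x \<noteq> appx f n" "appx f x' \<noteq> appx f n"
        using inj'[of x n] inj'[of x' n] x(1,2) by auto
      then have "appx f x = appx f x'" using x(3) unfolding h_def by (auto split: if_splits)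
      then show ?thesis using inj'[of x x'] x(1,2) by simp
    qed
    then have "\<forall>x\<in>elts n. \<forall>y\<in>elts n. appx (lam n h) x = appx (lam n h) y \<longrightarrow> x = y"
      by (simp add: app_g)
    with suc.IH g have "\<forall>y\<in>elts n. \<exists>x\<in>elts n. appx (lam n h) x = y" by simp
    then have onto: "\<exists>x\<in>elts n. h x = z" if "z \<in> elts n" for z
      using that by (simp add: app_g)
    show "\<exists>x\<in>elts (suc n). appx f x = y"
    proof (cases "y = n")
      case False
      then obtain x where "x \<in> elts n" "h x = y" using onto[of y] y by auto
      then show ?thesis unfolding h_def by (auto split: if_splits)
    next
      case True
      show ?thesis
      proof (rule ccontr)
        assume no: "\<not> (\<exists>x\<in>elts (suc n). appx f x = y)"
        \<comment> \<open>If \<open>n\<close> is missed, the value of \<open>f\<close> at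
          \<open>n\<close> lies below \<open>n\<close>, so \<open>h\<close> attains it at some
          \<open>x\<close> below \<open>n\<close>. As nothing was rerouted, \<open>f\<close> takes
          the same value at \<open>x\<close> and at \<open>n\<close>.\<close>
        then have "appx f n \<in> elts n" using rng[of n] True by auto
        then obtain x where x: "x \<in> elts n" "h x = appx f n" using onto[of "appx f n"] by auto
        then have "appx f x = appx f n" using no True by (auto simp: h_def split: if_splits)
        then show False using inj'[of x n] x(1) n by auto
      qed
    qed
  qed
qed simp

text \<open>By the pigeonhole principle \<open>h\<close> would map \<open>n\<close> onto itself and
  hence attain \<open>j\<close>, although all its values lie in \<open>j\<close>.\<close>

lemma no_injection_into_element:
  assumes n: "n \<in> NN" and j: "j \<in> elts n" and h: "univ.dtm (\<lambda>e. h (e 0))"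
    and inj: "inj_on h (elts n)" and rng: "h ` elts n \<subseteq> elts j"
  shows False
proof -
  have sub: "elts j \<subseteq> elts n" using int_ordinalD(2)[OF int_ordinal_NN[OF n] j] .
  then have f: "func (lam n h) n n" using rng by (intro func_lam[OF h]) auto
  have ap: "appx (lam n h) x = h x" if "x \<in> elts n" for x
    using func_app(3)[OF f that] app_lam[OF h that] by simp
  have "\<forall>x\<in>elts n. \<forall>y\<in>elts n. appx (lam n h) x = appx (lam n h) y \<longrightarrow> x = y"
    using inj by (auto simp: ap dest: inj_onD)
  then have "\<forall>y\<in>elts n. \<exists>x\<in>elts n. appx (lam n h) x = y"
    using pigeonhole_NN[OF n] f by simp
  then obtain x where "x \<in> elts n" "h x = j" using j ap by auto
  then have "j \<in> elts j" using rng by auto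
  moreover have "j \<in> NN" using elts_NN[OF n] j by auto
  ultimately show False using NN_irrefl by simp
qed

lemma dfn_finite_set: "univ.dtm t \<Longrightarrow> univ.dfn (\<lambda>e. finite_set (t e))"
  unfolding finite_set_def
  by (rule univ.dfn1I[where R = "\<lambda>x. \<exists>n\<in>NN. \<exists>f. bijection f x n"])
    (unfold elts_omega[symmetric], intro dfn_rules dfn_bijection)

lemma finite_zero: "finite_set zero"
proof -
  have "bijection zero zero zero" by (simp add: bijection_def func_def bij_betw_def)
  then show ?thesis using zero_NN unfolding finite_set_def by (intro bexI exI)
qed

lemma bijection_ins:
  assumes f: "bijection f s n" and x: "x \<notin> elts s" and n: "n \<notin> elts n"
  shows "\<exists>g. bijection g (ins x s) (suc n)"
proof -
  have f': "func f s n" "inj_on (app f) (elts s)" "app f ` elts s = elts n"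
    using f by (auto simp: bijection_def bij_betw_def)
  define h where "h y = (if y = x then n else appx f y)" for y
  have h: "univ.dtm (\<lambda>e. h (e 0))" unfolding h_def by (intro dfn_rules dtm_appx)
  have hs: "h y = app f y" if "y \<in> elts s" for y
    using that x func_app(3)[OF f'(1)] by (auto simp: h_def)
  have "h ` elts s = elts n" using f'(3) hs by auto
  moreover have "inj_on h (elts s)" using f'(2) hs by (auto simp: inj_on_def)
  ultimately have "bij_betw h (elts (ins x s)) (elts (suc n))"
    using n by (auto simp: bij_betw_def h_def)
  from bijection_lam[OF h this] show ?thesis ..
qed

lemma finite_ins: assumes "finite_set s" shows "finite_set (ins x s)"
proof (cases "x \<in> elts s")
  case True
  then have "elts (ins x s) = elts s" by auto
  then have "ins x s = s" by (rule elts_eqI)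
  then show ?thesis using assms by simp
next
  case False
  obtain n f where n: "n \<in> NN" "bijection f s n" using assms unfolding finite_set_def by (elim bexE exE)
  then show ?thesis
    using bijection_ins[OF n(2) False NN_irrefl[OF n(1)]] suc_NN[OF n(1)] unfolding finite_set_def
    by (intro bexI[of _ "suc n"])
qed

text \<open>The point removed is the preimage of \<open>n\<close>, so the values of the others fill
  exactly \<open>n\<close>.\<close>

lemma bijection_suc_remove:
  assumes f: "bijection f s (suc n)" and n: "n \<notin> elts n"
  shows "\<exists>x t. s = ins x t \<and> x \<notin> elts t \<and> (\<exists>g. bijection g t n)"
proof -
  have f': "func f s (suc n)" "inj_on (app f) (elts s)" "app f ` elts s = insert n (elts n)"
    using f by (auto simp: bijection_def bij_betw_def)
  have "n \<in> app f ` elts s" using f'(3) by simp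
  then obtain x where x: "x \<in> elts s" "app f x = n" by auto
  define t where "t = sepset s (\<lambda>y. y \<noteq> x)"
  have t: "elts t = elts s - {x}"
    unfolding t_def by (subst elts_sepset) (intro dfn_rules, auto)
  have "elts s = elts (ins x t)" using x t by auto
  then have "s = ins x t" by (rule elts_eqI)
  moreover have "\<exists>g. bijection g t n"
  proof (rule exI, rule bijection_lam)
    show "univ.dtm (\<lambda>e. appx f (e 0))" by (intro dfn_rules dtm_appx)
    have ap: "appx f y = app f y" if "y \<in> elts s" for y using func_app(3)[OF f'(1) that] .
    have "inj_on (appx f) (elts t)" using f'(2) t by (auto simp: inj_on_def ap)
    moreover have "appx f ` elts t = elts n"
    proof -
      have "appx f ` elts t = app f ` (elts s - {x})" using t by (auto simp: ap)
      also have "\<dots> = app f ` elts s - app f ` {x}"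
        using x f'(2) by (intro inj_on_image_set_diff) auto
      finally show ?thesis using f'(3) x(2) n by auto
    qed
    ultimately show "bij_betw (appx f) (elts t) (elts n)" by (simp add: bij_betw_def)
  qed
  moreover have "x \<notin> elts t" using t by simp
  ultimately show ?thesis by metis
qed

text \<open>Induction on the number of elements, for all sets of that size at once; definability of
  \<open>P\<close> is inherited from \<open>NN_induct\<close>.\<close>

lemma finite_set_induct [consumes 1, case_names definable zero ins]:
  assumes "finite_set s" "univ.dfn (\<lambda>e. P (e 0))" "P zero"
    and step: "\<And>x t. finite_set t \<Longrightarrow> x \<notin> elts t \<Longrightarrow> P t \<Longrightarrow> P (ins x t)"
  shows "P s"
proof -
  have "\<forall>s. (\<exists>f. bijection f s n) \<longrightarrow> P s" if "n \<in> NN" for n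
    using that
  proof (induction rule: NN_induct)
    case definable
    show ?case by (intro dfn_rules dfn_bijection univ.dfn1I[OF assms(2)])
  next
    case zero
    show ?case
    proof (intro allI impI)
      fix s assume "\<exists>f. bijection f s zero"
      then have "elts s = {}" by (auto simp: bijection_def bij_betw_def)
      then show "P s" using assms(3) by simp
    qed
  next
    case (suc n)
    show ?case
    proof (intro allI impI, elim exE)
      fix s f assume "bijection f s (suc n)"
      then obtain x t g where t: "s = ins x t" "x \<notin> elts t" "bijection g t n"
        using bijection_suc_remove[of f s n] NN_irrefl[OF suc.hyps] by metis
      have "P t" using suc.IH t(3) by (elim allE impE) (rule exI)
      moreover have "finite_set t" using t(3) suc.hyps unfolding finite_set_def by (intro bexI exI)
      ultimately show "P s" using step t(1,2) by simp
    qed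
  qed
  then show ?thesis using assms(1) unfolding finite_set_def by (elim bexE) simp
qed

lemma finite_subset: assumes "finite_set t" "elts s \<subseteq> elts t" shows "finite_set s"
proof -
  have "\<forall>s. elts s \<subseteq> elts t \<longrightarrow> finite_set s"
    using assms(1)
  proof (induction rule: finite_set_induct)
    case definable
    show ?case by (intro dfn_rules dfn_finite_set)
  next
    case zero
    then show ?case by (simp add: finite_zero)
  next
    case (ins x t)
    show ?case
    proof (intro allI impI)
      fix s assume s: "elts s \<subseteq> elts (ins x t)"
      define s' where "s' = sepset s (\<lambda>y. y \<noteq> x)"
      have s': "elts s' = elts s - {x}"
        unfolding s'_def by (subst elts_sepset) (intro dfn_rules, auto)
      then have fin: "finite_set s'" using ins.IH s by auto
      show "finite_set s"
      proof (cases "x \<in> elts s")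
        case True
        then have "elts s = elts (ins x s')" using s' by auto
        then have "s = ins x s'" by (rule elts_eqI)
        then show ?thesis using finite_ins[OF fin] by simp
      next
        case False
        then have "elts s = elts s'" using s' by auto
        then have "s = s'" by (rule elts_eqI)
        then show ?thesis using fin by simp
      qed
    qed
  qed
  then show ?thesis using assms(2) by simp
qed

text \<open>A bijection from \<open>s\<close> to \<open>n\<close>, composed with \<open>h\<close>,
  would inject n+1 into \<open>n\<close>.\<close>

lemma infinite_of_injection:
  assumes h: "univ.dtm (\<lambda>e. h (e 0))" and inj: "inj_on h NN" and rng: "h ` NN \<subseteq> elts s"
  shows "\<not> finite_set s"
proof
  assume "finite_set s"
  then obtain n f where n: "n \<in> NN" "bijection f s n" unfolding finite_set_def by (elim bexE exE)
  then have f: "func f s n" "inj_on (app f) (elts s)" by (auto simp: bijection_def bij_betw_def)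
  have ap: "appx f (h x) = app f (h x)" "h x \<in> elts s" if "x \<in> NN" for x
    using func_app(3)[OF f(1), of "h x"] rng that by auto
  have m: "suc n \<in> NN" "elts (suc n) \<subseteq> NN" using suc_NN[OF n(1)] elts_NN[OF suc_NN[OF n(1)]] .
  show False
  proof (rule no_injection_into_element[OF m(1), of n "\<lambda>x. appx f (h x)"])
    show "univ.dtm (\<lambda>e. appx f (h (e 0)))" by (intro dtm_appx dtm_const h)
    show "inj_on (\<lambda>x. appx f (h x)) (elts (suc n))"
    proof (rule inj_onI)
      fix x y assume xy: "x \<in> elts (suc n)" "y \<in> elts (suc n)" "appx f (h x) = appx f (h y)"
      then have N: "x \<in> NN" "y \<in> NN" using m(2) by auto
      then have "h x = h y" using xy(3) ap f(2) by (auto dest: inj_onD)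
      then show "x = y" using inj N by (auto dest: inj_onD)
    qed
    show "(\<lambda>x. appx f (h x)) ` elts (suc n) \<subseteq> elts n"
      using func_app(1)[OF f(1)] ap m(2) by (auto simp del: elts_suc)
  qed simp
qed

text \<open>In place of a power set: induction on n shows that some set contains all n-element
  subsets of \<open>v\<close>, Collection gathers such sets for all n, and the finite subsets are
  separated from their union.\<close>

lemma ex_finite_subsets: "\<exists>F. \<forall>s. s \<in> elts F \<longleftrightarrow> finite_set s \<and> elts s \<subseteq> elts v"
proof -
  have ex: "\<exists>w. \<forall>s. elts s \<subseteq> elts v \<longrightarrow> (\<exists>f. bijection f s n) \<longrightarrow> s \<^bold>\<in> w" if "n \<in> NN" for n
    using that
  proof (induction rule: NN_induct)
    case definable
    show ?case by (intro dfn_rules dfn_bijection)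
  next
    case zero
    have "s \<^bold>\<in> upair zero zero" if "bijection f s zero" for s f
    proof -
      have "elts s = {}" using that by (auto simp: bijection_def bij_betw_def)
      then show ?thesis using elts_upair[of zero zero] mem_elts[of zero "upair zero zero"] by simp
    qed
    then show ?case by (intro exI[of _ "upair zero zero"]) auto
  next
    case (suc n)
    then obtain w where w: "\<forall>s. elts s \<subseteq> elts v \<longrightarrow> (\<exists>f. bijection f s n) \<longrightarrow> s \<^bold>\<in> w" by (elim exE)
    define w' where "w' = unionset (replset w (\<lambda>t. replset v (\<lambda>x. ins x t)))"
    have "elts (replset v (\<lambda>x. ins x t)) = (\<lambda>x. ins x t) ` elts v" for t
      by (intro elts_replset dtm_rules dfn_rules)
    moreover have "elts (replset w (\<lambda>t. replset v (\<lambda>x. ins x t))) = (\<lambda>t. replset v (\<lambda>x. ins x t)) ` elts w"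
      by (intro elts_replset dtm_rules dfn_rules)
    ultimately have w': "elts w' = (\<Union>t\<in>elts w. (\<lambda>x. ins x t) ` elts v)"
      unfolding w'_def elts_unionset by simp
    have "s \<^bold>\<in> w'" if s: "elts s \<subseteq> elts v" "bijection f s (suc n)" for s f
    proof -
      obtain x t g where t: "s = ins x t" "bijection g t n"
        using bijection_suc_remove[OF s(2) NN_irrefl[OF suc.hyps]] by (elim exE conjE)
      have tv: "x \<in> elts v" "elts t \<subseteq> elts v" using s(1) t(1) by auto
      then have "t \<in> elts w" using w t(2) unfolding mem_elts by (elim allE impE) (auto intro: exI)
      then have "s \<in> elts w'" unfolding w' using tv(1) t(1) by blast
      then show ?thesis by (simp add: mem_elts)
    qed
    then show ?case by (intro exI[of _ w']) auto
  qed
  have "univ.dfn (\<lambda>e. \<forall>s. elts s \<subseteq> elts v \<longrightarrow> (\<exists>f. bijection f s (e 0)) \<longrightarrow> s \<^bold>\<in> e 1)"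
    by (intro dfn_rules dfn_bijection)
  from collection_set[OF this, of omega] obtain Y where
    "\<forall>n\<in>elts omega. (\<exists>w. \<forall>s. elts s \<subseteq> elts v \<longrightarrow> (\<exists>f. bijection f s n) \<longrightarrow> s \<^bold>\<in> w) \<longrightarrow>
      (\<exists>w\<in>elts Y. \<forall>s. elts s \<subseteq> elts v \<longrightarrow> (\<exists>f. bijection f s n) \<longrightarrow> s \<^bold>\<in> w)" by (elim exE)
  then have Y: "\<exists>w\<in>elts Y. \<forall>s. elts s \<subseteq> elts v \<longrightarrow> (\<exists>f. bijection f s n) \<longrightarrow> s \<^bold>\<in> w" if "n \<in> NN" for n
    using ex[OF that] that unfolding elts_omega by simp
  have F: "elts (sepset (unionset Y) (\<lambda>s. finite_set s \<and> elts s \<subseteq> elts v)) =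
      {s \<in> elts (unionset Y). finite_set s \<and> elts s \<subseteq> elts v}"
    by (intro elts_sepset dfn_rules dfn_finite_set)
  have "s \<in> elts (unionset Y)" if s: "finite_set s" "elts s \<subseteq> elts v" for s
  proof -
    obtain n f where n: "n \<in> NN" "bijection f s n" using s(1) unfolding finite_set_def by (elim bexE exE)
    obtain w where w: "w \<in> elts Y" "\<forall>s. elts s \<subseteq> elts v \<longrightarrow> (\<exists>f. bijection f s n) \<longrightarrow> s \<^bold>\<in> w"
      using Y[OF n(1)] by (elim bexE)
    then have "s \<in> elts w" using s(2) n(2) unfolding mem_elts by (elim allE impE) (auto intro: exI)
    then show ?thesis using w(1) unfolding elts_unionset by blast
  qed
  then show ?thesis
    by (intro exI[of _ "sepset (unionset Y) (\<lambda>s. finite_set s \<and> elts s \<subseteq> elts v)"]) (auto simp: F)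
qed

definition fin_subsets :: "'u \<Rightarrow> 'u" where
  "fin_subsets v = (SOME F. \<forall>s. s \<in> elts F \<longleftrightarrow> finite_set s \<and> elts s \<subseteq> elts v)"

lemma mem_fin_subsets: "s \<in> elts (fin_subsets v) \<longleftrightarrow> finite_set s \<and> elts s \<subseteq> elts v"
  using someI_ex[OF ex_finite_subsets[of v]] unfolding fin_subsets_def by blast

subsection \<open>Well-founded sets and standard size\<close>

definition wf_transitive :: "'u \<Rightarrow> bool" where
  "wf_transitive T \<longleftrightarrow> (\<forall>y\<in>elts T. elts y \<subseteq> elts T) \<and>
     (\<forall>s. elts s \<subseteq> elts T \<and> s \<noteq> zero \<longrightarrow> (\<exists>m\<in>elts s. \<forall>z\<in>elts m. z \<notin> elts s))"

lemma VV_iff: "x \<in> VV \<longleftrightarrow> (\<exists>T. x \<in> elts T \<and> wf_transitive T)"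
  unfolding VV_def wf_transitive_def disjoint_iff elts_empty_iff Ball_def by (simp add: mem_elts)

lemma wf_transitiveD:
  assumes "wf_transitive T"
  shows "y \<in> elts T \<Longrightarrow> elts y \<subseteq> elts T"
    "elts s \<subseteq> elts T \<Longrightarrow> s \<noteq> zero \<Longrightarrow> \<exists>m\<in>elts s. \<forall>z\<in>elts m. z \<notin> elts s"
  using assms unfolding wf_transitive_def by simp_all

lemma dfn_wf_transitive: "univ.dtm t \<Longrightarrow> univ.dfn (\<lambda>e. wf_transitive (t e))"
  by (rule univ.dfn1I[where R = wf_transitive]) (unfold wf_transitive_def, intro dfn_rules)

lemma dfn_VV: "univ.dtm t \<Longrightarrow> univ.dfn (\<lambda>e. t e \<in> VV)"
  by (rule univ.dfn1I[where R = "\<lambda>x. x \<in> VV"]) (unfold VV_iff, intro dfn_rules dfn_wf_transitive)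

lemma elts_VV: assumes "x \<in> VV" shows "elts x \<subseteq> VV"
proof
  fix y assume y: "y \<in> elts x"
  obtain T where T: "x \<in> elts T" "wf_transitive T" using assms unfolding VV_iff by (elim exE conjE)
  then have "y \<in> elts T" using wf_transitiveD(1)[OF T(2,1)] y by auto
  then show "y \<in> VV" unfolding VV_iff using T(2) by (intro exI conjI)
qed

text \<open>Collection supplies witnesses for all elements of \<open>w\<close>. Their union is
  transitive and well-founded, and stays so when \<open>w\<close> is added on top.\<close>

lemma VV_of_elts: assumes "elts w \<subseteq> VV" shows "w \<in> VV"
proof -
  have "univ.dfn (\<lambda>e. e 0 \<in> elts (e 1) \<and> wf_transitive (e 1))"
    by (intro dfn_rules dfn_wf_transitive)
  from collection_set[OF this, of w] obtain Y where Y: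
    "\<forall>x\<in>elts w. (\<exists>T. x \<in> elts T \<and> wf_transitive T) \<longrightarrow> (\<exists>T\<in>elts Y. x \<in> elts T \<and> wf_transitive T)"
    by (elim exE)
  define C where "C = sepset Y wf_transitive"
  have C: "elts C = {T \<in> elts Y. wf_transitive T}"
    unfolding C_def by (intro elts_sepset dfn_wf_transitive univ.dtm_var)
  define U where "U = unionset C"
  have U: "x \<in> elts U \<longleftrightarrow> (\<exists>T\<in>elts C. x \<in> elts T)" for x
    by (auto simp: U_def elts_unionset)
  have wU: "elts w \<subseteq> elts U"
  proof
    fix x assume x: "x \<in> elts w"
    then have "\<exists>T. x \<in> elts T \<and> wf_transitive T" using assms VV_iff by auto
    then have "\<exists>T\<in>elts Y. x \<in> elts T \<and> wf_transitive T" using Y x by simp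
    then show "x \<in> elts U" unfolding U C by auto
  qed
  have U_trans: "elts y \<subseteq> elts U" if y: "y \<in> elts U" for y
  proof -
    obtain T where T: "T \<in> elts C" "y \<in> elts T" using y U by auto
    then have "elts y \<subseteq> elts T" using C wf_transitiveD(1) by auto
    then show ?thesis using T(1) U by auto
  qed
  have U_min: "\<exists>m\<in>elts s. \<forall>z\<in>elts m. z \<notin> elts s" if x: "x \<in> elts s" "x \<in> elts U" for s x
  proof -
    obtain T where T: "T \<in> elts C" "x \<in> elts T" using x(2) U by auto
    then have wfT: "wf_transitive T" using C by simp
    \<comment> \<open>A minimal element of \<open>s\<close> inside one witness \<open>T\<close> is
      minimal in all of \<open>s\<close>, because \<open>T\<close> contains the elements of its
      elements.\<close>
    define s' where "s' = sepset s (\<lambda>y. y \<in> elts T)"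
    have s': "elts s' = {y \<in> elts s. y \<in> elts T}"
      unfolding s'_def by (intro elts_sepset dfn_rules)
    then have "x \<in> elts s'" using x(1) T(2) by simp
    then have "s' \<noteq> zero" by auto
    moreover have "elts s' \<subseteq> elts T" using s' by auto
    ultimately obtain m where m: "m \<in> elts s'" "\<forall>z\<in>elts m. z \<notin> elts s'"
      using wf_transitiveD(2)[OF wfT, of s'] by auto
    then have "m \<in> elts s" "m \<in> elts T" using s' by auto
    moreover have "\<forall>z\<in>elts m. z \<notin> elts s"
      using m(2) s' wf_transitiveD(1)[OF wfT \<open>m \<in> elts T\<close>] by auto
    ultimately show ?thesis by auto
  qed
  have "wf_transitive (ins w U)"
    unfolding wf_transitive_def
  proof (intro conjI ballI allI impI)
    show "elts y \<subseteq> elts (ins w U)" if "y \<in> elts (ins w U)" for y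
      using that wU U_trans[of y] by auto
    fix s assume s: "elts s \<subseteq> elts (ins w U) \<and> s \<noteq> zero"
    show "\<exists>m\<in>elts s. \<forall>z\<in>elts m. z \<notin> elts s"
    proof (cases "\<exists>x. x \<in> elts s \<and> x \<in> elts U")
      case True
      then show ?thesis using U_min by (elim exE conjE)
    next
      case False
      have "elts s \<noteq> {}" using s by simp
      then obtain x where "x \<in> elts s" by (auto simp del: elts_empty_iff)
      then have "w \<in> elts s" using False s by auto
      moreover have "\<forall>z\<in>elts w. z \<notin> elts s" using False wU by auto
      ultimately show ?thesis by (intro bexI)
    qed
  qed
  then show ?thesis unfolding VV_iff by (intro exI[of _ "ins w U"]) simp
qed

lemma zero_VV: "zero \<in> VV"
  by (intro VV_of_elts) simp

lemma upair_VV: "a \<in> VV \<Longrightarrow> b \<in> VV \<Longrightarrow> upair a b \<in> VV"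
  by (intro VV_of_elts) (simp add: elts_upair)

lemma pair_VV: "a \<in> VV \<Longrightarrow> b \<in> VV \<Longrightarrow> pair a b \<in> VV"
  unfolding pair_def by (intro upair_VV)

lemma NN_VV: "n \<in> NN \<Longrightarrow> n \<in> VV"
proof (induction rule: NN_induct)
  case definable
  show ?case by (intro dfn_VV univ.dtm_var)
next
  case (suc n)
  then have "elts (suc n) \<subseteq> VV" using elts_VV by simp
  then show ?case by (rule VV_of_elts)
qed (rule zero_VV)

lemma omega_VV: "omega \<in> VV"
  by (rule VV_of_elts) (auto simp: elts_omega NN_VV)

section \<open>Closure properties of sets of standard size\<close>

text \<open>An injection into the class \<open>VV\<close> suffices: its image is a set, and a set of
  well-founded sets is well-founded.\<close>

lemma standard_sizeI:
  assumes h: "univ.dtm (\<lambda>e. h (e 0))" and "inj_on h (elts X)" "h ` elts X \<subseteq> VV"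
  shows "standard_size X"
proof -
  have "elts (replset X h) = h ` elts X" by (rule elts_replset[OF h])
  then have "bij_betw h (elts X) (elts (replset X h))" "replset X h \<in> VV"
    using assms(2,3) by (auto simp: bij_betw_def intro: VV_of_elts)
  then show ?thesis unfolding standard_size_def using bijection_lam[OF h] by (intro bexI exI)
qed

lemma standard_sizeD:
  assumes "standard_size X"
  shows "\<exists>f. inj_on (appx f) (elts X) \<and> appx f ` elts X \<subseteq> VV"
proof -
  obtain v f where v: "v \<in> VV" "bijection f X v" using assms unfolding standard_size_def by (elim bexE exE)
  then have f: "func f X v" "inj_on (app f) (elts X)" by (auto simp: bijection_def bij_betw_def)
  have "appx f x = app f x" "app f x \<in> VV" if "x \<in> elts X" for x
    using func_app(1,3)[OF f(1) that] elts_VV[OF v(1)] by auto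
  then have "inj_on (appx f) (elts X) \<and> appx f ` elts X \<subseteq> VV"
    using f(2) by (auto simp: inj_on_def)
  then show ?thesis ..
qed

lemma standard_size_VV: "v \<in> VV \<Longrightarrow> standard_size v"
  by (rule standard_sizeI[where h = "\<lambda>x. x"]) (auto intro: univ.dtm_var dest: elts_VV)

lemma standard_size_inj:
  assumes X: "standard_size X" and h: "univ.dtm (\<lambda>e. h (e 0))"
    and inj: "inj_on h (elts Y)" and rng: "h ` elts Y \<subseteq> elts X"
  shows "standard_size Y"
proof -
  obtain f where f: "inj_on (appx f) (elts X)" "appx f ` elts X \<subseteq> VV"
    using standard_sizeD[OF X] by (elim exE conjE)
  show ?thesis
  proof (rule standard_sizeI)
    show "univ.dtm (\<lambda>e. appx f (h (e 0)))" by (intro dtm_appx dtm_const h)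
    show "inj_on (\<lambda>x. appx f (h x)) (elts Y)"
      using comp_inj_on[OF inj inj_on_subset[OF f(1) rng]] by (simp add: comp_def)
    show "(\<lambda>x. appx f (h x)) ` elts Y \<subseteq> VV" using f(2) rng by auto
  qed
qed

text \<open>A point of the image is coded by its fibre.\<close>

lemma standard_size_image:
  assumes X: "standard_size X" and h: "univ.dtm (\<lambda>e. h (e 0))" and Y: "elts Y \<subseteq> h ` elts X"
  shows "standard_size Y"
proof -
  obtain f where f: "inj_on (appx f) (elts X)" "appx f ` elts X \<subseteq> VV"
    using standard_sizeD[OF X] by (elim exE conjE)
  define g where "g y = replset (sepset X (\<lambda>x. h x = y)) (appx f)" for y
  have fib: "elts (sepset X (\<lambda>x. h x = y)) = {x \<in> elts X. h x = y}" for y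
    by (intro elts_sepset dfn_rules h)
  have g: "elts (g y) = appx f ` {x \<in> elts X. h x = y}" for y
    unfolding g_def fib[symmetric] by (intro elts_replset dtm_appx dfn_rules)
  show ?thesis
  proof (rule standard_sizeI[where h = g])
    show "univ.dtm (\<lambda>e. g (e 0))"
      unfolding g_def by (intro dtm_replset dtm_sepset dtm_appx dfn_rules univ.dtm1I[OF h])
    show "g ` elts Y \<subseteq> VV"
      using f(2) by (intro image_subsetI VV_of_elts) (auto simp: g)
    show "inj_on g (elts Y)"
    proof (rule inj_onI)
      fix y y' assume y: "y \<in> elts Y" "y' \<in> elts Y" "g y = g y'"
      obtain x where x: "x \<in> elts X" "y = h x" using Y y(1) by auto
      then have "appx f x \<in> elts (g y)" unfolding g by simp
      then have "appx f x \<in> appx f ` {x \<in> elts X. h x = y'}" using y(3) g by simp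
      then obtain x' where x': "x' \<in> elts X" "h x' = y'" "appx f x = appx f x'" by auto
      then have "x = x'" using f(1) x(1) by (auto dest: inj_onD)
      then show "y = y'" using x x' by simp
    qed
  qed
qed

definition prodset :: "'u \<Rightarrow> 'u \<Rightarrow> 'u" where
  "prodset X Y = unionset (replset X (\<lambda>x. replset Y (\<lambda>y. pair x y)))"

lemma elts_prodset: "elts (prodset X Y) = {pair x y | x y. x \<in> elts X \<and> y \<in> elts Y}"
proof -
  have "elts (replset Y (\<lambda>y. pair x y)) = (\<lambda>y. pair x y) ` elts Y" for x
    by (intro elts_replset dfn_rules)
  moreover have "elts (replset X (\<lambda>x. replset Y (\<lambda>y. pair x y))) = (\<lambda>x. replset Y (\<lambda>y. pair x y)) ` elts X"
    by (intro elts_replset dtm_replset dfn_rules)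
  ultimately show ?thesis unfolding prodset_def elts_unionset by auto
qed

definition fst_of :: "'u \<Rightarrow> 'u \<Rightarrow> 'u \<Rightarrow> 'u" where
  "fst_of X Y p = unionset (sepset X (\<lambda>x. \<exists>y\<in>elts Y. p = pair x y))"
definition snd_of :: "'u \<Rightarrow> 'u \<Rightarrow> 'u \<Rightarrow> 'u" where
  "snd_of X Y p = unionset (sepset Y (\<lambda>y. \<exists>x\<in>elts X. p = pair x y))"

lemma fst_of: "x \<in> elts X \<Longrightarrow> y \<in> elts Y \<Longrightarrow> fst_of X Y (pair x y) = x"
  and snd_of: "x \<in> elts X \<Longrightarrow> y \<in> elts Y \<Longrightarrow> snd_of X Y (pair x y) = y"
proof -
  assume xy: "x \<in> elts X" "y \<in> elts Y"
  have "elts (sepset X (\<lambda>x'. \<exists>y'\<in>elts Y. pair x y = pair x' y')) = {x' \<in> elts X. \<exists>y'\<in>elts Y. pair x y = pair x' y'}"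
    by (intro elts_sepset dfn_rules)
  also have "\<dots> = {x}" using xy by auto
  finally show "fst_of X Y (pair x y) = x"
    by (intro elts_eqI) (simp add: fst_of_def elts_unionset)
  have "elts (sepset Y (\<lambda>y'. \<exists>x'\<in>elts X. pair x y = pair x' y')) = {y' \<in> elts Y. \<exists>x'\<in>elts X. pair x y = pair x' y'}"
    by (intro elts_sepset dfn_rules)
  also have "\<dots> = {y}" using xy by auto
  finally show "snd_of X Y (pair x y) = y"
    by (intro elts_eqI) (simp add: snd_of_def elts_unionset)
qed

lemma dtm_fst_of: "univ.dtm t \<Longrightarrow> univ.dtm (\<lambda>e. fst_of X Y (t e))"
  and dtm_snd_of: "univ.dtm t \<Longrightarrow> univ.dtm (\<lambda>e. snd_of X Y (t e))"
  unfolding fst_of_def snd_of_def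
  by (intro dtm_unionset dtm_sepset dtm_const dfn_rules univ.dtm_shift; assumption)+

lemma standard_size_prodset:
  assumes "standard_size X" "standard_size Y"
  shows "standard_size (prodset X Y)"
proof -
  obtain f where f: "inj_on (appx f) (elts X)" "appx f ` elts X \<subseteq> VV"
    using standard_sizeD[OF assms(1)] by (elim exE conjE)
  obtain g where g: "inj_on (appx g) (elts Y)" "appx g ` elts Y \<subseteq> VV"
    using standard_sizeD[OF assms(2)] by (elim exE conjE)
  show ?thesis
  proof (rule standard_sizeI)
    show "univ.dtm (\<lambda>e. pair (appx f (fst_of X Y (e 0))) (appx g (snd_of X Y (e 0))))"
      by (intro dfn_rules dtm_appx dtm_fst_of dtm_snd_of)
    show "inj_on (\<lambda>p. pair (appx f (fst_of X Y p)) (appx g (snd_of X Y p))) (elts (prodset X Y))"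
    proof (rule inj_onI)
      fix p q assume pq: "p \<in> elts (prodset X Y)" "q \<in> elts (prodset X Y)"
        "pair (appx f (fst_of X Y p)) (appx g (snd_of X Y p)) = pair (appx f (fst_of X Y q)) (appx g (snd_of X Y q))"
      obtain x y where p: "p = pair x y" "x \<in> elts X" "y \<in> elts Y" using pq(1) unfolding elts_prodset by auto
      obtain x' y' where q: "q = pair x' y'" "x' \<in> elts X" "y' \<in> elts Y" using pq(2) unfolding elts_prodset by auto
      have "appx f x = appx f x'" "appx g y = appx g y'" using pq(3) p q by (simp_all add: fst_of snd_of)
      then have "x = x'" "y = y'" using f(1) g(1) p q by (auto dest: inj_onD)
      then show "p = q" using p q by simp
    qed
    show "(\<lambda>p. pair (appx f (fst_of X Y p)) (appx g (snd_of X Y p))) ` elts (prodset X Y) \<subseteq> VV"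
      using f(2) g(2) unfolding elts_prodset by (auto simp: fst_of snd_of intro!: pair_VV)
  qed
qed

lemma standard_size_image2:
  assumes "standard_size X" "standard_size Y" and h: "univ.dtm (\<lambda>e. h (e 0) (e 1))"
    and Z: "\<And>z. z \<in> elts Z \<Longrightarrow> \<exists>x\<in>elts X. \<exists>y\<in>elts Y. z = h x y"
  shows "standard_size Z"
proof (rule standard_size_image[OF standard_size_prodset[OF assms(1,2)]])
  show "univ.dtm (\<lambda>e. h (fst_of X Y (e 0)) (snd_of X Y (e 0)))"
    by (intro univ.dtm2I[OF h] dtm_fst_of dtm_snd_of univ.dtm_var)
  show "elts Z \<subseteq> (\<lambda>p. h (fst_of X Y p) (snd_of X Y p)) ` elts (prodset X Y)"
  proof
    fix z assume "z \<in> elts Z"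
    then obtain x y where xy: "x \<in> elts X" "y \<in> elts Y" "z = h x y" using Z[of z] by auto
    then have "pair x y \<in> elts (prodset X Y)" "z = h (fst_of X Y (pair x y)) (snd_of X Y (pair x y))"
      by (auto simp: elts_prodset fst_of snd_of)
    then show "z \<in> (\<lambda>p. h (fst_of X Y p) (snd_of X Y p)) ` elts (prodset X Y)" by (rule rev_image_eqI)
  qed
qed

text \<open>Given an injection of \<open>X\<close> into \<open>VV\<close>, each finite subset is
  coded by its image, again an element of \<open>VV\<close>.\<close>

lemma standard_size_fin_subsets:
  assumes "standard_size X"
  shows "standard_size (fin_subsets X)"
proof -
  obtain f where f: "inj_on (appx f) (elts X)" "appx f ` elts X \<subseteq> VV"
    using standard_sizeD[OF assms] by (elim exE conjE)
  have g: "elts (replset s (appx f)) = appx f ` elts s" for s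
    by (intro elts_replset dtm_appx dfn_rules)
  show ?thesis
  proof (rule standard_sizeI)
    show "univ.dtm (\<lambda>e. replset (e 0) (appx f))"
      by (intro dtm_replset dtm_appx dfn_rules)
    show "(\<lambda>s. replset s (appx f)) ` elts (fin_subsets X) \<subseteq> VV"
      using f(2) by (intro image_subsetI VV_of_elts) (auto simp: g mem_fin_subsets)
    show "inj_on (\<lambda>s. replset s (appx f)) (elts (fin_subsets X))"
    proof (rule inj_onI)
      fix s s' assume s: "s \<in> elts (fin_subsets X)" "s' \<in> elts (fin_subsets X)"
        "replset s (appx f) = replset s' (appx f)"
      have "appx f ` elts s = appx f ` elts s'" using g[of s] g[of s'] s(3) by simp
      then have "elts s = elts s'"
        using s(1,2) inj_on_image_eq_iff[OF f(1)] by (simp add: mem_fin_subsets)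
      then show "s = s'" by (rule elts_eqI)
    qed
  qed
qed

subsection \<open>Saturation for families with the finite intersection property\<close>

lemma finite_vun: assumes "finite_set s" "finite_set t" shows "finite_set (vun s t)"
  using assms(1)
proof (induction rule: finite_set_induct)
  case definable
  show ?case by (intro dfn_finite_set dtm_vun dtm_const univ.dtm_var)
next
  case zero
  have "vun zero t = t" by (rule elts_eqI) simp
  then show ?case using assms(2) by simp
next
  case (ins x s)
  have "vun (ins x s) t = ins x (vun s t)" by (rule elts_eqI) simp
  then show ?case using finite_ins[OF ins.IH] by simp
qed

text \<open>The axiom asks for a family closed under binary intersections. The intersections of
  finite subfamilies of \<open>Z\<close> form one, still of standard size; the internal bound
  \<open>U\<close> gives a meaning to the empty intersection.\<close>

lemma saturation_fip:
  assumes Z: "elts Z \<subseteq> II" "standard_size Z" and U: "U \<in> II"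
    and fip: "\<And>s. finite_set s \<Longrightarrow> elts s \<subseteq> elts Z \<Longrightarrow> \<exists>x\<in>elts U. \<forall>z\<in>elts s. x \<in> elts z"
  shows "\<exists>x\<in>elts U. \<forall>z\<in>elts Z. x \<in> elts z"
proof -
  define h where "h s = sepset U (\<lambda>x. \<forall>z\<in>elts s. x \<in> elts z)" for s
  have h_elts: "elts (h s) = {x \<in> elts U. \<forall>z\<in>elts s. x \<in> elts z}" for s
    unfolding h_def by (intro elts_sepset dfn_rules)
  have h: "univ.dtm (\<lambda>e. h (e 0))" unfolding h_def by (intro dtm_sepset dfn_rules)
  have h_II: "elts s \<subseteq> II \<longrightarrow> h s \<in> II" if "finite_set s" for s
    using that
  proof (induction rule: finite_set_induct)
    case definable
    show ?case unfolding subset_eq by (intro dfn_rules h)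
  next
    case zero
    have "h zero = U" by (rule elts_eqI) (simp add: h_elts)
    then show ?case using U by simp
  next
    case (ins z s)
    show ?case
    proof
      assume s: "elts (ins z s) \<subseteq> II"
      then have zs: "z \<in> II" "h s \<in> II" using ins.IH by auto
      have "intl.dfn (\<lambda>e. e 0 \<in> elts z)"
        using zs(1) by (intro intl.dfn_elts intl.dtm_const intl.dtm_var)
      from separation_internal[OF zs(2) this] obtain y where
        y: "y \<in> II" "elts y = {x \<in> elts (h s). x \<in> elts z}" by (elim bexE)
      have "y = h (ins z s)" by (rule elts_eqI) (auto simp: y(2) h_elts)
      then show "h (ins z s) \<in> II" using y(1) by simp
    qed
  qed
  define X where "X = replset (fin_subsets Z) h"
  have X: "elts X = h ` elts (fin_subsets Z)" unfolding X_def by (rule elts_replset[OF h])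
  have "elts X \<subseteq> II" using h_II Z(1) unfolding X by (auto simp: mem_fin_subsets)
  moreover have "standard_size X"
    by (rule standard_size_image[OF standard_size_fin_subsets[OF Z(2)] h]) (simp add: X)
  moreover have zero_fin: "zero \<in> elts (fin_subsets Z)" by (simp add: mem_fin_subsets finite_zero)
  then have "elts X \<noteq> {}" unfolding X by (auto simp del: elts_empty_iff)
  moreover have "\<forall>x\<in>elts X. elts x \<noteq> {}"
  proof
    fix x assume "x \<in> elts X"
    then obtain s where s: "x = h s" "finite_set s" "elts s \<subseteq> elts Z" unfolding X by (auto simp: mem_fin_subsets)
    obtain w where "w \<in> elts U" "\<forall>z\<in>elts s. w \<in> elts z" using fip[OF s(2,3)] by (elim bexE)
    then have "w \<in> elts x" unfolding s(1) h_elts by simp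
    then show "elts x \<noteq> {}" by (auto simp del: elts_empty_iff)
  qed
  moreover have "\<forall>x\<in>elts X. \<forall>y\<in>elts X. \<exists>z\<in>elts X. elts z = elts x \<inter> elts y"
  proof (intro ballI)
    fix x y assume "x \<in> elts X" "y \<in> elts X"
    then obtain s t where s: "x = h s" "finite_set s" "elts s \<subseteq> elts Z"
      and t: "y = h t" "finite_set t" "elts t \<subseteq> elts Z" unfolding X by (auto simp: mem_fin_subsets)
    have "h (vun s t) \<in> elts X" unfolding X using s t by (auto simp: mem_fin_subsets finite_vun)
    moreover have "elts (h (vun s t)) = elts x \<inter> elts y" unfolding s t h_elts by auto
    ultimately show "\<exists>z\<in>elts X. elts z = elts x \<inter> elts y" by (intro bexI)
  qed
  ultimately have "(\<Inter>x\<in>elts X. elts x) \<noteq> {}" by (rule saturation)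
  then obtain w where w: "\<forall>x\<in>elts X. w \<in> elts x" by auto
  then have "w \<in> elts (h zero)" using zero_fin unfolding X by auto
  then have "w \<in> elts U" unfolding h_elts by simp
  moreover have "w \<in> elts z" if z: "z \<in> elts Z" for z
  proof -
    have "ins z zero \<in> elts (fin_subsets Z)"
      using z finite_ins[OF finite_zero] by (simp add: mem_fin_subsets)
    then have "w \<in> elts (h (ins z zero))" using w unfolding X by auto
    then show ?thesis unfolding h_elts by simp
  qed
  ultimately show ?thesis by (intro bexI) auto
qed

text \<open>Every internal set lies in a standard one. Collection gathers such standard sets,
  Standardization gives a standard set with the same standard elements, and its union is
  internal.\<close>

lemma ex_internal_cover:
  assumes "elts X \<subseteq> II"
  shows "\<exists>U\<in>II. elts X \<subseteq> elts U"
proof -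
  have "univ.dfn (\<lambda>e. st (e 1) \<and> e 0 \<in> elts (e 1))" by (intro dfn_rules)
  from collection_set[OF this, of X] obtain Y where
    Y: "\<forall>x\<in>elts X. (\<exists>y. st y \<and> x \<in> elts y) \<longrightarrow> (\<exists>y\<in>elts Y. st y \<and> x \<in> elts y)" by (elim exE)
  obtain Y' where Y': "st Y'" "elts Y' \<inter> SS = elts Y \<inter> SS" using standardization[of Y] by (elim exE conjE)
  have "Y' \<in> II" using Y'(1) SS_subset_II by (auto simp: SS_def)
  then have "unionset Y' \<in> II" by (rule unionset_II)
  moreover have "elts X \<subseteq> elts (unionset Y')"
  proof
    fix x assume x: "x \<in> elts X"
    then have "\<exists>y. st y \<and> x \<in> elts y" using assms by (auto simp: II_def mem_elts)
    then obtain y where y: "y \<in> elts Y" "st y" "x \<in> elts y" using Y x by auto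
    then have "y \<in> elts Y \<inter> SS" by (simp add: SS_def)
    then have "y \<in> elts Y'" using Y'(2) by auto
    then show "x \<in> elts (unionset Y')" using y(3) by (auto simp: elts_unionset)
  qed
  ultimately show ?thesis by (intro bexI)
qed

section \<open>Internal sets and standard size\<close>

lemma zero_II: "zero \<in> II"
  using NN_subset_II zero_NN by auto

text \<open>The sets \<open>x\<close> minus one point are internal, and finitely many of them always
  have a common point because \<open>x\<close> is infinite. If \<open>x\<close> had standard size,
  saturation would give a point of \<open>x\<close> different from every point of
  \<open>x\<close>.\<close>

theorem infinite_internal_not_standard_size:
  assumes x: "x \<in> II" "\<not> finite_set x"
  shows "\<not> standard_size x"
proof
  assume std: "standard_size x"
  define h where "h b = sepset x (\<lambda>w. w \<noteq> b)" for b
  have h: "univ.dtm (\<lambda>e. h (e 0))" unfolding h_def by (intro dtm_sepset dfn_rules)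
  have h_elts: "elts (h b) = elts x - {b}" for b
    unfolding h_def by (subst elts_sepset) (intro dfn_rules, auto)
  define Z where "Z = replset x h"
  have Z: "elts Z = h ` elts x" unfolding Z_def by (rule elts_replset[OF h])
  have "h b \<in> II" if b: "b \<in> elts x" for b
  proof -
    have "b \<in> II" using elts_of_II[OF x(1)] b by auto
    then have "intl.dfn (\<lambda>e. e 0 \<noteq> b)" by (intro intl.dfn_not intl.dfn_eq intl.dtm_var intl.dtm_const)
    from separation_internal[OF x(1) this] obtain y where y: "y \<in> II" "elts y = {w \<in> elts x. w \<noteq> b}"
      by (elim bexE)
    have "y = h b" by (rule elts_eqI) (auto simp: y(2) h_elts)
    then show ?thesis using y(1) by simp
  qed
  then have Z_II: "elts Z \<subseteq> II" unfolding Z by auto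
  have Z_std: "standard_size Z" by (rule standard_size_image[OF std h]) (simp add: Z)
  \<comment> \<open>The deleted points of a finite subfamily are collected in a finite set
    \<open>t\<close>, which cannot exhaust \<open>x\<close>.\<close>
  have fin: "elts s \<subseteq> elts Z \<longrightarrow> (\<exists>t. finite_set t \<and> (\<forall>z\<in>elts s. \<forall>w\<in>elts x. w \<notin> elts t \<longrightarrow> w \<in> elts z))"
    if "finite_set s" for s
    using that
  proof (induction rule: finite_set_induct)
    case definable
    show ?case by (intro dfn_rules dfn_finite_set)
  next
    case zero
    show ?case using finite_zero by auto
  next
    case (ins z s)
    show ?case
    proof
      assume s: "elts (ins z s) \<subseteq> elts Z"
      then obtain t where t: "finite_set t" "\<forall>z\<in>elts s. \<forall>w\<in>elts x. w \<notin> elts t \<longrightarrow> w \<in> elts z"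
        using ins.IH by auto
      obtain b where b: "z = h b" using s unfolding Z by auto
      have "\<forall>z\<in>elts (ins z s). \<forall>w\<in>elts x. w \<notin> elts (ins b t) \<longrightarrow> w \<in> elts z"
        using t(2) unfolding b by (auto simp: h_elts)
      then show "\<exists>t. finite_set t \<and> (\<forall>z\<in>elts (ins z s). \<forall>w\<in>elts x. w \<notin> elts t \<longrightarrow> w \<in> elts z)"
        using finite_ins[OF t(1)] by (intro exI[of _ "ins b t"] conjI)
    qed
  qed
  have "\<exists>w\<in>elts x. \<forall>z\<in>elts Z. w \<in> elts z"
  proof (rule saturation_fip[OF Z_II Z_std x(1)])
    fix s assume s: "finite_set s" "elts s \<subseteq> elts Z"
    then obtain t where t: "finite_set t" "\<forall>z\<in>elts s. \<forall>w\<in>elts x. w \<notin> elts t \<longrightarrow> w \<in> elts z"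
      using fin[OF s(1)] by auto
    have "\<not> elts x \<subseteq> elts t" using finite_subset[OF t(1)] x(2) by auto
    then obtain w where "w \<in> elts x" "w \<notin> elts t" by auto
    then show "\<exists>w\<in>elts x. \<forall>z\<in>elts s. w \<in> elts z" using t(2) by auto
  qed
  then show False unfolding Z by (auto simp: h_elts)
qed

lemma omega_not_internal: "omega \<notin> II"
proof
  assume "omega \<in> II"
  moreover have "\<not> finite_set omega"
    by (rule infinite_of_injection[where h = "\<lambda>x. x"]) (auto simp: elts_omega intro: univ.dtm_var)
  ultimately show False using infinite_internal_not_standard_size standard_size_VV[OF omega_VV] by auto
qed

section \<open>Internal power sets and internal sets of pairs\<close>

lemma ex_internal_power:
  assumes "x \<in> II"
  shows "\<exists>p\<in>II. \<forall>y\<in>II. y \<in> elts p \<longleftrightarrow> elts y \<subseteq> elts x"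
proof -
  obtain p where p: "p \<in> II" "\<forall>y\<in>II. y \<^bold>\<in> p \<longleftrightarrow> (\<forall>z\<in>II. z \<^bold>\<in> y \<longrightarrow> z \<^bold>\<in> x)"
    using power_II[unfolded ax_power_def, THEN bspec, OF assms] by (elim bexE)
  have "y \<in> elts p \<longleftrightarrow> elts y \<subseteq> elts x" if y: "y \<in> II" for y
    using p(2)[THEN bspec, OF y] elts_of_II[OF y] by (auto simp: elts_def)
  then show ?thesis using p(1) by (intro bexI[of _ p] ballI)
qed

lemma ex_internal_pairs:
  assumes "x \<in> II"
  shows "\<exists>p\<in>II. \<forall>a\<in>elts x. \<forall>b\<in>elts x. pair a b \<in> elts p"
proof -
  obtain p where p: "p \<in> II" "\<forall>y\<in>II. y \<in> elts p \<longleftrightarrow> elts y \<subseteq> elts x"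
    using ex_internal_power[OF assms] by (elim bexE)
  obtain q where q: "q \<in> II" "\<forall>y\<in>II. y \<in> elts q \<longleftrightarrow> elts y \<subseteq> elts p"
    using ex_internal_power[OF p(1)] by (elim bexE)
  have "pair a b \<in> elts q" if ab: "a \<in> elts x" "b \<in> elts x" for a b
  proof -
    have I: "a \<in> II" "b \<in> II" using ab elts_of_II[OF assms] by auto
    then have "upair a a \<in> elts p" "upair a b \<in> elts p"
      using p(2) ab by (simp_all add: upair_II elts_upair)
    then show ?thesis using q(2) I by (simp add: pair_def upair_II elts_upair)
  qed
  then show ?thesis using q(1) by (intro bexI[of _ q] ballI)
qed

lemma pair_mem_internal:
  assumes "g \<in> II" "pair x y \<^bold>\<in> g"
  shows "x \<in> elts (unionset (unionset g))" "y \<in> elts (unionset (unionset g))" "x \<in> II" "y \<in> II"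
proof -
  have "pair x y \<in> elts g" using assms(2) by (simp add: mem_elts)
  moreover have "upair x y \<in> elts (pair x y)" by (simp add: pair_def elts_upair)
  ultimately have "upair x y \<in> elts (unionset g)" by (auto simp: elts_unionset)
  then show xy: "x \<in> elts (unionset (unionset g))" "y \<in> elts (unionset (unionset g))"
    by (auto simp: elts_unionset[of "unionset g"] elts_upair intro!: bexI[of _ "upair x y"])
  have "elts (unionset (unionset g)) \<subseteq> II" by (intro elts_of_II unionset_II assms(1))
  then show "x \<in> II" "y \<in> II" using xy by auto
qed

subsection \<open>Internal partial injections\<close>

definition partial_inj :: "'u \<Rightarrow> bool" where
  "partial_inj g \<longleftrightarrow> (\<forall>x y x' y'. pair x y \<^bold>\<in> g \<longrightarrow> pair x' y' \<^bold>\<in> g \<longrightarrow> (x = x' \<longleftrightarrow> y = y'))"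

lemma partial_injD: "partial_inj g \<Longrightarrow> pair x y \<^bold>\<in> g \<Longrightarrow> pair x' y' \<^bold>\<in> g \<Longrightarrow> x = x' \<longleftrightarrow> y = y'"
  unfolding partial_inj_def by simp

lemma mem_ins: "p \<^bold>\<in> ins q g \<longleftrightarrow> p = q \<or> p \<^bold>\<in> g"
  unfolding mem_elts[of p, THEN sym] by simp

lemma ex_internal_partial_inj:
  assumes D: "elts D \<subseteq> II" "standard_size D" and B: "standard_size B" "elts B \<noteq> {}"
    and h: "univ.dtm (\<lambda>e. h (e 0))" "\<And>b. b \<in> elts B \<Longrightarrow> h b \<in> II"
    and K: "elts K = (\<Inter>b\<in>elts B. elts (h b))" "\<not> finite_set K"
  shows "\<exists>g\<in>II. partial_inj g \<and> (\<forall>d\<in>elts D. \<exists>y. pair d y \<^bold>\<in> g) \<and> (\<forall>x y. pair x y \<^bold>\<in> g \<longrightarrow> y \<in> elts K)"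
proof (cases "elts D = {}")
  \<comment> \<open>The range condition of \<open>g\<close> is read off its membership in some
    \<open>G d b\<close>, so an empty \<open>D\<close> is served by the empty injection.\<close>
  case True
  moreover have "\<not> p \<^bold>\<in> zero" for p using mem_elts[of p zero] by simp
  ultimately show ?thesis using zero_II by (intro bexI[of _ zero]) (auto simp: partial_inj_def)
next
  case False
  obtain b0 where b0: "b0 \<in> elts B" using B(2) by (auto simp del: elts_empty_iff)
  \<comment> \<open>\<open>D\<close> and \<open>K\<close> may be external. An internal cover
    \<open>U\<close> of both makes the partial injections considered range over an internal set, as
    saturation requires.\<close>
  have "elts (vun D K) \<subseteq> II" using D(1) K(1) elts_of_II[OF h(2)[OF b0]] b0 by auto
  then obtain U where U: "U \<in> II" "elts (vun D K) \<subseteq> elts U" using ex_internal_cover[of "vun D K"] by auto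
  obtain P where P: "P \<in> II" "\<forall>a\<in>elts U. \<forall>b\<in>elts U. pair a b \<in> elts P"
    using ex_internal_pairs[OF U(1)] by (elim bexE)
  obtain R where R: "R \<in> II" "\<forall>y\<in>II. y \<in> elts R \<longleftrightarrow> elts y \<subseteq> elts P"
    using ex_internal_power[OF P(1)] by (elim bexE)
  have "intl.dfn (\<lambda>e. \<forall>x\<in>II. \<forall>y\<in>II. \<forall>x'\<in>II. \<forall>y'\<in>II. pair x y \<^bold>\<in> e 0 \<longrightarrow> pair x' y' \<^bold>\<in> e 0 \<longrightarrow> (x = x' \<longleftrightarrow> y = y'))"
    by (intro intl.dfn_intros)
  from separation_internal[OF R(1) this] obtain Q where Q: "Q \<in> II" "elts Q = {g \<in> elts R.
     \<forall>x\<in>II. \<forall>y\<in>II. \<forall>x'\<in>II. \<forall>y'\<in>II. pair x y \<^bold>\<in> g \<longrightarrow> pair x' y' \<^bold>\<in> g \<longrightarrow> (x = x' \<longleftrightarrow> y = y')}"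
    by (elim bexE)
  have Q': "g \<in> elts Q \<longleftrightarrow> g \<in> II \<and> elts g \<subseteq> elts P \<and> partial_inj g" for g
  proof (cases "g \<in> II")
    case True
    have "(\<forall>x\<in>II. \<forall>y\<in>II. \<forall>x'\<in>II. \<forall>y'\<in>II. pair x y \<^bold>\<in> g \<longrightarrow> pair x' y' \<^bold>\<in> g \<longrightarrow> (x = x' \<longleftrightarrow> y = y')) \<longleftrightarrow> partial_inj g"
      (is "?l \<longleftrightarrow> _")
    proof
      assume l: ?l
      show "partial_inj g" unfolding partial_inj_def
      proof (intro allI impI)
        fix x y x' y' assume p: "pair x y \<^bold>\<in> g" "pair x' y' \<^bold>\<in> g"
        note I = pair_mem_internal(3,4)[OF True p(1)] pair_mem_internal(3,4)[OF True p(2)]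
        show "x = x' \<longleftrightarrow> y = y'"
          by (rule l[THEN bspec, OF I(1), THEN bspec, OF I(2), THEN bspec, OF I(3), THEN bspec, OF I(4),
                THEN mp, OF p(1), THEN mp, OF p(2)])
      qed
    qed (simp add: partial_inj_def)
    then show ?thesis using True R(2) unfolding Q(2) by simp
  next
    case False
    then show ?thesis using elts_of_II[OF Q(1)] by auto
  qed
  define G where "G d b = sepset Q (\<lambda>g. (\<exists>y. pair d y \<^bold>\<in> g) \<and> (\<forall>x y. pair x y \<^bold>\<in> g \<longrightarrow> y \<in> elts (h b)))" for d b
  have G: "univ.dtm (\<lambda>e. G (e 0) (e 1))"
    unfolding G_def by (intro dtm_sepset dfn_rules univ.dtm1I[OF h(1)])
  have G_elts: "elts (G d b) = {g \<in> elts Q. (\<exists>y. pair d y \<^bold>\<in> g) \<and> (\<forall>x y. pair x y \<^bold>\<in> g \<longrightarrow> y \<in> elts (h b))}" for d b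
    unfolding G_def by (intro elts_sepset dfn_rules univ.dtm1I[OF h(1)])
  have G_II: "G d b \<in> II" if d: "d \<in> II" and b: "h b \<in> II" for d b
  proof -
    have "intl.dfn (\<lambda>e. (\<exists>y\<in>II. pair d y \<^bold>\<in> e 0) \<and> (\<forall>x\<in>II. \<forall>y\<in>II. pair x y \<^bold>\<in> e 0 \<longrightarrow> y \<in> elts (h b)))"
      by (intro intl.dfn_intros intl.dtm_const d b)
    from separation_internal[OF Q(1) this] obtain z where z: "z \<in> II" "elts z = {g \<in> elts Q.
      (\<exists>y\<in>II. pair d y \<^bold>\<in> g) \<and> (\<forall>x\<in>II. \<forall>y\<in>II. pair x y \<^bold>\<in> g \<longrightarrow> y \<in> elts (h b))}" by (elim bexE)
    have "(\<exists>y\<in>II. pair d y \<^bold>\<in> g) \<longleftrightarrow> (\<exists>y. pair d y \<^bold>\<in> g)"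
      "(\<forall>x\<in>II. \<forall>y\<in>II. pair x y \<^bold>\<in> g \<longrightarrow> y \<in> elts (h b)) \<longleftrightarrow> (\<forall>x y. pair x y \<^bold>\<in> g \<longrightarrow> y \<in> elts (h b))"
      if "g \<in> elts Q" for g
      using pair_mem_internal(3,4)[of g] that Q' by meson+
    then have "elts z = elts (G d b)" unfolding z(2) G_elts by auto
    then have "z = G d b" by (rule elts_eqI)
    then show ?thesis using z(1) by simp
  qed
  define Z where "Z = replset (prodset D B) (\<lambda>p. G (fst_of D B p) (snd_of D B p))"
  have "elts Z = (\<lambda>p. G (fst_of D B p) (snd_of D B p)) ` elts (prodset D B)"
    unfolding Z_def by (intro elts_replset univ.dtm2I[OF G] dtm_fst_of dtm_snd_of univ.dtm_var)
  also have "\<dots> = {G d b | d b. d \<in> elts D \<and> b \<in> elts B}"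
    unfolding elts_prodset by (force simp: fst_of snd_of)
  finally have Z: "elts Z = {G d b | d b. d \<in> elts D \<and> b \<in> elts B}" .
  have Z_II: "elts Z \<subseteq> II" unfolding Z using G_II D(1) h(2) by auto
  have Z_std: "standard_size Z"
    by (rule standard_size_image2[OF D(2) B(1) G]) (auto simp: Z)
  have fin: "elts s \<subseteq> elts Z \<longrightarrow> (\<exists>g\<in>elts Q. (\<forall>z\<in>elts s. g \<in> elts z) \<and>
      (\<forall>x y. pair x y \<^bold>\<in> g \<longrightarrow> y \<in> elts K) \<and> (\<exists>t. finite_set t \<and> (\<forall>x y. pair x y \<^bold>\<in> g \<longrightarrow> y \<in> elts t)))"
    if "finite_set s" for s
    using that
  proof (induction rule: finite_set_induct)
    case definable
    show ?case by (intro dfn_rules dfn_finite_set)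
  next
    case zero
    have no: "\<not> p \<^bold>\<in> zero" for p using mem_elts[of p zero] by simp
    then have "partial_inj zero" by (simp add: partial_inj_def)
    then have "zero \<in> elts Q" using zero_II by (simp add: Q')
    then show ?case using no finite_zero by auto
  next
    case (ins z s)
    show ?case
    proof
      assume s: "elts (ins z s) \<subseteq> elts Z"
      then obtain g t where g: "g \<in> elts Q" "\<forall>z\<in>elts s. g \<in> elts z"
        "\<forall>x y. pair x y \<^bold>\<in> g \<longrightarrow> y \<in> elts K" and t: "finite_set t" "\<forall>x y. pair x y \<^bold>\<in> g \<longrightarrow> y \<in> elts t"
        using ins.IH by auto
      obtain d b where z: "z = G d b" "d \<in> elts D" "b \<in> elts B" using s unfolding Z by auto
      show "\<exists>g\<in>elts Q. (\<forall>z\<in>elts (ins z s). g \<in> elts z) \<and>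
        (\<forall>x y. pair x y \<^bold>\<in> g \<longrightarrow> y \<in> elts K) \<and> (\<exists>t. finite_set t \<and> (\<forall>x y. pair x y \<^bold>\<in> g \<longrightarrow> y \<in> elts t))"
      proof (cases "\<exists>y. pair d y \<^bold>\<in> g")
        case True
        then have "g \<in> elts z" unfolding z(1) G_elts using g(1,3) z(3) K(1) by auto
        then show ?thesis using g t by (intro bexI[of _ g]) auto
      next
        case False
        have "\<not> elts K \<subseteq> elts t" using finite_subset[OF t(1)] K(2) by auto
        then obtain y where y: "y \<in> elts K" "y \<notin> elts t" by auto
        define g' where "g' = ins (pair d y) g"
        have mem: "pair u v \<^bold>\<in> g' \<longleftrightarrow> (u = d \<and> v = y) \<or> pair u v \<^bold>\<in> g" for u v
          by (simp add: g'_def mem_ins)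
        have gQ: "g \<in> II" "elts g \<subseteq> elts P" "partial_inj g" using g(1) Q' by auto
        have dy: "d \<in> elts U" "y \<in> elts U" using U(2) z(2) y(1) by auto
        then have "pair d y \<in> elts P" using P(2) by simp
        then have "g' \<in> II" "elts g' \<subseteq> elts P"
          using gQ(1,2) elts_of_II[OF P(1)] by (auto simp: g'_def intro!: ins_II)
        moreover have "partial_inj g'"
          unfolding partial_inj_def mem
        proof (intro allI impI)
          fix u v u' v' assume "(u = d \<and> v = y) \<or> pair u v \<^bold>\<in> g" "(u' = d \<and> v' = y) \<or> pair u' v' \<^bold>\<in> g"
          then show "u = u' \<longleftrightarrow> v = v'"
            using partial_injD[OF gQ(3), of u v u' v'] False t(2) y(2) by auto
        qed
        ultimately have Qg': "g' \<in> elts Q" by (simp add: Q')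
        have K': "\<forall>u v. pair u v \<^bold>\<in> g' \<longrightarrow> v \<in> elts K" using g(3) y(1) mem by auto
        have "g' \<in> elts z'" if z': "z' \<in> elts (ins z s)" for z'
        proof (cases "z' = z")
          case True
          then show ?thesis unfolding True z(1) G_elts using Qg' K' z(3) K(1) mem by auto
        next
          case False
          then have "z' \<in> elts s" using z' by simp
          moreover obtain d' b' where db: "z' = G d' b'" "b' \<in> elts B" using z' s unfolding Z by auto
          ultimately have "g \<in> elts (G d' b')" using g(2) by simp
          then have "\<exists>y. pair d' y \<^bold>\<in> g'" unfolding G_elts using mem by auto
          then show ?thesis unfolding db(1) G_elts using Qg' K' db(2) K(1) by auto
        qed
        moreover have "\<exists>t. finite_set t \<and> (\<forall>u v. pair u v \<^bold>\<in> g' \<longrightarrow> v \<in> elts t)"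
          using finite_ins[OF t(1), of y] t(2) mem by (intro exI[of _ "ins y t"]) auto
        ultimately show ?thesis using Qg' K' by (intro bexI[of _ g'] conjI ballI)
      qed
    qed
  qed
  have "\<exists>g\<in>elts Q. \<forall>z\<in>elts Z. g \<in> elts z"
  proof (rule saturation_fip[OF Z_II Z_std Q(1)])
    fix s assume "finite_set s" "elts s \<subseteq> elts Z"
    then show "\<exists>g\<in>elts Q. \<forall>z\<in>elts s. g \<in> elts z" using fin[of s] by auto
  qed
  then obtain g where g: "g \<in> elts Q" "\<forall>z\<in>elts Z. g \<in> elts z" by (elim bexE)
  have gG: "g \<in> elts (G d b)" if "d \<in> elts D" "b \<in> elts B" for d b
    using g(2) that unfolding Z by auto
  obtain d0 where d0: "d0 \<in> elts D" using False by (auto simp del: elts_empty_iff)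
  have "\<exists>y. pair d y \<^bold>\<in> g" if "d \<in> elts D" for d
    using gG[OF that b0] unfolding G_elts by simp
  moreover have "y \<in> elts K" if "pair x y \<^bold>\<in> g" for x y
    using gG[OF d0] that unfolding G_elts K(1) by auto
  ultimately show ?thesis using g(1) Q' by (intro bexI[of _ g]) auto
qed

subsection \<open>Infinite parts of sets that are not of standard size\<close>

text \<open>With one enumeration chosen for each \<open>K a\<close>, the set \<open>X\<close> is
  covered by the image of \<open>A\<close> times \<open>omega\<close> under evaluation.\<close>

lemma standard_size_finite_Union:
  assumes A: "standard_size A" and K: "univ.dtm (\<lambda>e. K (e 0))"
    and fin: "\<And>a. a \<in> elts A \<Longrightarrow> finite_set (K a)" and X: "elts X \<subseteq> (\<Union>a\<in>elts A. elts (K a))"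
  shows "standard_size X"
proof -
  have enum: "\<exists>f. \<exists>n\<in>elts omega. bijection f n (K a)" if a: "a \<in> elts A" for a
  proof -
    obtain n f where "n \<in> NN" "bijection f (K a) n"
      using fin[OF a] unfolding finite_set_def by (elim bexE exE)
    then show ?thesis using bijection_inverse[of f "K a" n] unfolding elts_omega by (intro exI bexI)
  qed
  have "univ.dfn (\<lambda>e. \<exists>n\<in>elts omega. bijection (e 1) n (K (e 0)))"
    by (intro dfn_rules dfn_bijection univ.dtm1I[OF K])
  \<comment> \<open>Choice needs a set of candidates for each \<open>a\<close>; Collection provides
    one containing an enumeration of every \<open>K a\<close>.\<close>
  from collection_set[OF this, of A] obtain W where
    W: "\<forall>a\<in>elts A. (\<exists>f. \<exists>n\<in>elts omega. bijection f n (K a)) \<longrightarrow> (\<exists>f\<in>elts W. \<exists>n\<in>elts omega. bijection f n (K a))"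
    by (elim exE)
  define E where "E a = sepset W (\<lambda>f. \<exists>n\<in>elts omega. bijection f n (K a))" for a
  have E: "univ.dtm (\<lambda>e. E (e 0))"
    unfolding E_def by (intro dtm_sepset dfn_rules dfn_bijection univ.dtm1I[OF K])
  have E_elts: "elts (E a) = {f \<in> elts W. \<exists>n\<in>elts omega. bijection f n (K a)}" for a
    unfolding E_def by (intro elts_sepset dfn_rules dfn_bijection)
  have E_ne: "elts (E a) \<noteq> {}" if a: "a \<in> elts A" for a
  proof -
    obtain f where "f \<in> elts W" "\<exists>n\<in>elts omega. bijection f n (K a)"
      using W[THEN bspec, OF a, THEN mp, OF enum[OF a]] by (elim bexE) (rule that, auto)
    then have "f \<in> elts (E a)" unfolding E_elts by simp
    then show ?thesis by (auto simp del: elts_empty_iff)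
  qed
  have fE: "func (lam A E) A (replset A E)"
    by (rule func_lam[OF E]) (simp add: elts_replset[OF E])
  have aE: "app (lam A E) a = E a" if "a \<in> elts A" for a by (rule app_lam[OF E that])
  have "\<forall>a\<in>elts A. elts (app (lam A E) a) \<noteq> {}" using E_ne aE by (simp del: elts_empty_iff)
  from standard_size_choice[OF A fE this] obtain c V where
    c: "func c A V" "\<forall>a\<in>elts A. app c a \<^bold>\<in> app (lam A E) a" by (elim exE conjE)
  have c_bij: "\<exists>n\<in>elts omega. bijection (appx c a) n (K a)" if "a \<in> elts A" for a
  proof -
    have "app c a \<in> elts (E a)" using c(2) aE that by (simp add: mem_elts)
    then show ?thesis unfolding E_elts using func_app(3)[OF c(1) that] by simp
  qed
  show ?thesis
  proof (rule standard_size_image2[OF A standard_size_VV[OF omega_VV]])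
    show "univ.dtm (\<lambda>e. appx (appx c (e 0)) (e 1))" by (intro dtm_appx dfn_rules)
    fix x assume "x \<in> elts X"
    then obtain a where a: "a \<in> elts A" "x \<in> elts (K a)" using X by auto
    obtain n where n: "n \<in> elts omega" "bijection (appx c a) n (K a)" using c_bij[OF a(1)] by (elim bexE)
    then have b: "func (appx c a) n (K a)" "app (appx c a) ` elts n = elts (K a)"
      by (auto simp: bijection_def bij_betw_def)
    then obtain m where m: "m \<in> elts n" "x = app (appx c a) m" using a(2) by auto
    then have "x = appx (appx c a) m" using func_app(3)[OF b(1)] by simp
    moreover have "m \<in> elts omega" using elts_NN[of n] n(1) m(1) by (auto simp: elts_omega)
    ultimately show "\<exists>a\<in>elts A. \<exists>m\<in>elts omega. x = appx (appx c a) m"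
      using a(1) by (intro bexI)
  qed
qed

text \<open>Russell's paradox. It excludes an empty index set \<open>B\<close> below, whose
  intersection would be the whole universe.\<close>

lemma no_universal_set: "elts V \<noteq> UNIV"
proof
  assume V: "elts V = UNIV"
  have "elts (sepset V (\<lambda>x. \<not> x \<^bold>\<in> x)) = {x \<in> elts V. \<not> x \<^bold>\<in> x}"
    by (intro elts_sepset dfn_rules)
  then have "x \<in> elts (sepset V (\<lambda>x. \<not> x \<^bold>\<in> x)) \<longleftrightarrow> \<not> x \<^bold>\<in> x" for x using V by simp
  then show False unfolding mem_elts by blast
qed

lemma Sigma_ss2_partial_inj:
  assumes Y: "Sigma_ss2 Y" "\<not> standard_size Y" and D: "elts D \<subseteq> II" "standard_size D"
  shows "\<exists>g\<in>II. partial_inj g \<and> (\<forall>d\<in>elts D. \<exists>y. pair d y \<^bold>\<in> g) \<and> (\<forall>x y. pair x y \<^bold>\<in> g \<longrightarrow> y \<in> elts Y)"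
proof -
  obtain A B F where AB: "A \<in> VV" "B \<in> VV" "internal_family F A B"
    and Y_elts: "elts Y = (\<Union>a\<in>elts A. \<Inter>b\<in>elts B. elts (app F (pair a b)))"
    using Y(1) unfolding Sigma_ss2_def by (elim bexE exE conjE)
  obtain P Z where P: "elts P = {pair a b | a b. a \<in> elts A \<and> b \<in> elts B}" and Z: "elts Z \<subseteq> II"
    and F: "func F P Z" using AB(3) unfolding internal_family_def by (elim exE conjE)
  define h where "h a b = appx F (pair a b)" for a b
  have h_dtm: "univ.dtm (\<lambda>e. h (t e) (s e))" if "univ.dtm t" "univ.dtm s" for t s
    unfolding h_def by (intro dtm_appx dtm_const univ.dtm_pair that)
  have h: "h a b = app F (pair a b)" "h a b \<in> II" if "a \<in> elts A" "b \<in> elts B" for a b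
  proof -
    have "pair a b \<in> elts P" using P that by auto
    then show "h a b = app F (pair a b)" "h a b \<in> II" using func_app(1,3)[OF F] Z unfolding h_def by auto
  qed
  have Y_h: "elts Y = (\<Union>a\<in>elts A. \<Inter>b\<in>elts B. elts (h a b))"
    unfolding Y_elts using h(1) by (intro SUP_cong INF_cong refl) simp
  \<comment> \<open>Separating from \<open>Y\<close> turns the intersection into a definable
    set-valued term; for \<open>a\<close> in \<open>A\<close> nothing is lost, the intersection
    being part of \<open>Y\<close>.\<close>
  define K where "K a = sepset Y (\<lambda>x. \<forall>b\<in>elts B. x \<in> elts (h a b))" for a
  have K: "univ.dtm (\<lambda>e. K (e 0))" unfolding K_def by (intro dtm_sepset dfn_rules h_dtm)
  have "elts (K a) = {x \<in> elts Y. \<forall>b\<in>elts B. x \<in> elts (h a b)}" for a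
    unfolding K_def by (intro elts_sepset dfn_rules h_dtm)
  then have K_elts: "elts (K a) = (\<Inter>b\<in>elts B. elts (h a b))" if "a \<in> elts A" for a
    using that Y_h by auto
  have "\<exists>a\<in>elts A. \<not> finite_set (K a)"
  proof (rule ccontr)
    assume "\<not> (\<exists>a\<in>elts A. \<not> finite_set (K a))"
    then have "standard_size Y"
      using Y_h K_elts by (intro standard_size_finite_Union[OF standard_size_VV[OF AB(1)] K]) auto
    then show False using Y(2) by simp
  qed
  then obtain a where a: "a \<in> elts A" "\<not> finite_set (K a)" by (elim bexE)
  have sub: "elts (K a) \<subseteq> elts Y" using a(1) K_elts Y_h by auto
  have B: "elts B \<noteq> {}"
  proof
    assume "elts B = {}"
    then have "elts (K a) = UNIV" using K_elts[OF a(1)] by auto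
    then show False using no_universal_set by simp
  qed
  have "\<exists>g\<in>II. partial_inj g \<and> (\<forall>d\<in>elts D. \<exists>y. pair d y \<^bold>\<in> g) \<and> (\<forall>x y. pair x y \<^bold>\<in> g \<longrightarrow> y \<in> elts (K a))"
    by (rule ex_internal_partial_inj[OF D standard_size_VV[OF AB(2)] B _ _ K_elts[OF a(1)] a(2)])
      (use h(2)[OF a(1)] in \<open>auto intro!: h_dtm dtm_const univ.dtm_var\<close>)
  then obtain g where "g \<in> II" "partial_inj g" "\<forall>d\<in>elts D. \<exists>y. pair d y \<^bold>\<in> g"
    "\<forall>x y. pair x y \<^bold>\<in> g \<longrightarrow> y \<in> elts (K a)" by (elim bexE conjE)
  then show ?thesis using sub by (intro bexI[of _ g]) auto
qed

subsection \<open>Values and images of partial injections\<close>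

text \<open>Components of pairs in \<open>g\<close> lie in its double union, so the values at
  \<open>x\<close> can be separated there; the outer union extracts a unique one.\<close>

definition gval :: "'u \<Rightarrow> 'u \<Rightarrow> 'u" where
  "gval g x = unionset (sepset (unionset (unionset g)) (\<lambda>y. pair x y \<^bold>\<in> g))"

lemma dtm_gval: "univ.dtm t \<Longrightarrow> univ.dtm (\<lambda>e. gval g (t e))"
  by (rule univ.dtm1I[where h = "gval g"]) (unfold gval_def, intro dtm_rules dfn_rules)

lemma gval:
  assumes g: "g \<in> II" "partial_inj g" and xy: "pair x y \<^bold>\<in> g"
  shows "gval g x = y"
proof (rule elts_eqI)
  have "elts (sepset (unionset (unionset g)) (\<lambda>y. pair x y \<^bold>\<in> g)) = {y \<in> elts (unionset (unionset g)). pair x y \<^bold>\<in> g}"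
    by (intro elts_sepset dfn_rules)
  also have "\<dots> = {y}"
    using pair_mem_internal(2)[OF g(1) xy] xy partial_injD[OF g(2) xy] by auto
  finally show "elts (gval g x) = elts y" by (simp add: gval_def elts_unionset)
qed

text \<open>Both the image of \<open>k\<close> and the graph relating it to \<open>k\<close> are
  obtained by internal separation from sets built out of \<open>g\<close>, so the equinumerosity is
  witnessed inside \<open>II\<close>.\<close>

lemma ex_internal_image:
  assumes g: "g \<in> II" "partial_inj g" and k: "k \<in> II" "\<forall>u\<in>elts k. \<exists>v. pair u v \<^bold>\<in> g"
  shows "\<exists>y\<in>II. elts y = gval g ` elts k \<and> int_equinumerous y k"
proof -
  define W where "W = unionset (unionset g)"
  have W: "W \<in> II" unfolding W_def by (intro unionset_II g)
  have val: "pair u v \<^bold>\<in> g \<longleftrightarrow> v = gval g u" if u: "u \<in> elts k" for u v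
  proof -
    obtain w where w: "pair u w \<^bold>\<in> g" using k(2) u by auto
    then have "gval g u = w" using gval[OF g] by simp
    then show ?thesis using w gval[OF g] by auto
  qed
  have "intl.dfn (\<lambda>e. \<exists>u\<in>elts k. pair u (e 0) \<^bold>\<in> g)"
    by (intro intl.dfn_intros intl.dtm_const k(1) g(1))
  from separation_internal[OF W this] obtain y where
    y: "y \<in> II" "elts y = {v \<in> elts W. \<exists>u\<in>elts k. pair u v \<^bold>\<in> g}" by (elim bexE)
  have y_elts: "elts y = gval g ` elts k"
    unfolding y(2) W_def using val pair_mem_internal(2)[OF g(1)] by auto
  obtain P where P: "P \<in> II" "\<forall>a\<in>elts W. \<forall>b\<in>elts W. pair a b \<in> elts P"
    using ex_internal_pairs[OF W] by (elim bexE)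
  \<comment> \<open>The pairs are reversed because the bijection has to lead from the image to
    \<open>k\<close>.\<close>
  have "intl.dfn (\<lambda>e. \<exists>u\<in>elts k. \<exists>v\<in>elts y. e 0 = pair v u \<and> pair u v \<^bold>\<in> g)"
    by (intro intl.dfn_intros intl.dtm_const k(1) g(1) y(1))
  from separation_internal[OF P(1) this] obtain f where
    f: "f \<in> II" "elts f = {p \<in> elts P. \<exists>u\<in>elts k. \<exists>v\<in>elts y. p = pair v u \<and> pair u v \<^bold>\<in> g}" by (elim bexE)
  have mem: "pair v u \<^bold>\<in> f \<longleftrightarrow> u \<in> elts k \<and> v = gval g u" for u v
  proof
    assume "pair v u \<^bold>\<in> f"
    then have "pair v u \<in> elts f" by (simp add: mem_elts)
    then show "u \<in> elts k \<and> v = gval g u" unfolding f(2) using val by auto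
  next
    assume u: "u \<in> elts k \<and> v = gval g u"
    then have uv: "pair u v \<^bold>\<in> g" "v \<in> elts y" using val y_elts by auto
    then have "pair v u \<in> elts P"
      using P(2) pair_mem_internal(1,2)[OF g(1) uv(1)] unfolding W_def by simp
    then have "pair v u \<in> elts f" unfolding f(2) using u uv by auto
    then show "pair v u \<^bold>\<in> f" by (simp add: mem_elts)
  qed
  have inj: "u = u'" if "u \<in> elts k" "u' \<in> elts k" "gval g u = gval g u'" for u u'
  proof -
    have "pair u (gval g u) \<^bold>\<in> g" "pair u' (gval g u') \<^bold>\<in> g" using val that(1,2) by auto
    then show ?thesis using partial_injD[OF g(2)] that(3) by auto
  qed
  have "func f y k"
    unfolding func_def
  proof (intro conjI ballI)
    fix p assume "p \<in> elts f"
    then show "\<exists>x\<in>elts y. \<exists>z\<in>elts k. p = pair x z" unfolding f(2) by auto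
  next
    fix x assume "x \<in> elts y"
    then obtain u where u: "u \<in> elts k" "x = gval g u" unfolding y_elts by auto
    show "\<exists>!z. pair x z \<^bold>\<in> f"
    proof (rule ex1I[of _ u])
      show "pair x u \<^bold>\<in> f" using u mem by simp
      show "z = u" if "pair x z \<^bold>\<in> f" for z using that u inj[of z u] unfolding mem by simp
    qed
  qed
  moreover have "\<forall>u\<in>elts k. \<exists>!x. x \<in> elts y \<and> pair x u \<^bold>\<in> f"
  proof
    fix u assume u: "u \<in> elts k"
    show "\<exists>!x. x \<in> elts y \<and> pair x u \<^bold>\<in> f"
    proof (rule ex1I[of _ "gval g u"])
      show "gval g u \<in> elts y \<and> pair (gval g u) u \<^bold>\<in> f" using u y_elts by (simp add: mem)
      show "x = gval g u" if "x \<in> elts y \<and> pair x u \<^bold>\<in> f" for x using that unfolding mem by simp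
    qed
  qed
  ultimately have "bijection f y k" unfolding bijection_iff by (rule conjI)
  then show ?thesis using f(1) y(1) y_elts unfolding int_equinumerous_def by (intro bexI[of _ y] conjI bexI[of _ f])
qed

section \<open>Internal cardinals, overspill and the spectrum\<close>

lemma int_card_eq:
  assumes k: "int_ordinal k" "int_equinumerous y k" "\<forall>j\<in>elts k. \<not> int_equinumerous y j"
  shows "int_card y = k"
  unfolding int_card_def
proof (rule the_equality)
  fix j assume j: "int_ordinal j \<and> int_equinumerous y j \<and> (\<forall>i\<in>elts j. \<not> int_equinumerous y i)"
  then show "j = k" using int_ordinal_linear[of j k] k by auto
qed (use k in simp)

text \<open>No smaller ordinal is equinumerous to \<open>y\<close>: composing through
  \<open>y\<close> would inject \<open>n\<close> into one of its elements.\<close>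

lemma int_card_NN:
  assumes n: "n \<in> NN" and y: "int_equinumerous y n"
  shows "int_card y = n"
proof (rule int_card_eq[OF int_ordinal_NN[OF n] y], rule ballI, rule notI)
  fix j assume j: "j \<in> elts n" "int_equinumerous y j"
  obtain f where f: "bijection f y n" using y unfolding int_equinumerous_def by (elim bexE)
  obtain f' where "bijection f' n y" using bijection_inverse[OF f] by auto
  then have f': "func f' n y" "inj_on (app f') (elts n)" by (auto simp: bijection_def bij_betw_def)
  obtain q where "bijection q y j" using j(2) unfolding int_equinumerous_def by (elim bexE)
  then have q: "func q y j" "inj_on (app q) (elts y)" by (auto simp: bijection_def bij_betw_def)
  have ap: "appx f' u = app f' u" "app f' u \<in> elts y" if "u \<in> elts n" for u
    using func_app(1,3)[OF f'(1) that] by auto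
  have aq: "appx q v = app q v" "app q v \<in> elts j" if "v \<in> elts y" for v
    using func_app(1,3)[OF q(1) that] by auto
  show False
  proof (rule no_injection_into_element[OF n j(1), of "\<lambda>u. appx q (appx f' u)"])
    show "univ.dtm (\<lambda>e. appx q (appx f' (e 0)))" by (intro dtm_appx dfn_rules)
    show "inj_on (\<lambda>u. appx q (appx f' u)) (elts n)"
    proof (rule inj_onI)
      fix u u' assume u: "u \<in> elts n" "u' \<in> elts n" "appx q (appx f' u) = appx q (appx f' u')"
      then have "app f' u = app f' u'" using ap aq q(2) by (auto dest: inj_onD)
      then show "u = u'" using u f'(2) by (auto dest: inj_onD)
    qed
    show "(\<lambda>u. appx q (appx f' u)) ` elts n \<subseteq> elts j" using ap aq by auto
  qed
qed

text \<open>The ordinal \<open>k\<close> need not be a cardinal. The elements of its successor that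
  are equinumerous to \<open>y\<close> form an internal set, and a minimal element of it is the
  cardinal of \<open>y\<close>.\<close>

lemma ex_least_equinumerous:
  assumes k: "int_ordinal k" and y: "y \<in> II" "int_equinumerous y k"
  shows "\<exists>m. int_ordinal m \<and> int_equinumerous y m \<and> (\<forall>j\<in>elts m. \<not> int_equinumerous y j)"
proof -
  note k' = int_ordinal_suc[OF k]
  \<comment> \<open>Bijectivity with all quantifiers restricted to internal sets, as internal
    separation demands; it agrees with \<open>bijection\<close> for internal
    \<open>f\<close>.\<close>
  define bij where "bij f j \<longleftrightarrow> (\<forall>p\<in>elts f. \<exists>x\<in>elts y. \<exists>z\<in>elts j. p = pair x z) \<and>
    (\<forall>x\<in>elts y. \<exists>!z. z \<in> II \<and> pair x z \<^bold>\<in> f) \<and>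
    (\<forall>z\<in>elts j. \<exists>!x. x \<in> II \<and> x \<in> elts y \<and> pair x z \<^bold>\<in> f)" for f j
  have bij: "bij f j \<longleftrightarrow> bijection f y j" if "f \<in> II" for f j
  proof -
    have "z \<in> II \<and> pair x z \<^bold>\<in> f \<longleftrightarrow> pair x z \<^bold>\<in> f"
      "x \<in> II \<and> x \<in> elts y \<and> pair x z \<^bold>\<in> f \<longleftrightarrow> x \<in> elts y \<and> pair x z \<^bold>\<in> f" for x z
      using pair_mem_internal(3,4)[OF that] by auto
    then show ?thesis unfolding bij_def bijection_iff func_def by simp
  qed
  have "intl.dfn (\<lambda>e. \<exists>f\<in>II. bij f (e 0))"
    unfolding bij_def by (intro intl.dfn_intros intl.dtm_const y(1))
  from separation_internal[OF int_ordinalD(1)[OF k'] this] obtain S where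
    S: "S \<in> II" "elts S = {j \<in> elts (suc k). \<exists>f\<in>II. bij f j}" by (elim bexE)
  have S': "elts S = {j \<in> elts (suc k). int_equinumerous y j}"
    unfolding S(2) int_equinumerous_def using bij by auto
  have "elts S \<subseteq> elts (suc k)" "elts S \<noteq> {}" using S' y(2) by auto
  from int_ordinalD(4)[OF k' S(1) this] obtain m where m: "m \<in> elts S" "elts m \<inter> elts S = {}"
    by (elim bexE)
  then have mk: "m \<in> elts (suc k)" "int_equinumerous y m" using S' by auto
  have "\<not> int_equinumerous y j" if j: "j \<in> elts m" for j
  proof
    assume "int_equinumerous y j"
    moreover have "j \<in> elts (suc k)" using int_ordinalD(2)[OF k' mk(1)] j by auto
    ultimately show False using S' m(2) j by auto
  qed
  then show ?thesis using int_ordinal_elt[OF k' mk(1)] mk(2) by auto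
qed

text \<open>The ordinals on which \<open>g\<close> is defined form an internal set, which therefore overspills
  the natural numbers.\<close>

lemma Sigma_ss2_hyperfinite_subset:
  assumes Y: "Sigma_ss2 Y" "\<not> standard_size Y"
  shows "(\<exists>k y. int_ordinal k \<and> y \<in> II \<and> elts y \<subseteq> elts Y \<and> int_equinumerous y k \<and> \<not> finite_set y) \<and>
    (\<forall>n\<in>NN. \<exists>y\<in>II. elts y \<subseteq> elts Y \<and> int_equinumerous y n)"
proof -
  have "elts omega \<subseteq> II" "standard_size omega"
    using NN_subset_II by (auto simp: elts_omega intro: standard_size_VV[OF omega_VV])
  from Sigma_ss2_partial_inj[OF Y this] obtain g where g: "g \<in> II" "partial_inj g"
    "\<forall>n\<in>NN. \<exists>y. pair n y \<^bold>\<in> g" "\<forall>x y. pair x y \<^bold>\<in> g \<longrightarrow> y \<in> elts Y"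
    unfolding elts_omega by (elim bexE conjE)
  have sub: "gval g ` elts k \<subseteq> elts Y" if "\<forall>u\<in>elts k. \<exists>v. pair u v \<^bold>\<in> g" for k
    using that g(4) gval[OF g(1,2)] by auto
  obtain W where W: "W \<in> II" "NN \<subseteq> elts W" "\<forall>k\<in>elts W. int_ordinal k"
    using ex_internal_ordinals by (elim bexE conjE)
  have "intl.dfn (\<lambda>e. \<forall>u\<in>elts (e 0). \<exists>v\<in>II. pair u v \<^bold>\<in> g)"
    by (intro intl.dfn_intros intl.dtm_const g(1))
  from separation_internal[OF W(1) this] obtain S where
    S: "S \<in> II" "elts S = {k \<in> elts W. \<forall>u\<in>elts k. \<exists>v\<in>II. pair u v \<^bold>\<in> g}" by (elim bexE)
  have S': "elts S = {k \<in> elts W. \<forall>u\<in>elts k. \<exists>v. pair u v \<^bold>\<in> g}"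
  proof -
    have "(\<exists>v\<in>II. pair u v \<^bold>\<in> g) \<longleftrightarrow> (\<exists>v. pair u v \<^bold>\<in> g)" for u
      using pair_mem_internal(4)[OF g(1), of u] by blast
    then show ?thesis unfolding S(2) by simp
  qed
  have dom_NN: "\<forall>u\<in>elts n. \<exists>v. pair u v \<^bold>\<in> g" if "n \<in> NN" for n
    using elts_NN[OF that] g(3) by auto
  then have "NN \<subseteq> elts S" unfolding S' using W(2) by auto
  \<comment> \<open>\<open>S\<close> is internal and \<open>omega\<close> is not, so
    \<open>S\<close> has an element outside \<open>NN\<close>.\<close>
  moreover have "elts S \<noteq> NN"
  proof
    assume "elts S = NN"
    then have "S = omega" by (intro elts_eqI) (simp add: elts_omega)
    then show False using S(1) omega_not_internal by simp
  qed
  ultimately obtain k where k: "k \<in> elts S" "k \<notin> NN" by auto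
  then have ok: "int_ordinal k" "\<forall>u\<in>elts k. \<exists>v. pair u v \<^bold>\<in> g" using S' W(3) by auto
  \<comment> \<open>By linearity the alternatives are that \<open>k\<close> equals n or belongs to
    n, and either would put \<open>k\<close> into \<open>NN\<close>.\<close>
  have NNk: "NN \<subseteq> elts k"
  proof
    fix n assume n: "n \<in> NN"
    then show "n \<in> elts k"
      using int_ordinal_linear[OF int_ordinal_NN[OF n] ok(1)] elts_NN[OF n] k(2) by auto
  qed
  obtain y where y: "y \<in> II" "elts y = gval g ` elts k" "int_equinumerous y k"
    using ex_internal_image[OF g(1,2) int_ordinalD(1)[OF ok(1)] ok(2)] by (elim bexE conjE)
  have "\<not> finite_set y"
  proof (rule infinite_of_injection[where h = "gval g"])
    show "univ.dtm (\<lambda>e. gval g (e 0))" by (intro dtm_gval univ.dtm_var)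
    show "gval g ` NN \<subseteq> elts y" unfolding y(2) using NNk by (rule image_mono)
    show "inj_on (gval g) NN"
    proof (rule inj_onI)
      fix m n assume mn: "m \<in> NN" "n \<in> NN" "gval g m = gval g n"
      obtain u v where "pair m u \<^bold>\<in> g" "pair n v \<^bold>\<in> g"
        using g(3)[THEN bspec, OF mn(1)] g(3)[THEN bspec, OF mn(2)] by (elim exE)
      then show "m = n" using gval[OF g(1,2)] mn(3) partial_injD[OF g(2)] by auto
    qed
  qed
  then have "\<exists>k y. int_ordinal k \<and> y \<in> II \<and> elts y \<subseteq> elts Y \<and> int_equinumerous y k \<and> \<not> finite_set y"
    using ok y sub[OF ok(2)] by (intro exI[of _ k] exI[of _ y]) simp
  moreover have "\<exists>y\<in>II. elts y \<subseteq> elts Y \<and> int_equinumerous y n" if n: "n \<in> NN" for n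
  proof -
    obtain y where "y \<in> II" "elts y = gval g ` elts n" "int_equinumerous y n"
      using ex_internal_image[OF g(1,2) int_ordinalD(1)[OF int_ordinal_NN[OF n]] dom_NN[OF n]]
      by (elim bexE conjE)
    then show ?thesis using sub[OF dom_NN[OF n]] by (intro bexI[of _ y]) auto
  qed
  ultimately show ?thesis by simp
qed

text \<open>Natural numbers arise as cardinals of images of the initial segments n. The inclusion is
  strict because the cardinal of an infinite internal subset cannot lie in \<open>NN\<close>: an
  internal bijection with a natural number would make it finite.\<close>

theorem NN_psubset_spn:
  assumes Y: "Sigma_ss2 Y" "\<not> standard_size Y"
  shows "NN \<subset> spn Y"
proof
  show "NN \<subseteq> spn Y"
  proof
    fix n assume n: "n \<in> NN"
    then obtain y where y: "y \<in> II" "elts y \<subseteq> elts Y" "int_equinumerous y n"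
      using Sigma_ss2_hyperfinite_subset[OF Y] by auto
    then have "n = int_card y" using int_card_NN[OF n] by simp
    then show "n \<in> spn Y" unfolding spn_def using y by auto
  qed
  obtain k y where k: "int_ordinal k" and y: "y \<in> II" "elts y \<subseteq> elts Y" "int_equinumerous y k" "\<not> finite_set y"
    using Sigma_ss2_hyperfinite_subset[OF Y] by auto
  obtain m where m: "int_ordinal m" "int_equinumerous y m" "\<forall>j\<in>elts m. \<not> int_equinumerous y j"
    using ex_least_equinumerous[OF k y(1,3)] by (elim exE conjE)
  have "m \<in> spn Y" unfolding spn_def using int_card_eq[OF m] y(1,2) by auto
  moreover have "m \<notin> NN"
    using m(2) y(4) unfolding finite_set_def int_equinumerous_def by auto
  ultimately show "NN \<noteq> spn Y" by auto
qed

subsection \<open>Comparison of effective cardinals\<close>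

lemma internal_family_lam:
  assumes h: "univ.dtm (\<lambda>e. h (e 0))" and rng: "h ` elts (prodset A B) \<subseteq> II"
  shows "internal_family (lam (prodset A B) h) A B"
  unfolding internal_family_def
  using elts_prodset[of A B] rng elts_replset[OF h, of "prodset A B"]
  by (intro exI[of _ "prodset A B"] exI[of _ "replset (prodset A B) h"] conjI func_lam[OF h]) auto

text \<open>Singletons of internal sets are internal, so \<open>X\<close> is a union of internal
  singletons indexed by an element of \<open>VV\<close>; this one union counts as either
  form.\<close>

lemma Delta_ss2_of_standard_size:
  assumes X: "elts X \<subseteq> II" "standard_size X"
  shows "Delta_ss2 X"
proof -
  obtain v f where v: "v \<in> VV" "bijection f X v" using X(2) unfolding standard_size_def by (elim bexE exE)
  define q where "q = lam v (inv_app X f)"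
  have "bijection q v X" unfolding q_def by (rule bijection_inverse[OF v(2)])
  then have q: "func q v X" "app q ` elts v = elts X" by (auto simp: bijection_def bij_betw_def)
  have aq: "appx q a = app q a" "app q a \<in> II" if "a \<in> elts v" for a
    using func_app(1,3)[OF q(1) that] X(1) by auto
  \<comment> \<open>A one-point index set makes the intersection trivial, the inner one in the Sigma
    form and the outer one in the Pi form.\<close>
  define one where "one = upair zero zero"
  have one: "one \<in> VV" "elts one = {zero}" unfolding one_def by (simp_all add: upair_VV zero_VV elts_upair)
  define h where "h p = upair (appx q (fst_of v one p)) (appx q (fst_of v one p))" for p
  define h' where "h' p = upair (appx q (snd_of one v p)) (appx q (snd_of one v p))" for p
  have h: "univ.dtm (\<lambda>e. h (e 0))" "univ.dtm (\<lambda>e. h' (e 0))"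
    unfolding h_def h'_def by (intro dfn_rules dtm_appx dtm_fst_of dtm_snd_of)+
  have h_val: "h (pair a zero) = upair (app q a) (app q a)" "h' (pair zero a) = upair (app q a) (app q a)"
    if "a \<in> elts v" for a
    using that by (simp_all add: h_def h'_def fst_of snd_of one(2) aq)
  have rng: "h ` elts (prodset v one) \<subseteq> II" "h' ` elts (prodset one v) \<subseteq> II"
    unfolding elts_prodset one(2) by (auto simp: h_val intro!: upair_II aq(2))
  have ap: "app (lam (prodset v one) h) (pair a zero) = upair (app q a) (app q a)"
    "app (lam (prodset one v) h') (pair zero a) = upair (app q a) (app q a)" if "a \<in> elts v" for a
    using that by (simp_all add: app_lam h elts_prodset one(2) h_val)
  have "elts X = (\<Union>a\<in>elts v. \<Inter>b\<in>elts one. elts (app (lam (prodset v one) h) (pair a b)))"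
    unfolding q(2)[symmetric] one(2) by (auto simp: ap elts_upair)
  moreover have "elts X = (\<Inter>a\<in>elts one. \<Union>b\<in>elts v. elts (app (lam (prodset one v) h') (pair a b)))"
    unfolding q(2)[symmetric] one(2) by (auto simp: ap elts_upair)
  ultimately show ?thesis
    unfolding Delta_ss2_def Sigma_ss2_def Pi_ss2_def
    using v(1) one(1) internal_family_lam[OF h(1) rng(1)] internal_family_lam[OF h(2) rng(2)]
    by (intro conjI bexI exI)
qed

theorem card_eff_less_of_standard_size:
  assumes X: "elts X \<subseteq> II" "standard_size X" and Y: "Sigma_ss2 Y" "\<not> standard_size Y"
  shows "card_eff_less X Y"
  unfolding card_eff_less_def
proof
  obtain g where g: "g \<in> II" "partial_inj g" "\<forall>x\<in>elts X. \<exists>y. pair x y \<^bold>\<in> g" "\<forall>x y. pair x y \<^bold>\<in> g \<longrightarrow> y \<in> elts Y"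
    using Sigma_ss2_partial_inj[OF Y X] by (elim bexE conjE)
  have h: "univ.dtm (\<lambda>e. gval g (e 0))" by (intro dtm_gval univ.dtm_var)
  have val: "pair x (gval g x) \<^bold>\<in> g" if x: "x \<in> elts X" for x
  proof -
    obtain y where "pair x y \<^bold>\<in> g" using g(3) x by auto
    then show ?thesis using gval[OF g(1,2)] by simp
  qed
  define f where "f = lam X (gval g)"
  have "func f X Y" unfolding f_def by (rule func_lam[OF h]) (use val g(4) in auto)
  moreover have "inj_on (app f) (elts X)"
    unfolding f_def
  proof (rule inj_onI)
    fix x x' assume x: "x \<in> elts X" "x' \<in> elts X" "app (lam X (gval g)) x = app (lam X (gval g)) x'"
    then have "gval g x = gval g x'" by (simp add: app_lam[OF h])
    then show "x = x'" using partial_injD[OF g(2) val[OF x(1)] val[OF x(2)]] by simp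
  qed
  ultimately have "injection f X Y" by (simp add: injection_def)
  moreover have "Delta_ss2 f"
  proof (rule Delta_ss2_of_standard_size)
    have f: "elts f = (\<lambda>x. pair x (gval g x)) ` elts X"
      unfolding f_def lam_def by (intro elts_replset univ.dtm_pair h univ.dtm_var)
    show "elts f \<subseteq> II" unfolding f using val g(1) by (auto intro: transitivity_of_II)
    show "standard_size f"
      by (rule standard_size_image[OF X(2), of "\<lambda>x. pair x (gval g x)"])
        (auto simp: f intro: univ.dtm_pair h univ.dtm_var)
  qed
  ultimately show "card_eff_le X Y" unfolding card_eff_le_def by (intro exI conjI)
  \<comment> \<open>An injection of \<open>Y\<close> into \<open>X\<close> would carry standard size
    from \<open>X\<close> back to \<open>Y\<close>.\<close>
  show "\<not> card_eff_le Y X"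
  proof
    assume "card_eff_le Y X"
    then obtain q where q: "func q Y X" "inj_on (app q) (elts Y)"
      unfolding card_eff_le_def injection_def by (elim exE conjE)
    have aq: "appx q y = app q y" "app q y \<in> elts X" if "y \<in> elts Y" for y
      using func_app(1,3)[OF q(1) that] by auto
    have "standard_size Y"
    proof (rule standard_size_inj[OF X(2)])
      show "univ.dtm (\<lambda>e. appx q (e 0))" by (intro dtm_appx dfn_rules)
      show "inj_on (appx q) (elts Y)" using q(2) aq(1) by (simp add: inj_on_def)
    qed (use aq in auto)
    then show False using Y(2) by simp
  qed
qed

theorem infinite_internal_subset:
  assumes Y: "Sigma_ss2 Y" "\<not> standard_size Y"
  shows "\<exists>y\<in>II. elts y \<subseteq> elts Y \<and> \<not> finite_set y"
  using Sigma_ss2_hyperfinite_subset[OF Y] by auto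

end

theorem theorem4p2:
  fixes mem :: "'u \<Rightarrow> 'u \<Rightarrow> bool" and st :: "'u \<Rightarrow> bool"
  assumes "HST mem st"
  shows
    "(\<forall>x \<in> st_structure.II mem st.
        \<not> st_structure.finite_set mem x \<longrightarrow> \<not> st_structure.standard_size mem x) \<and>
     (\<forall>X. st_structure.Delta_ss2 mem st X \<and> \<not> st_structure.standard_size mem X \<longrightarrow>
        (\<exists>y \<in> st_structure.II mem st.
           st_structure.elts mem y \<subseteq> st_structure.elts mem X \<and>
           \<not> st_structure.finite_set mem y)) \<and>
     (\<forall>X. st_structure.Delta_ss2 mem st X \<and> \<not> st_structure.standard_size mem X \<longrightarrow>
        st_structure.NN mem \<subset> st_structure.spn mem st X) \<and>
     (\<forall>X Y. st_structure.elts mem X \<subseteq> st_structure.II mem st \<and>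
        st_structure.standard_size mem X \<and>
        st_structure.Delta_ss2 mem st Y \<and> \<not> st_structure.standard_size mem Y \<longrightarrow>
        st_structure.card_eff_less mem st X Y)"
proof -
  interpret HST mem st by (rule assms)
  have "Sigma_ss2 X" if "Delta_ss2 X" for X using that by (simp add: Delta_ss2_def)
  then show ?thesis
    using infinite_internal_not_standard_size infinite_internal_subset NN_psubset_spn
      card_eff_less_of_standard_size by (intro conjI allI impI ballI) auto
qed

end
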